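(* Let $(X_1,X_2,X_3=W)$ be a trivariate stationary Gaussian random field on $\mathbb R^d$ with strictly positive definite matrix covariance function $K=(K_{k\ell})_{1\le k,\ell\le3}$, where the $K_{k\ell}$ satisfy the smoothness condition $\mathrm A_d$ of the context for some $L>0$ with exponents $\alpha_{k\ell}$. Let $Y=\beta_1X_1+\beta_2X_2+W$ and let $(Y,X_1,X_2)$ be observed. For $v=(v_1,v_2)^T\in\mathbb R^2$ let $X_v=v_1X_1+v_2X_2$, and denote the covariance of $X_v$ by $K_{vv}$ and the cross-covariance of $X_v$ and $W$ by $K_{v3}$. Then $\beta=(\beta_1,\beta_2)^T$ is consistently estimable if for all $v\ne0$, $K_{vv}$ and $K_{v3}$ satisfy the smoothness condition with exponents $\alpha_{vv}$ and $\alpha_{v3}$ such that $$\alpha_{vv}<\min\{\alpha_{v3},\ \alpha_{33}+1\}.$$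
   Context: Condition $\mathrm A(L,c,\alpha)$ for a function $K$ on $\mathbb R$: $K(t)=A(t)+B(t)$, where $A$ is even and analytic and $B$ is even and continuous on $[-L,L]$; the $k$-th derivative $B^{(k)}$ on $(0,L]$ ($k\ge0$, $B^{(0)}=B$) satisfies, as $t\downarrow0$, $B^{(k)}(t)=(\alpha)_k\,c\,t^{\alpha-k}+o(t^{\alpha-k})$, where $c$ is a constant (non-zero for covariance functions, possibly zero for cross-covariances), $\alpha>0$ is not an even integer, $(\alpha)_k=\Gamma(\alpha+1)/\Gamma(\alpha+1-k)$. Condition $\mathrm A_d$ (exponent $\alpha$) for a (cross-)covariance function $C$ on $\mathbb R^d$: cross-covariances are symmetric ($C_{k\ell}=C_{\ell k}$), and $C(u)=K(\|u\|)+r(u)$, where $K$ (extended evenly to $\mathbb R$) satisfies $\mathrm A(L,c,\alpha)$ and $r(u)=o(\|u\|^{\alpha})$ with all $p$-th order mixed partial derivatives of $r$ at $u\ne0$ being $o(\|u\|^{\alpha-p})$ as $u\to0$. For $d=1$ this can be taken to be $\mathrm A(L,c,\alpha)$. $\beta$ is consistently estimable if there is a sequence of measurable functions of $\{(Y(s),X_1(s),X_2(s)):s\in[0,L]^d\}$ converging in probability to $\beta$. *)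

theory Defs
  imports "HOL-Probability.Probability"
begin

section \<open>Gaussian random fields with several components\<close>

definition cov :: "'w measure \<Rightarrow> ('w \<Rightarrow> real) \<Rightarrow> ('w \<Rightarrow> real) \<Rightarrow> real" where
  "cov M U V = (\<integral>\<omega>. (U \<omega> - (\<integral>\<omega>'. U \<omega>' \<partial>M)) * (V \<omega> - (\<integral>\<omega>'. V \<omega>' \<partial>M)) \<partial>M)"

text \<open>Degenerate (almost surely constant) variables count as Gaussian.\<close>

definition gaussian_rv :: "'w measure \<Rightarrow> ('w \<Rightarrow> real) \<Rightarrow> bool" where
  "gaussian_rv M Z \<longleftrightarrow> Z \<in> borel_measurable M \<and>
     ((\<exists>\<mu> \<sigma>. \<sigma> > 0 \<and> distributed M lborel Z (normal_density \<mu> \<sigma>)) \<or>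
      (\<exists>\<mu>. AE \<omega> in M. Z \<omega> = \<mu>))"

definition gaussian_field :: "'w measure \<Rightarrow> ('k \<Rightarrow> 's \<Rightarrow> 'w \<Rightarrow> real) \<Rightarrow> bool" where
  "gaussian_field M X \<longleftrightarrow>
     (\<forall>T a. finite T \<longrightarrow> gaussian_rv M (\<lambda>\<omega>. \<Sum>(k, s)\<in>T. a k s * X k s \<omega>))"

text \<open>For a Gaussian field, stationarity means that the mean is constant (not necessarily zero)
  and that the covariances depend on the lag only; \<open>K\<close> is then the matrix covariance
  function.\<close>

definition stationary_with_cov ::
  "'w measure \<Rightarrow> ('k::finite \<Rightarrow> real ^ 'd \<Rightarrow> 'w \<Rightarrow> real) \<Rightarrow> (real ^ 'd \<Rightarrow> real ^ 'k ^ 'k) \<Rightarrow> bool"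
  where
  "stationary_with_cov M X K \<longleftrightarrow>
     (\<forall>k s t. (\<integral>\<omega>. X k s \<omega> \<partial>M) = (\<integral>\<omega>. X k t \<omega> \<partial>M)) \<and>
     (\<forall>k l s u. cov M (X k (s + u)) (X l s) = K u $ k $ l)"

definition strictly_pos_def :: "(real ^ 'd \<Rightarrow> real ^ 'k ^ 'k) \<Rightarrow> bool" where
  "strictly_pos_def K \<longleftrightarrow>
     (\<forall>T a. finite T \<and> (\<exists>s\<in>T. a s \<noteq> 0) \<longrightarrow>
        (\<Sum>s\<in>T. \<Sum>t\<in>T. a s \<bullet> (K (s - t) *v a t)) > 0)"

text \<open>The (cross-)covariance function of two jointly stationary scalar fields.\<close>

definition cross_cov_fun ::
  "'w measure \<Rightarrow> (real ^ 'd \<Rightarrow> 'w \<Rightarrow> real) \<Rightarrow> (real ^ 'd \<Rightarrow> 'w \<Rightarrow> real) \<Rightarrow> real ^ 'd \<Rightarrow> real"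
  where "cross_cov_fun M U V u = cov M (U u) (V 0)"


section \<open>The smoothness conditions\<close>

definition real_analytic_at :: "(real \<Rightarrow> real) \<Rightarrow> real \<Rightarrow> bool" where
  "real_analytic_at f x \<longleftrightarrow> (\<exists>F. (\<lambda>h. f (x + h)) has_fps_expansion F)"

text \<open>When \<open>\<alpha> + 1 - k\<close> is a pole of \<open>Gamma\<close>, the value \<open>Gamma (\<alpha> + 1 - k) = 0\<close> and
  \<open>x / 0 = 0\<close> make this zero, as it should be.\<close>

definition falling_fact :: "real \<Rightarrow> nat \<Rightarrow> real" where
  "falling_fact \<alpha> k = Gamma (\<alpha> + 1) / Gamma (\<alpha> + 1 - real k)"

text \<open>\<open>D k\<close> is the \<open>k\<close>-th derivative of \<open>B\<close> on \<open>(0, L]\<close>, one-sided at \<open>L\<close>.  Nothing is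
  required of \<open>K\<close>, \<open>A\<close> and \<open>B\<close> away from \<open>[-L, L]\<close> (a neighbourhood of it for the
  analyticity of \<open>A\<close>).\<close>

definition condition_A :: "real \<Rightarrow> real \<Rightarrow> real \<Rightarrow> (real \<Rightarrow> real) \<Rightarrow> bool" where
  "condition_A L c \<alpha> K \<longleftrightarrow>
     \<alpha> > 0 \<and> (\<forall>n::nat. \<alpha> \<noteq> 2 * real n) \<and>
     (\<exists>A B.
        (\<forall>t\<in>{-L..L}. K t = A t + B t) \<and>
        (\<forall>t\<in>{-L..L}. A (- t) = A t \<and> real_analytic_at A t) \<and>
        (\<forall>t\<in>{-L..L}. B (- t) = B t) \<and> continuous_on {-L..L} B \<and>
        (\<exists>D. D 0 = B \<and>
           (\<forall>k::nat. \<forall>t\<in>{0<..L}. (D k has_real_derivative D (Suc k) t) (at t within {0<..L})) \<and>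
           (\<forall>k. (\<lambda>t. D k t - falling_fact \<alpha> k * c * t powr (\<alpha> - real k))
                  \<in> o[at_right 0](\<lambda>t. t powr (\<alpha> - real k)))))"

text \<open>\<open>D [i\<^sub>1, \<dots>, i\<^sub>p]\<close> is the mixed partial derivative of order \<open>p\<close> of \<open>r\<close> on the complement
  of the origin, with respect to the coordinates \<open>i\<^sub>1, \<dots>, i\<^sub>p\<close>.  The filter \<open>nhds 0\<close> in the
  bound on \<open>r\<close> includes the origin, so that \<open>r 0 = 0\<close>: a discontinuity (nugget) of \<open>C\<close> at the
  origin is excluded.\<close>

definition condition_Ad :: "real \<Rightarrow> real \<Rightarrow> real \<Rightarrow> (real ^ 'd \<Rightarrow> real) \<Rightarrow> bool" where
  "condition_Ad L c \<alpha> C \<longleftrightarrow>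
     (\<exists>K r.
        (\<forall>u. C u = K (norm u) + r u) \<and>
        (\<forall>t. K (- t) = K t) \<and> condition_A L c \<alpha> K \<and>
        r \<in> o[nhds 0](\<lambda>u. norm u powr \<alpha>) \<and>
        (\<exists>D :: 'd list \<Rightarrow> real ^ 'd \<Rightarrow> real. D [] = r \<and>
           (\<forall>is i u. u \<noteq> 0 \<longrightarrow>
              ((\<lambda>h. D is (u + h *\<^sub>R axis i 1)) has_real_derivative D (i # is) u) (at 0)) \<and>
           (\<forall>is. D is \<in> o[at 0](\<lambda>u. norm u powr (\<alpha> - real (length is))))))"


section \<open>Consistent estimability\<close>

definition tendsto_in_prob ::
  "'w measure \<Rightarrow> (nat \<Rightarrow> 'w \<Rightarrow> 'p::metric_space) \<Rightarrow> 'p \<Rightarrow> bool" where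
  "tendsto_in_prob M Z z \<longleftrightarrow>
     (\<forall>\<epsilon>>0. (\<lambda>n. measure M {\<omega> \<in> space M. dist (Z n \<omega>) z > \<epsilon>}) \<longlonglongrightarrow> 0)"

text \<open>\<open>Z \<theta>\<close> is the random field observed on \<open>S\<close> when the parameter equals \<open>\<theta>\<close>.  The
  estimators \<open>f n\<close> must not depend on \<open>\<theta>\<close>; otherwise the constants \<open>f n = \<theta>\<close> would do.\<close>

definition consistently_estimable ::
  "'w measure \<Rightarrow> 's set \<Rightarrow> ('p::metric_space \<Rightarrow> 's \<Rightarrow> 'w \<Rightarrow> 'z::topological_space) \<Rightarrow> bool"
  where
  "consistently_estimable M S Z \<longleftrightarrow>
     (\<exists>f :: nat \<Rightarrow> ('s \<Rightarrow> 'z) \<Rightarrow> 'p.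
        (\<forall>n. f n \<in> borel_measurable (PiM S (\<lambda>_. borel))) \<and>
        (\<forall>\<theta>. tendsto_in_prob M (\<lambda>n \<omega>. f n (\<lambda>s\<in>S. Z \<theta> s \<omega>)) \<theta>))"

definition cube :: "real \<Rightarrow> (real ^ 'd) set" where
  "cube L = {s. \<forall>i. 0 \<le> s $ i \<and> s $ i \<le> L}"

definition lin_comb_field ::
  "real ^ 2 \<Rightarrow> (3 \<Rightarrow> real ^ 'd \<Rightarrow> 'w \<Rightarrow> real) \<Rightarrow> real ^ 'd \<Rightarrow> 'w \<Rightarrow> real" where
  "lin_comb_field v X s \<omega> = v $ 1 * X 1 s \<omega> + v $ 2 * X 2 s \<omega>"

definition response ::
  "real ^ 2 \<Rightarrow> (3 \<Rightarrow> real ^ 'd \<Rightarrow> 'w \<Rightarrow> real) \<Rightarrow> real ^ 'd \<Rightarrow> 'w \<Rightarrow> real" where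
  "response \<beta> X s \<omega> = \<beta> $ 1 * X 1 s \<omega> + \<beta> $ 2 * X 2 s \<omega> + X 3 s \<omega>"

end

theory Submission
  imports Defs
begin

text \<open>
  Restricted to a short segment on a coordinate axis, each covariance is asymptotically
  the sum of a smooth even part and of a multiple of \<open>\<bar>t\<bar> powr \<alpha>\<close>.
  Contrasts of order \<open>m\<close> on a grid of mesh \<open>h\<close> remove the smooth part:
  if \<open>2 m\<close> is large, the variance of a contrast of \<open>X\<^sub>v\<close> is asymptotically a positive multiple of
  \<open>h\<close> to the power \<open>\<alpha>\<^sub>v\<^sub>v\<close>, and the correlations of two contrasts decay quadratically in their lag.
  Since there are about \<open>1 / h\<close> contrasts, the least squares coefficient of \<open>W\<close> on \<open>X\<^sub>v\<close> has a bias
  of order \<open>\<alpha>\<^sub>v\<^sub>3 - \<alpha>\<^sub>v\<^sub>v\<close> and a variance of order \<open>\<alpha>\<^sub>3\<^sub>3 + 1 - \<alpha>\<^sub>v\<^sub>v\<close> in \<open>h\<close>.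

  For two regressors one chooses a basis \<open>v\<close>, \<open>w\<close> of the plane, with \<open>X\<^sub>v\<close> at least as rough
  as \<open>X\<^sub>w\<close>, for which the contrasts of \<open>X\<^sub>v\<close> and \<open>X\<^sub>w\<close> have a covariance that is negligible
  against the variance for \<open>X\<^sub>v\<close>.  The simple regression on \<open>X\<^sub>v\<close> then estimates the first coefficient,
  and the regression of the residual on \<open>X\<^sub>w\<close> estimates the second one, provided that
  the first regression uses a much finer grid.
\<close>


section \<open>Finite differences\<close>

text \<open>Two obstacles shape the argument. The limit of the contrast variance must not vanish.
  Its constant is, up to sign, \<open>c\<close> times the \<open>2 m\<close>-th central difference
  of \<open>\<bar>x\<bar> powr \<alpha>\<close> at 0, and this is non-zero because the even integers
  below \<open>2 m\<close> already exhaust the possible zeros in \<alpha>. Quadratic decay needs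
  \<open>2 m \<ge> \<alpha> + 2\<close>, since the \<open>2 m\<close>-th derivative of the irregular
  part is of order \<open>t powr (\<alpha> - 2 m)\<close>; then averaging about \<open>1 / h\<close>
  products of contrasts gains a factor \<open>h\<close>, which is the \<open>1\<close> in
  \<open>\<alpha>\<^sub>3\<^sub>3 + 1\<close>. The second obstacle is that two regressors may differ
  in roughness. Their empirical cross moment is negligible only against the variance of the rougher
  one; its ratio to the variance of the smoother one is not controlled, so the coefficients are
  found one after the other. That no direction is rougher than the rougher coordinate direction
  follows from positive semidefiniteness, and cross-covariances of regressors are controlled by
  polarisation through \<open>v\<close>, \<open>w\<close> and \<open>v + w\<close>. Gaussianity
  enters only through fourth moments: Isserlis' formula bounds the variances that go into
  Chebyshev's inequality.\<close>

definition fdiff :: "real \<Rightarrow> (real \<Rightarrow> 'a::ab_group_add) \<Rightarrow> real \<Rightarrow> 'a" where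
  "fdiff h f x = f (x + h) - f x"

lemma fdiff_funpow_Suc: "(fdiff h ^^ Suc m) f x = (fdiff h ^^ m) f (x + h) - (fdiff h ^^ m) f x"
  by (simp add: fdiff_def)

lemma fdiff_funpow_lin:
  fixes f g :: "real \<Rightarrow> real"
  shows "(fdiff h ^^ m) (\<lambda>x. a * f x + b * g x) x = a * (fdiff h ^^ m) f x + b * (fdiff h ^^ m) g x"
proof (induction m arbitrary: x)
  case (Suc m)
  then show ?case
    unfolding fdiff_funpow_Suc by (simp add: algebra_simps)
qed simp

lemma fdiff_funpow_add:
  fixes f g :: "real \<Rightarrow> real"
  shows "(fdiff h ^^ m) (\<lambda>x. f x + g x) x = (fdiff h ^^ m) f x + (fdiff h ^^ m) g x"
  using fdiff_funpow_lin[of m h 1 f 1 g x] by simp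

text \<open>The sign is written with \<open>m + j\<close> instead of \<open>m - j\<close>, which has
  the same parity and avoids truncated subtraction.\<close>

lemma fdiff_funpow_sum:
  fixes f :: "real \<Rightarrow> real"
  shows "(fdiff h ^^ m) f x = (\<Sum>j\<le>m. (-1) ^ (m + j) * real (m choose j) * f (x + real j * h))"
proof (induction m arbitrary: x)
  case (Suc m)
  let ?w = "\<lambda>m j. (-1) ^ (m + j) * real (m choose j)"
  have "(\<Sum>j\<le>Suc m. ?w (Suc m) j * f (x + real j * h))
      = ?w (Suc m) 0 * f x + (\<Sum>j\<le>m. ?w (Suc m) (Suc j) * f (x + h + real j * h))"
    by (subst sum.atMost_Suc_shift) (simp add: algebra_simps)
  also have "(\<Sum>j\<le>m. ?w (Suc m) (Suc j) * f (x + h + real j * h))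
     = (\<Sum>j\<le>m. ?w m j * f (x + h + real j * h)) - (\<Sum>j\<le>m. (-1) ^ (m + Suc j) * real (m choose Suc j) * f (x + real (Suc j) * h))"
    unfolding sum_subtractf[symmetric] by (intro sum.cong) (auto simp: algebra_simps)
  also have "(\<Sum>j\<le>m. (-1) ^ (m + Suc j) * real (m choose Suc j) * f (x + real (Suc j) * h))
     = (\<Sum>j\<le>Suc m. ?w m j * f (x + real j * h)) - ?w m 0 * f x"
    by (subst sum.atMost_Suc_shift) simp
  also have "(\<Sum>j\<le>Suc m. ?w m j * f (x + real j * h)) = (\<Sum>j\<le>m. ?w m j * f (x + real j * h))"
    by simp
  finally show ?case
    unfolding fdiff_funpow_Suc Suc by simp
qed simp

text \<open>Only the grid points enter. Hence a local expansion may replace a covariance function,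
  and a restricted path the full one.\<close>

lemma fdiff_funpow_cong:
  assumes "\<And>j. j \<le> m \<Longrightarrow> f (x + real j * h) = g (x + real j * h)"
  shows "(fdiff h ^^ m) f x = (fdiff h ^^ m) (g :: real \<Rightarrow> real) x"
  unfolding fdiff_funpow_sum using assms by (intro sum.cong) auto

text \<open>Each difference gains a factor \<open>h\<close> by the mean value theorem. The
  derivative family \<open>D\<close> is generalised in the induction, because its differences
  \<open>E\<close> form again such a family, with one order less to go.\<close>

lemma fdiff_funpow_bound:
  fixes D :: "nat \<Rightarrow> real \<Rightarrow> real"
  assumes "h > 0"
    and "\<And>k t. k < N \<Longrightarrow> x \<le> t \<Longrightarrow> t \<le> x + real N * h \<Longrightarrow> (D k has_real_derivative D (Suc k) t) (at t)"
    and "\<And>t. x \<le> t \<Longrightarrow> t \<le> x + real N * h \<Longrightarrow> \<bar>D N t\<bar> \<le> C"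
  shows "\<bar>(fdiff h ^^ N) (D 0) x\<bar> \<le> C * h ^ N"
  using assms(2,3)
proof (induction N arbitrary: D C)
  case 0
  then show ?case by simp
next
  case (Suc N)
  define E where "E k t = D k (t + h) - D k t" for k t
  have "\<bar>(fdiff h ^^ N) (E 0) x\<bar> \<le> (C * h) * h ^ N"
  proof (rule Suc.IH)
    fix k t assume kt: "k < N" "x \<le> t" "t \<le> x + real N * h"
    have "(D k has_real_derivative D (Suc k) t) (at t)"
      using kt \<open>h > 0\<close> by (intro Suc.prems) (auto simp: algebra_simps)
    moreover have "(D k has_real_derivative D (Suc k) (t + h)) (at (t + h))"
      using kt \<open>h > 0\<close> by (intro Suc.prems) (auto simp: algebra_simps)
    then have "((\<lambda>t. D k (t + h)) has_real_derivative D (Suc k) (t + h)) (at t)"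
      by (simp add: DERIV_shift)
    ultimately show "(E k has_real_derivative E (Suc k) t) (at t)"
      unfolding E_def by (auto intro!: derivative_eq_intros)
  next
    fix t assume t: "x \<le> t" "t \<le> x + real N * h"
    have "\<exists>z. t < z \<and> z < t + h \<and> D N (t + h) - D N t = (t + h - t) * D (Suc N) z"
    proof (rule MVT2)
      fix z assume z: "t \<le> z" "z \<le> t + h"
      show "DERIV (D N) z :> D (Suc N) z"
        using t z \<open>h > 0\<close> by (intro Suc.prems) (auto simp: algebra_simps)
    qed (use \<open>h > 0\<close> in simp)
    then obtain z where z: "t < z" "z < t + h" "E N t = h * D (Suc N) z"
      by (auto simp: E_def)
    have "\<bar>D (Suc N) z\<bar> \<le> C"
      using t z by (intro Suc.prems) (auto simp: algebra_simps)
    then show "\<bar>E N t\<bar> \<le> C * h"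
      using \<open>h > 0\<close> z by (simp add: abs_mult)
  qed
  moreover have "E 0 = fdiff h (D 0)"
    by (auto simp: E_def fdiff_def)
  ultimately show ?case
    by (simp add: funpow_Suc_right algebra_simps del: funpow.simps)
qed

text \<open>The \<open>N\<close>-th derivative is zero, so the preceding bound applies with constant
  0.\<close>

lemma fdiff_poly_eq_0:
  fixes p :: "real poly"
  assumes "degree p < N" "h > 0"
  shows "(fdiff h ^^ N) (poly p) x = 0"
proof -
  have deg: "degree ((pderiv ^^ k) p) = degree p - k" for k
    by (induction k) (auto simp: degree_pderiv)
  have "degree ((pderiv ^^ (N - 1)) p) = 0"
    using assms deg by simp
  then have "pderiv ((pderiv ^^ (N - 1)) p) = 0"
    by (simp add: pderiv_eq_0_iff)
  then have "(pderiv ^^ Suc (N - 1)) p = 0"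
    by simp
  then have "(pderiv ^^ N) p = 0"
    using assms by simp
  then have "\<bar>(fdiff h ^^ N) ((\<lambda>k. poly ((pderiv ^^ k) p)) 0) x\<bar> \<le> 0 * h ^ N"
    by (intro fdiff_funpow_bound) (use assms(2) in \<open>auto simp: poly_DERIV\<close>)
  then show ?thesis by simp
qed

text \<open>The clause \<open>z < Max Z\<close> serves the induction: the new zero of
  \<open>f'\<close> lies beyond the previous maximum, hence differs from those found before.\<close>

lemma Rolle_zeros:
  fixes f f' :: "real \<Rightarrow> real"
  assumes "\<And>x. (f has_real_derivative f' x) (at x)" "finite Z" "\<And>z. z \<in> Z \<Longrightarrow> f z = 0"
  shows "\<exists>Z'. finite Z' \<and> card Z \<le> Suc (card Z') \<and> (\<forall>z\<in>Z'. f' z = 0 \<and> z < Max Z)"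
  using assms(2,3)
proof (induction Z rule: finite_linorder_max_induct)
  case empty
  then show ?case by (intro exI[of _ "{}"]) auto
next
  case (insert b A)
  show ?case
  proof (cases "A = {}")
    case True
    then show ?thesis by (intro exI[of _ "{}"]) auto
  next
    case False
    obtain Z' where Z': "finite Z'" "card A \<le> Suc (card Z')" "\<forall>z\<in>Z'. f' z = 0 \<and> z < Max A"
      using insert by auto
    have A: "Max A \<in> A" "Max A < b"
      using insert False by auto
    have "\<exists>z. Max A < z \<and> z < b \<and> f b - f (Max A) = (b - Max A) * f' z"
      using A assms(1) by (intro MVT2) auto
    moreover have "f b = 0" "f (Max A) = 0"
      using insert.prems A by auto
    ultimately obtain z where z: "Max A < z" "z < b" "f' z = 0"
      using A by auto
    have "z \<notin> Z'"
      using Z' z by auto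
    moreover have "Max (insert b A) = b"
      using insert by (intro Max_eqI) (auto intro: less_imp_le)
    moreover have "b \<notin> A" using insert by auto
    ultimately show ?thesis
      using Z' z A insert by (intro exI[of _ "insert z Z'"]) (auto intro: less_trans)
  qed
qed

text \<open>Division by \<open>exp (\<kappa> i * z)\<close> makes one term constant, and
  differentiation removes it. By Rolle at most one zero is lost while the sum loses one term, so the
  induction keeps at least as many zeros as terms.\<close>

lemma exp_sum_zeros:
  fixes a \<kappa> :: "'i \<Rightarrow> real"
  assumes "finite I" "inj_on \<kappa> I" "finite Z" "card I \<le> card Z"
    and "\<And>z. z \<in> Z \<Longrightarrow> (\<Sum>i\<in>I. a i * exp (\<kappa> i * z)) = 0" and "j \<in> I"
  shows "a j = 0"
  using assms
proof (induction I arbitrary: a \<kappa> Z j rule: finite_induct)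
  case (insert i I)
  define f where "f z = a i + (\<Sum>k\<in>I. a k * exp ((\<kappa> k - \<kappa> i) * z))" for z
  define f' where "f' z = (\<Sum>k\<in>I. (a k * (\<kappa> k - \<kappa> i)) * exp ((\<kappa> k - \<kappa> i) * z))" for z
  have f0: "f z = 0" if "z \<in> Z" for z
  proof -
    have "f z = exp (- \<kappa> i * z) * (\<Sum>k\<in>insert i I. a k * exp (\<kappa> k * z))"
      using insert.hyps
      by (simp add: f_def sum_distrib_left exp_add[symmetric] mult.left_commute algebra_simps)
    then show ?thesis
      using insert.prems(4)[OF that] by simp
  qed
  have "(f has_real_derivative f' z) (at z)" for z
    unfolding f_def f'_def by (auto intro!: derivative_eq_intros sum.cong)
  from Rolle_zeros[OF this insert.prems(2) f0]
  obtain Z' where Z': "finite Z'" "card Z \<le> Suc (card Z')" "\<And>z. z \<in> Z' \<Longrightarrow> f' z = 0"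
    by auto
  have "card I \<le> card Z'"
    using Z' insert.prems insert.hyps by simp
  have 0: "a k = 0" if "k \<in> I" for k
  proof -
    have "a k * (\<kappa> k - \<kappa> i) = 0"
    proof (rule insert.IH[where \<kappa> = "\<lambda>k. \<kappa> k - \<kappa> i" and a = "\<lambda>k. a k * (\<kappa> k - \<kappa> i)"])
      show "inj_on (\<lambda>k. \<kappa> k - \<kappa> i) I"
        using insert.prems(1) by (auto simp: inj_on_def)
    qed (use Z' that \<open>card I \<le> card Z'\<close> in \<open>auto simp: f'_def\<close>)
    moreover have "\<kappa> k \<noteq> \<kappa> i"
      using insert.prems(1) insert.hyps that by (auto simp: inj_on_def)
    ultimately show ?thesis by simp
  qed
  have "Z \<noteq> {}"
    using insert.prems insert.hyps by auto
  then obtain z where "z \<in> Z" by blast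
  then have "a i = 0"
    using f0[of z] 0 by (simp add: f_def)
  then show ?case
    using 0 insert.prems(5) by auto
qed simp

text \<open>The central difference at the origin with step 1. With step \<open>h\<close> it scales
  by \<open>h powr \<alpha>\<close>, so this is the leading coefficient for an irregular part
  \<open>\<bar>t\<bar> powr \<alpha>\<close>.\<close>

definition power_const :: "nat \<Rightarrow> real \<Rightarrow> real" where
  "power_const m \<alpha> = (fdiff 1 ^^ (2 * m)) (\<lambda>x. \<bar>x\<bar> powr \<alpha>) (- real m)"

text \<open>For an even integer exponent the function is a polynomial of degree
  \<open>2 * j < 2 * m\<close>. The case \<open>j = 0\<close> is excluded since
  \<open>0 powr 0 = 0\<close>, so that the function would not be the constant 1.\<close>

lemma power_const_even:
  assumes "0 < j" "j < m"
  shows "power_const m (2 * real j) = 0"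
proof -
  have "\<bar>x\<bar> powr (2 * real j) = poly (monom 1 (2 * j)) x" for x :: real
    using assms powr_realpow[of "\<bar>x\<bar>" "2 * j"]
    by (cases "x = 0") (auto simp: poly_monom power_even_abs)
  then have "power_const m (2 * real j) = (fdiff 1 ^^ (2 * m)) (poly (monom 1 (2 * j))) (- real m)"
    unfolding power_const_def by presburger
  also have "\<dots> = 0"
    using assms by (intro fdiff_poly_eq_0) (auto intro: le_less_trans[OF degree_monom_le])
  finally show ?thesis .
qed

text \<open>As a function of \<open>\<alpha>\<close> this is a sum of \<open>m\<close> exponentials, which by Rolle's theorem has at most
  \<open>m - 1\<close> zeros; these are \<open>2, 4, \<dots>, 2 m - 2\<close>.\<close>

lemma power_const_nonzero:
  assumes "\<alpha> > 0" "\<And>n::nat. \<alpha> \<noteq> 2 * real n" "m > 0"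
  shows "power_const m \<alpha> \<noteq> 0"
proof
  assume *: "power_const m \<alpha> = 0"
  define w where "w j = (-1) ^ j * real (2 * m choose j)" for j
  define a where "a i = w (m + i) + w (m - i)" for i
  \<comment> \<open>The term \<open>j = m\<close> vanishes because \<open>0 powr x = 0\<close>; the
    terms at distance \<open>i\<close> on either side of the centre are paired.\<close>
  have pc: "power_const m x = (\<Sum>i\<in>{1..m}. a i * exp (ln (real i) * x))" for x
  proof -
    have "(- 1) ^ (2 * m + j) = ((- 1) ^ j :: real)" for j
      by (simp add: power_add)
    then have "power_const m x = (\<Sum>j\<le>2 * m. w j * \<bar>real j - real m\<bar> powr x)"
      unfolding power_const_def fdiff_funpow_sum by (simp add: w_def add.commute)
    also have "\<dots> = (\<Sum>j\<in>{m}. w j * \<bar>real j - real m\<bar> powr x) + (\<Sum>j\<in>{..2*m} - {m}. w j * \<bar>real j - real m\<bar> powr x)"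
      by (subst sum.subset_diff[of "{m}"]) auto
    also have "{..2*m} - {m} = {..<m} \<union> {m<..2*m}"
      by auto
    also have "(\<Sum>j\<in>\<dots>. w j * \<bar>real j - real m\<bar> powr x) = (\<Sum>j\<in>{..<m}. w j * \<bar>real j - real m\<bar> powr x) + (\<Sum>j\<in>{m<..2*m}. w j * \<bar>real j - real m\<bar> powr x)"
      by (intro sum.union_disjoint) auto
    also have "(\<Sum>j\<in>{..<m}. w j * \<bar>real j - real m\<bar> powr x) = (\<Sum>i\<in>{1..m}. w (m - i) * real i powr x)"
      by (rule sum.reindex_bij_witness[of _ "\<lambda>i. m - i" "\<lambda>i. m - i"]) (auto simp: of_nat_diff)
    also have "(\<Sum>j\<in>{m<..2*m}. w j * \<bar>real j - real m\<bar> powr x) = (\<Sum>i\<in>{1..m}. w (m + i) * real i powr x)"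
      by (rule sum.reindex_bij_witness[of _ "\<lambda>i. m + i" "\<lambda>i. i - m"]) auto
    finally have "power_const m x = (\<Sum>i\<in>{1..m}. w (m - i) * real i powr x) + (\<Sum>i\<in>{1..m}. w (m + i) * real i powr x)"
      by simp
    also have "\<dots> = (\<Sum>i\<in>{1..m}. a i * real i powr x)"
      by (simp add: sum.distrib[symmetric] a_def algebra_simps)
    also have "\<dots> = (\<Sum>i\<in>{1..m}. a i * exp (ln (real i) * x))"
      by (intro sum.cong) (auto simp: powr_def mult.commute)
    finally show ?thesis .
  qed
  \<comment> \<open>These are \<open>m\<close> distinct zeros, against \<open>m\<close> exponentials
    with distinct rates \<open>ln i\<close>. All coefficients would be 0, but the outermost one is
    2.\<close>
  define Z where "Z = insert \<alpha> ((\<lambda>j. 2 * real j) ` {1..<m})"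
  have "a m = 0"
  proof (rule exp_sum_zeros[where I = "{1..m}" and Z = Z and \<kappa> = "\<lambda>i. ln (real i)"])
    have "card ((\<lambda>j. 2 * real j) ` {1..<m}) = m - 1"
      by (subst card_image) (auto simp: inj_on_def)
    moreover have "\<alpha> \<notin> (\<lambda>j. 2 * real j) ` {1..<m}"
      using assms by auto
    ultimately show "card {1..m} \<le> card Z"
      using assms by (simp add: Z_def)
    show "(\<Sum>i\<in>{1..m}. a i * exp (ln (real i) * z)) = 0" if "z \<in> Z" for z
      using that * power_const_even unfolding pc[symmetric] Z_def by auto
  qed (use assms in \<open>auto simp: Z_def inj_on_def\<close>)
  moreover have "a m = 2"
    by (simp add: a_def w_def mult_2[symmetric])
  ultimately show False by simp
qed


section \<open>Local expansion of the covariance functions\<close>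

text \<open>A form of condition \<open>A\<close> on a neighbourhood of the origin, where \<open>G k\<close> and \<open>D k\<close> are
  the \<open>k\<close>-th derivatives of the smooth and of the irregular part.\<close>

definition local_power :: "real \<Rightarrow> real \<Rightarrow> (real \<Rightarrow> real) \<Rightarrow> bool" where
  "local_power c \<alpha> g \<longleftrightarrow>
     \<alpha> > 0 \<and> (\<forall>n::nat. \<alpha> \<noteq> 2 * real n) \<and>
     (\<exists>\<epsilon>>0. \<exists>G D.
        (\<forall>t. \<bar>t\<bar> \<le> \<epsilon> \<longrightarrow> g t = G 0 t + D 0 \<bar>t\<bar>) \<and>
        (\<forall>k::nat. \<forall>t. \<bar>t\<bar> \<le> \<epsilon> \<longrightarrow> (G k has_real_derivative G (Suc k) t) (at t)) \<and>
        D 0 0 = 0 \<and>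
        (\<forall>k::nat. \<forall>t. 0 < t \<and> t \<le> \<epsilon> \<longrightarrow> (D k has_real_derivative D (Suc k) t) (at t)) \<and>
        (\<forall>k. D k \<in> O[at_right 0](\<lambda>t. t powr (\<alpha> - real k))) \<and>
        ((\<lambda>t. D 0 t / t powr \<alpha>) \<longlongrightarrow> c) (at_right 0))"

text \<open>Differentiating a power series does not shrink its radius of convergence, so a single
  interval serves the derivatives of all orders.\<close>

lemma real_analytic_at_0_derivs:
  assumes "real_analytic_at A 0"
  obtains \<epsilon> G where "\<epsilon> > 0" "\<And>t. \<bar>t\<bar> \<le> \<epsilon> \<Longrightarrow> A t = G 0 t"
    "\<And>(k::nat) t. \<bar>t\<bar> \<le> \<epsilon> \<Longrightarrow> (G k has_real_derivative G (Suc k) t) (at t)"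
proof -
  obtain F where F: "fps_conv_radius F > 0" "eventually (\<lambda>h. eval_fps F h = A h) (nhds 0)"
    using assms by (auto simp: real_analytic_at_def has_fps_expansion_def)
  obtain d where d: "d > 0" "\<And>h. dist h 0 < d \<Longrightarrow> eval_fps F h = A h"
    using F(2) by (auto simp: eventually_nhds_metric)
  obtain r where r: "0 < ereal r" "ereal r < fps_conv_radius F"
    using F(1) by (metis ereal_dense2)
  define G where "G k = eval_fps ((fps_deriv ^^ k) F)" for k
  have rad: "fps_conv_radius F \<le> fps_conv_radius ((fps_deriv ^^ k) F)" for k
    by (induction k) (auto intro: order_trans fps_conv_radius_deriv)
  show ?thesis
  proof (rule that[of "min r (d / 2)" G])
    show "min r (d / 2) > 0" using r d by auto
    show "A t = G 0 t" if "\<bar>t\<bar> \<le> min r (d / 2)" for t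
      using d that by (auto simp: G_def)
    show "(G k has_real_derivative G (Suc k) t) (at t)" if "\<bar>t\<bar> \<le> min r (d / 2)" for k t
    proof -
      have "ereal \<bar>t\<bar> \<le> ereal r" using that by simp
      then have "ereal (norm t) < fps_conv_radius ((fps_deriv ^^ k) F)"
        using r rad[of k] by (auto simp del: ereal_less_eq intro: le_less_trans less_le_trans)
      then show ?thesis
        unfolding G_def by (auto intro!: has_field_derivative_eval_fps)
    qed
  qed
qed

text \<open>On a coordinate axis the radial part depends on \<open>\<bar>t\<bar>\<close>, and the
  mixed partials of the remainder reduce to pure ones, indexed by \<open>replicate k i\<close>. The
  analytic part becomes \<open>G\<close>; the irregular part and the remainder together become
  \<open>D\<close>.\<close>

lemma condition_Ad_line:
  fixes C :: "real ^ 'd \<Rightarrow> real"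
  assumes C: "condition_Ad L c \<alpha> C" and "L > 0" and even: "\<And>u. C (- u) = C u"
  shows "local_power c \<alpha> (\<lambda>t. C (t *\<^sub>R axis i 1))"
proof -
  define e where "e = (axis i 1 :: real ^ 'd)"
  have e: "norm e = 1" "e \<noteq> 0"
    by (auto simp: e_def axis_eq_0_iff)
  obtain K r Dr where K: "\<And>u. C u = K (norm u) + r u" "condition_A L c \<alpha> K"
    and r: "r \<in> o[nhds 0](\<lambda>u. norm u powr \<alpha>)"
    and Dr: "Dr [] = r"
      "\<And>is i u. u \<noteq> 0 \<Longrightarrow>
         ((\<lambda>h. Dr is (u + h *\<^sub>R axis i 1)) has_real_derivative Dr (i # is) u) (at 0)"
      "\<And>is. Dr is \<in> o[at 0](\<lambda>u. norm u powr (\<alpha> - real (length is)))"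
    using C unfolding condition_Ad_def by metis
  obtain A B DB where cA: "\<alpha> > 0" "\<forall>n::nat. \<alpha> \<noteq> 2 * real n"
    "\<forall>t\<in>{-L..L}. K t = A t + B t"
    "\<forall>t\<in>{-L..L}. A (- t) = A t \<and> real_analytic_at A t"
    "continuous_on {-L..L} B" "DB 0 = B"
    "\<forall>k::nat. \<forall>t\<in>{0<..L}. (DB k has_real_derivative DB (Suc k) t) (at t within {0<..L})"
    "\<forall>k. (\<lambda>t. DB k t - falling_fact \<alpha> k * c * t powr (\<alpha> - real k))
                  \<in> o[at_right 0](\<lambda>t. t powr (\<alpha> - real k))"
    using K(2) unfolding condition_A_def by (elim conjE exE) (rule that; assumption)
  note \<alpha> = cA(1) cA(2)[rule_format] and AB = cA(3)[rule_format] and B = cA(5)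
    and DB = cA(6) cA(7)[rule_format] cA(8)[rule_format]
  have A: "A (- t) = A t" "real_analytic_at A t" if "t \<in> {-L..L}" for t
    using cA(4) that by auto
  have "real_analytic_at A 0" using A(2)[of 0] \<open>L > 0\<close> by simp
  then obtain \<epsilon> G where G: "\<epsilon> > 0" "\<And>t. \<bar>t\<bar> \<le> \<epsilon> \<Longrightarrow> A t = G 0 t"
    "\<And>(k::nat) t. \<bar>t\<bar> \<le> \<epsilon> \<Longrightarrow> (G k has_real_derivative G (Suc k) t) (at t)"
    by (rule real_analytic_at_0_derivs) blast
  \<comment> \<open>Staying strictly below \<open>L\<close> makes the derivatives within
    \<open>{0<..L}\<close> two-sided.\<close>
  define \<delta> where "\<delta> = min \<epsilon> (L / 2)"
  define D where "D k t = DB k t + Dr (replicate k i) (t *\<^sub>R e)" for k t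
  have \<delta>: "0 < \<delta>" "\<delta> < L" "\<delta> \<le> \<epsilon>" using G(1) \<open>L > 0\<close> by (auto simp: \<delta>_def)
  have lim_e: "filterlim (\<lambda>t. t *\<^sub>R e) (at 0) (at_right 0)"
    by (auto simp: filterlim_at e eventually_at_right_less intro!: tendsto_eq_intros
        eventually_mono[OF eventually_at_right_less])
  have Dr_small: "(\<lambda>t. Dr is (t *\<^sub>R e)) \<in> o[at_right 0](\<lambda>t. t powr (\<alpha> - real (length is)))" for "is"
  proof -
    have "(\<lambda>t. Dr is (t *\<^sub>R e)) \<in> o[at_right 0](\<lambda>t. norm (t *\<^sub>R e) powr (\<alpha> - real (length is)))"
      using landau_o.small.compose[OF Dr(3) lim_e] .
    also have "o[at_right 0](\<lambda>t. norm (t *\<^sub>R e) powr (\<alpha> - real (length is)))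
        = o[at_right 0](\<lambda>t. t powr (\<alpha> - real (length is)))"
      by (rule landau_o.small.cong) (auto simp: e eventually_at_filter)
    finally show ?thesis .
  qed
  have D_asymp: "(\<lambda>t. D k t - falling_fact \<alpha> k * c * t powr (\<alpha> - real k))
      \<in> o[at_right 0](\<lambda>t. t powr (\<alpha> - real k))" for k
  proof -
    have "(\<lambda>t. (DB k t - falling_fact \<alpha> k * c * t powr (\<alpha> - real k)) + Dr (replicate k i) (t *\<^sub>R e))
        \<in> o[at_right 0](\<lambda>t. t powr (\<alpha> - real k))"
      using sum_in_smallo(1)[OF DB(3)[of k] Dr_small[of "replicate k i", unfolded length_replicate]] .
    then show ?thesis
      unfolding D_def by (simp only: diff_add_eq)
  qed
  have ff: "falling_fact \<alpha> 0 = 1"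
  proof -
    have "Gamma (\<alpha> + 1) \<noteq> 0"
      using \<alpha>(1) Gamma_real_pos[of "\<alpha> + 1"] by linarith
    then show ?thesis by (simp add: falling_fact_def)
  qed
  have pos: "\<forall>\<^sub>F t in at_right 0. t > (0::real)" by (rule eventually_at_right_less)
  have "((\<lambda>t. (D 0 t - c * t powr \<alpha>) / t powr \<alpha>) \<longlongrightarrow> 0) (at_right 0)"
    using smalloD_tendsto[OF D_asymp[of 0]] by (simp add: ff)
  then have "((\<lambda>t. (D 0 t - c * t powr \<alpha>) / t powr \<alpha> + c) \<longlongrightarrow> 0 + c) (at_right 0)"
    by (intro tendsto_intros)
  moreover have "\<forall>\<^sub>F t in at_right 0. (D 0 t - c * t powr \<alpha>) / t powr \<alpha> + c = D 0 t / t powr \<alpha>"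
    by (rule eventually_mono[OF pos]) (simp add: diff_divide_distrib)
  ultimately have D_lim: "((\<lambda>t. D 0 t / t powr \<alpha>) \<longlongrightarrow> c) (at_right 0)"
    by (simp add: tendsto_cong)
  \<comment> \<open>The asymptotics give limit 0 at the origin, since \<alpha> is positive; with
    continuity of \<open>B\<close> this yields \<open>B 0 = 0\<close>.\<close>
  have "((\<lambda>t. (B t - c * t powr \<alpha>) / t powr \<alpha>) \<longlongrightarrow> 0) (at_right 0)"
    using smalloD_tendsto[OF DB(3)[of 0]] by (simp add: ff DB(1))
  moreover have pw: "((\<lambda>t. t powr \<alpha>) \<longlongrightarrow> 0) (at_right (0::real))"
    using \<alpha>(1) by (auto intro!: tendsto_eq_intros eventually_at_rightI[of 0 1])
  ultimately have "((\<lambda>t. ((B t - c * t powr \<alpha>) / t powr \<alpha>) * t powr \<alpha> + c * t powr \<alpha>) \<longlongrightarrow> 0 * 0 + c * 0) (at_right 0)"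
    by (intro tendsto_intros)
  moreover have "\<forall>\<^sub>F t in at_right 0. (B t - c * t powr \<alpha>) / t powr \<alpha> * t powr \<alpha> + c * t powr \<alpha> = B t"
    by (rule eventually_mono[OF pos]) simp
  ultimately have "(B \<longlongrightarrow> 0) (at_right 0)"
    by (simp add: tendsto_cong)
  moreover have "(B \<longlongrightarrow> B 0) (at_right 0)"
  proof -
    have "isCont B 0"
      using B \<open>L > 0\<close> by (intro continuous_on_interior) auto
    then show ?thesis
      unfolding isCont_def by (rule tendsto_mono[OF at_le, rotated]) auto
  qed
  ultimately have B0: "B 0 = 0"
    using tendsto_unique trivial_limit_at_right_real by blast
  \<comment> \<open>The filter \<open>nhds 0\<close> includes the origin itself, where the
    comparison function is 0.\<close>
  have r0: "r 0 = 0"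
  proof -
    have "\<forall>\<^sub>F u in nhds 0. norm (r u) \<le> 1 * norm (norm u powr \<alpha>)"
      using r by (rule landau_o.smallD) simp
    from eventually_nhds_x_imp_x[OF this] show ?thesis by simp
  qed
  \<comment> \<open>Both \<open>C\<close> and the radial part are even. Thus the remainder on the
    axis is a function of \<open>\<bar>t\<bar>\<close>, as \<open>local_power\<close>
    demands.\<close>
  have r_even: "r (- u) = r u" for u
    using even[of u] by (simp add: K(1))
  show ?thesis
    unfolding local_power_def e_def[symmetric]
  proof (intro conjI, rule \<alpha>(1), use \<alpha>(2) in blast, rule exI[of _ \<delta>], rule conjI, rule \<delta>(1),
      rule exI[of _ G], rule exI[of _ D], intro conjI allI impI)
    show "C (t *\<^sub>R e) = G 0 t + D 0 \<bar>t\<bar>" if "\<bar>t\<bar> \<le> \<delta>" for t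
    proof -
      have tL: "t \<in> {-L..L}" "\<bar>t\<bar> \<in> {-L..L}"
        using \<delta> that by auto
      moreover have "A \<bar>t\<bar> = A t"
        using A(1)[OF tL(1)] by (auto simp: abs_if)
      moreover have "r (t *\<^sub>R e) = r (\<bar>t\<bar> *\<^sub>R e)"
        using r_even[of "t *\<^sub>R e"] by (auto simp: abs_if)
      ultimately show ?thesis
        using G(2)[of t] \<delta> that by (simp add: K(1) e AB D_def DB Dr)
    qed
    show "(G k has_real_derivative G (Suc k) t) (at t)" if "\<bar>t\<bar> \<le> \<delta>" for k t
      using G(3)[of t k] \<delta> that by auto
    show "D 0 0 = 0" by (simp add: D_def DB Dr r0 B0)
    show "(D k has_real_derivative D (Suc k) t) (at t)" if "0 < t \<and> t \<le> \<delta>" for k t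
    proof -
      have "(DB k has_real_derivative DB (Suc k) t) (at t within {0<..L})"
        using that \<delta> by (intro DB) auto
      moreover have "at t within {0<..L} = at t"
        using that \<delta> by (intro at_within_open_subset[of _ "{0<..<L}"]) auto
      moreover have "((\<lambda>h. Dr (replicate k i) (t *\<^sub>R e + h *\<^sub>R e)) has_real_derivative
          Dr (i # replicate k i) (t *\<^sub>R e)) (at 0)"
        unfolding e_def by (rule Dr(2)) (use that in \<open>auto simp: axis_eq_0_iff\<close>)
      then have "((\<lambda>h. Dr (replicate k i) ((h + t) *\<^sub>R e)) has_real_derivative
          Dr (replicate (Suc k) i) (t *\<^sub>R e)) (at 0)"
        by (simp add: algebra_simps)
      then have "((\<lambda>s. Dr (replicate k i) (s *\<^sub>R e)) has_real_derivative
          Dr (replicate (Suc k) i) (t *\<^sub>R e)) (at t)"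
        using DERIV_shift[of "\<lambda>s. Dr (replicate k i) (s *\<^sub>R e)" _ 0 t] by simp
      ultimately show ?thesis
        unfolding D_def by (auto intro: DERIV_add)
    qed
    show "D k \<in> O[at_right 0](\<lambda>t. t powr (\<alpha> - real k))" for k
    proof -
      have "(\<lambda>t. (D k t - falling_fact \<alpha> k * c * t powr (\<alpha> - real k)) + falling_fact \<alpha> k * c * t powr (\<alpha> - real k))
          \<in> O[at_right 0](\<lambda>t. t powr (\<alpha> - real k))"
        by (intro sum_in_bigo landau_o.small_imp_big[OF D_asymp]) simp
      then show ?thesis by simp
    qed
  qed (rule D_lim)
qed

lemma real_family_bounded:
  fixes G :: "nat \<Rightarrow> real \<Rightarrow> real"
  assumes "\<And>k t. \<bar>t\<bar> \<le> \<epsilon> \<Longrightarrow> (G k has_real_derivative G (Suc k) t) (at t)"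
  obtains C where "\<And>t. \<bar>t\<bar> \<le> \<epsilon> \<Longrightarrow> \<bar>G k t\<bar> \<le> C"
proof -
  have "continuous_on {-\<epsilon>..\<epsilon>} (G k)"
    by (rule DERIV_continuous_on[of _ _ "G (Suc k)"], rule has_field_derivative_at_within, rule assms) auto
  then have "bounded (G k ` {-\<epsilon>..\<epsilon>})"
    by (intro compact_imp_bounded compact_continuous_image) auto
  then obtain C where "\<And>x. x \<in> G k ` {-\<epsilon>..\<epsilon>} \<Longrightarrow> norm x \<le> C"
    unfolding bounded_iff by blast
  then show ?thesis
    by (intro that[of C]) (auto simp: abs_le_iff)
qed

text \<open>The smooth part gives \<open>h ^ (2 * m)\<close>, with two spare powers of
  \<open>h\<close> to pay for the decay in \<open>k\<close>. The irregular part is estimated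
  termwise at small lags, where the grid may meet the singularity; at large lags the grid stays away
  from the origin and the \<open>2 m\<close>-th derivative applies. The exponent \<open>a\<close>
  may be smaller than \<alpha>, so that fields of different roughness can be bounded at a common
  rate.\<close>

lemma local_power_decay:
  assumes lp: "local_power c \<alpha> g" and a: "0 < a" "a \<le> \<alpha>" "a + 2 \<le> 2 * real m"
  obtains \<epsilon> C where "\<epsilon> > 0"
    "\<And>h k. h > 0 \<Longrightarrow> (real k + real m) * h \<le> \<epsilon> \<Longrightarrow>
       \<bar>(fdiff h ^^ (2 * m)) g ((real k - real m) * h)\<bar> \<le> C * h powr a / (1 + real k)\<^sup>2"
proof -
  obtain \<epsilon> G D where \<epsilon>: "\<epsilon> > 0" and GD:
    "\<forall>t. \<bar>t\<bar> \<le> \<epsilon> \<longrightarrow> g t = G 0 t + D 0 \<bar>t\<bar>"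
    "\<forall>k::nat. \<forall>t. \<bar>t\<bar> \<le> \<epsilon> \<longrightarrow> (G k has_real_derivative G (Suc k) t) (at t)"
    "D 0 0 = 0"
    "\<forall>k::nat. \<forall>t. 0 < t \<and> t \<le> \<epsilon> \<longrightarrow> (D k has_real_derivative D (Suc k) t) (at t)"
    "\<forall>k. D k \<in> O[at_right 0](\<lambda>t. t powr (\<alpha> - real k))"
    "((\<lambda>t. D 0 t / t powr \<alpha>) \<longlongrightarrow> c) (at_right 0)"
    using lp unfolding local_power_def by (elim conjE exE) (rule that; assumption)
  note g = GD(1)[rule_format] and G = GD(2)[rule_format] and D0 = GD(3)
    and D = GD(4)[rule_format, OF conjI] and O = GD(5)[rule_format]
  have m: "m \<ge> 1" using a by (cases m) auto
  obtain CG where CG: "\<And>t. \<bar>t\<bar> \<le> \<epsilon> \<Longrightarrow> \<bar>G (2 * m) t\<bar> \<le> CG"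
    using real_family_bounded[of \<epsilon> G "2 * m", OF G] by blast
  have CG0: "CG \<ge> 0" using CG[of 0] \<epsilon> by auto
  have ex: "\<exists>C>0. \<exists>d>0. \<forall>t. 0 < t \<and> t \<le> d \<longrightarrow> \<bar>D k t\<bar> \<le> C * t powr (\<alpha> - real k)" for k
  proof -
    obtain C where C: "C > 0" "\<forall>\<^sub>F t in at_right 0. norm (D k t) \<le> C * norm (t powr (\<alpha> - real k))"
      using O[of k] by (auto elim: landau_o.bigE)
    then obtain d where "d > 0" "\<And>t. 0 < t \<Longrightarrow> t < d \<Longrightarrow> norm (D k t) \<le> C * norm (t powr (\<alpha> - real k))"
      by (auto simp: eventually_at_right_field)
    then show ?thesis using C(1) by (intro exI[of _ C] conjI exI[of _ "d / 2"]) auto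
  qed
  obtain C0 d0 where C0: "C0 > 0" "d0 > 0" "\<And>t. 0 < t \<Longrightarrow> t \<le> d0 \<Longrightarrow> \<bar>D 0 t\<bar> \<le> C0 * t powr \<alpha>"
    using ex[of 0] by auto
  obtain C1 d1 where C1: "C1 > 0" "d1 > 0"
      "\<And>t. 0 < t \<Longrightarrow> t \<le> d1 \<Longrightarrow> \<bar>D (2 * m) t\<bar> \<le> C1 * t powr (\<alpha> - 2 * real m)"
    using ex[of "2 * m"] by auto
  \<comment> \<open>The bound 1 gives \<open>t powr \<alpha> \<le> t powr a\<close> and
    \<open>(1 + k) * h \<le> 1\<close>.\<close>
  define \<delta> where "\<delta> = Min {1, \<epsilon>, d0, d1}"
  have \<delta>: "\<delta> > 0" "\<delta> \<le> 1" "\<delta> \<le> \<epsilon>" "\<delta> \<le> d0" "\<delta> \<le> d1"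
    using \<epsilon> C0 C1 by (auto simp: \<delta>_def)
  \<comment> \<open>The constant for lags \<open>k \<le> 2 * m\<close>: there all arguments are at
    most \<open>3 * m * h\<close>, and \<open>(1 + 2 * m)\<^sup>2\<close> offsets the denominator
    \<open>(1 + k)\<^sup>2\<close>.\<close>
  define N where "N = (\<Sum>j\<le>2 * m. real (2 * m choose j)) * C0 * (3 * real m) powr a * (1 + 2 * real m)\<^sup>2"
  have N0: "N \<ge> 0" using C0 by (auto simp: N_def intro!: mult_nonneg_nonneg sum_nonneg)
  show ?thesis
  proof (rule that[of \<delta> "CG + N + 4 * C1"])
    fix h :: real and k :: nat
    assume h: "h > 0" "(real k + real m) * h \<le> \<delta>"
    define x where "x = (real k - real m) * h"
    have rng: "\<bar>x + real j * h\<bar> \<le> (real k + real m) * h" if "j \<le> 2 * m" for j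
    proof -
      have "\<bar>real k - real m + real j\<bar> \<le> real k + real m" using that by auto
      then have "\<bar>real k - real m + real j\<bar> * h \<le> (real k + real m) * h"
        using h by (intro mult_right_mono) auto
      moreover have "x + real j * h = (real k - real m + real j) * h"
        by (simp add: x_def algebra_simps)
      ultimately show ?thesis using h by (simp add: abs_mult)
    qed
    have xlo: "\<bar>x\<bar> \<le> (real k + real m) * h" and xhi: "\<bar>x + real (2 * m) * h\<bar> \<le> (real k + real m) * h"
      using rng[of 0] rng[of "2 * m"] by auto
    \<comment> \<open>This converts a spare factor \<open>h\<^sup>2\<close> into
      \<open>1 / (1 + k)\<^sup>2\<close>.\<close>
    have h1: "(1 + real k) * h \<le> 1"
    proof -
      have "(1 + real k) * h \<le> (real k + real m) * h"
        using m h by (intro mult_right_mono) auto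
      then show ?thesis using h \<delta> by linarith
    qed
    then have h2: "h\<^sup>2 \<le> 1 / (1 + real k)\<^sup>2"
      using power_mono[OF h1, of 2] h by (simp add: power_mult_distrib pos_le_divide_eq mult.commute)
    have hle1: "h \<le> 1"
      using h1 h by (smt (verit) mult_left_mono mult.commute mult_cancel_left1 of_nat_0_le_iff)
    have split: "(fdiff h ^^ (2 * m)) g x = (fdiff h ^^ (2 * m)) (G 0) x + (fdiff h ^^ (2 * m)) (\<lambda>t. D 0 \<bar>t\<bar>) x"
    proof -
      have "(fdiff h ^^ (2 * m)) g x = (fdiff h ^^ (2 * m)) (\<lambda>t. G 0 t + D 0 \<bar>t\<bar>) x"
      proof (rule fdiff_funpow_cong)
        fix j assume "j \<le> 2 * m"
        then show "g (x + real j * h) = G 0 (x + real j * h) + D 0 \<bar>x + real j * h\<bar>"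
          using rng[of j] h \<delta> by (intro g) linarith
      qed
      then show ?thesis by (simp only: fdiff_funpow_add)
    qed
    have "\<bar>(fdiff h ^^ (2 * m)) (G 0) x\<bar> \<le> CG * h ^ (2 * m)"
    proof (rule fdiff_funpow_bound)
      fix t assume t: "x \<le> t" "t \<le> x + real (2 * m) * h"
      then have "\<bar>t\<bar> \<le> \<epsilon>" using xlo xhi h \<delta> by linarith
      then show "\<bar>G (2 * m) t\<bar> \<le> CG" "(G k has_real_derivative G (Suc k) t) (at t)" for k
        using CG G by auto
    qed (use h in auto)
    also have "h ^ (2 * m) \<le> h powr (a + 2)"
      using h hle1 a by (subst powr_realpow[symmetric]) (auto intro!: powr_mono')
    also have "h powr (a + 2) = h powr a * h\<^sup>2"
      using h by (simp add: powr_add)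
    also have "h powr a * h\<^sup>2 \<le> h powr a * (1 / (1 + real k)\<^sup>2)"
      using h2 by (intro mult_left_mono) auto
    finally have bG: "\<bar>(fdiff h ^^ (2 * m)) (G 0) x\<bar> \<le> CG * (h powr a / (1 + real k)\<^sup>2)"
      using CG0 by (simp add: mult_left_mono)
    have bD: "\<bar>(fdiff h ^^ (2 * m)) (\<lambda>t. D 0 \<bar>t\<bar>) x\<bar> \<le> (N + 4 * C1) * (h powr a / (1 + real k)\<^sup>2)"
    proof (cases "k \<le> 2 * m")
      case True
      have b: "\<bar>D 0 \<bar>x + real j * h\<bar>\<bar> \<le> C0 * (3 * real m * h) powr a" if j: "j \<le> 2 * m" for j
      proof (cases "x + real j * h = 0")
        case False
        define t where "t = \<bar>x + real j * h\<bar>"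
        have t: "0 < t" "t \<le> (real k + real m) * h" "t \<le> \<delta>"
          using False rng[OF j] h by (auto simp: t_def)
        have "(real k + real m) * h \<le> (3 * real m) * h"
          using True h by (intro mult_right_mono) auto
        then have t3: "t \<le> 3 * real m * h" using t by simp
        have "\<bar>D 0 t\<bar> \<le> C0 * t powr \<alpha>" using t \<delta> by (intro C0) auto
        also have "t powr \<alpha> \<le> t powr a" using t \<delta> a by (intro powr_mono') auto
        also have "t powr a \<le> (3 * real m * h) powr a" using t t3 a by (intro powr_mono2) auto
        finally show ?thesis using C0 by (simp add: t_def)
      qed (use C0 D0 in auto)
      have "\<bar>(fdiff h ^^ (2 * m)) (\<lambda>t. D 0 \<bar>t\<bar>) x\<bar>
          \<le> (\<Sum>j\<le>2 * m. \<bar>(-1) ^ (2 * m + j) * real (2 * m choose j) * D 0 \<bar>x + real j * h\<bar>\<bar>)"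
        unfolding fdiff_funpow_sum by (rule sum_abs)
      also have "\<dots> \<le> (\<Sum>j\<le>2 * m. real (2 * m choose j) * (C0 * (3 * real m * h) powr a))"
        using b by (intro sum_mono) (auto simp: abs_mult intro!: mult_left_mono)
      also have "\<dots> = (\<Sum>j\<le>2 * m. real (2 * m choose j)) * C0 * (3 * real m) powr a * h powr a"
        using h by (simp add: sum_distrib_right[symmetric] powr_mult)
      also have "\<dots> \<le> (\<Sum>j\<le>2 * m. real (2 * m choose j)) * C0 * (3 * real m) powr a * h powr a * ((1 + 2 * real m)\<^sup>2 / (1 + real k)\<^sup>2)"
      proof -
        have "(1 + real k)\<^sup>2 \<le> (1 + 2 * real m)\<^sup>2" using True by (intro power_mono) auto
        then have "1 \<le> (1 + 2 * real m)\<^sup>2 / (1 + real k)\<^sup>2" by simp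
        moreover have "0 \<le> (\<Sum>j\<le>2 * m. real (2 * m choose j)) * C0 * (3 * real m) powr a * h powr a"
          using C0 by (auto intro!: mult_nonneg_nonneg sum_nonneg)
        ultimately show ?thesis
          by (metis mult_left_mono mult.right_neutral)
      qed
      also have "\<dots> = N * (h powr a / (1 + real k)\<^sup>2)" by (simp add: N_def)
      also have "\<dots> \<le> (N + 4 * C1) * (h powr a / (1 + real k)\<^sup>2)"
        using C1 by (intro mult_right_mono) auto
      finally show ?thesis .
    next
      case False
      \<comment> \<open>Here \<open>k \<ge> 2 * m + 1\<close>, so \<open>k - m\<close> is at least
        half of \<open>1 + k\<close>; this half is the origin of the factor 4 below.\<close>
      then have km: "real k - real m \<ge> 1" "real k - real m \<ge> (1 + real k) / 2" using m by auto
      have x0: "x > 0" using km h by (simp add: x_def)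
      have x1: "x + real (2 * m) * h \<le> \<delta>" using xhi h by linarith
      have "(fdiff h ^^ (2 * m)) (\<lambda>t. D 0 \<bar>t\<bar>) x = (fdiff h ^^ (2 * m)) (D 0) x"
        using x0 h by (intro fdiff_funpow_cong) auto
      also have "\<bar>\<dots>\<bar> \<le> (C1 * x powr (a - 2 * real m)) * h ^ (2 * m)"
      proof (rule fdiff_funpow_bound)
        fix t assume t: "x \<le> t" "t \<le> x + real (2 * m) * h"
        then have t': "0 < t" "t \<le> \<delta>" using x0 x1 by auto
        then show "(D k has_real_derivative D (Suc k) t) (at t)" for k
          using \<delta> by (intro D) auto
        have "\<bar>D (2 * m) t\<bar> \<le> C1 * t powr (\<alpha> - 2 * real m)" using t' \<delta> by (intro C1) auto
        also have "t powr (\<alpha> - 2 * real m) \<le> t powr (a - 2 * real m)"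
          using t' \<delta> a by (intro powr_mono') auto
        also have "t powr (a - 2 * real m) \<le> x powr (a - 2 * real m)"
          using t x0 a by (intro powr_mono2') auto
        finally show "\<bar>D (2 * m) t\<bar> \<le> C1 * x powr (a - 2 * real m)" using C1 by simp
      qed (use h in auto)
      also have "(C1 * x powr (a - 2 * real m)) * h ^ (2 * m)
          = C1 * h powr a * (real k - real m) powr (a - 2 * real m)"
      proof -
        have "x powr (a - 2 * real m) * h powr (2 * real m) = (real k - real m) powr (a - 2 * real m) * (h powr (a - 2 * real m) * h powr (2 * real m))"
          using h km by (simp add: x_def powr_mult)
        also have "h powr (a - 2 * real m) * h powr (2 * real m) = h powr a"
          by (simp add: powr_add[symmetric])
        finally show ?thesis using h powr_realpow[of h "2 * m"] by simp
      qed
      also have "C1 * h powr a * (real k - real m) powr (a - 2 * real m) \<le> C1 * h powr a * (4 / (1 + real k)\<^sup>2)"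
      proof (rule mult_left_mono)
        have "(real k - real m) powr (a - 2 * real m) \<le> (real k - real m) powr (-2)"
          using km a by (intro powr_mono) auto
        also have "\<dots> \<le> ((1 + real k) / 2) powr (-2)"
          using km by (intro powr_mono2') auto
        also have "\<dots> = 4 / (1 + real k)\<^sup>2"
          by (simp add: powr_minus powr_numeral field_simps power2_eq_square)
        finally show "(real k - real m) powr (a - 2 * real m) \<le> 4 / (1 + real k)\<^sup>2" .
      qed (use C1 in simp)
      finally have "\<bar>(fdiff h ^^ (2 * m)) (\<lambda>t. D 0 \<bar>t\<bar>) x\<bar> \<le> 4 * C1 * (h powr a / (1 + real k)\<^sup>2)"
        by (simp add: mult_ac)
      also have "\<dots> \<le> (N + 4 * C1) * (h powr a / (1 + real k)\<^sup>2)"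
        using N0 by (intro mult_right_mono) auto
      finally show ?thesis .
    qed
    have "\<bar>(fdiff h ^^ (2 * m)) (G 0) x + (fdiff h ^^ (2 * m)) (\<lambda>t. D 0 \<bar>t\<bar>) x\<bar>
        \<le> CG * (h powr a / (1 + real k)\<^sup>2) + (N + 4 * C1) * (h powr a / (1 + real k)\<^sup>2)"
      using bG bD by linarith
    then show "\<bar>(fdiff h ^^ (2 * m)) g ((real k - real m) * h)\<bar> \<le> (CG + N + 4 * C1) * h powr a / (1 + real k)\<^sup>2"
      unfolding x_def[symmetric] split by (simp add: distrib_right add_divide_distrib)
  qed (use \<delta> in auto)
qed

text \<open>The smooth part is of order \<open>h ^ (2 * m)\<close>, negligible against
  \<open>h powr \<alpha>\<close>. In the irregular part the term at distance \<open>s * h\<close>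
  from the origin tends, after division, to \<open>c * s powr \<alpha>\<close>, and the weighted sum
  of these is the difference of the pure power.\<close>

lemma local_power_limit:
  assumes lp: "local_power c \<alpha> g" and m: "\<alpha> < 2 * real m"
  shows "((\<lambda>h. (fdiff h ^^ (2 * m)) g (- real m * h) / h powr \<alpha>) \<longlongrightarrow> c * power_const m \<alpha>) (at_right 0)"
proof -
  have \<alpha>: "\<alpha> > 0" using lp by (simp add: local_power_def)
  obtain \<epsilon> G D where \<epsilon>: "\<epsilon> > 0" and GD:
    "\<forall>t. \<bar>t\<bar> \<le> \<epsilon> \<longrightarrow> g t = G 0 t + D 0 \<bar>t\<bar>"
    "\<forall>k::nat. \<forall>t. \<bar>t\<bar> \<le> \<epsilon> \<longrightarrow> (G k has_real_derivative G (Suc k) t) (at t)"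
    "D 0 0 = 0"
    "\<forall>k::nat. \<forall>t. 0 < t \<and> t \<le> \<epsilon> \<longrightarrow> (D k has_real_derivative D (Suc k) t) (at t)"
    "\<forall>k. D k \<in> O[at_right 0](\<lambda>t. t powr (\<alpha> - real k))"
    "((\<lambda>t. D 0 t / t powr \<alpha>) \<longlongrightarrow> c) (at_right 0)"
    using lp unfolding local_power_def by (elim conjE exE) (rule that; assumption)
  note g = GD(1)[rule_format] and G = GD(2)[rule_format] and D0 = GD(3) and Dlim = GD(6)
  have m0: "m > 0" using m \<alpha> by (cases m) auto
  obtain CG where CG: "\<And>t. \<bar>t\<bar> \<le> \<epsilon> \<Longrightarrow> \<bar>G (2 * m) t\<bar> \<le> CG"
    using real_family_bounded[of \<epsilon> G "2 * m", OF G] by blast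
  let ?w = "\<lambda>j. (-1) ^ (2 * m + j) * real (2 * m choose j)"
  have small: "\<forall>\<^sub>F h in at_right 0. 0 < h \<and> real m * h \<le> \<epsilon>"
    using \<epsilon> m0 by (intro eventually_at_rightI[of 0 "\<epsilon> / real m"]) (auto simp: field_simps)
  have "((\<lambda>h. (fdiff h ^^ (2 * m)) (G 0) (- real m * h) / h powr \<alpha>) \<longlongrightarrow> 0) (at_right 0)"
  proof (rule Lim_null_comparison)
    show "((\<lambda>h. CG * h powr (2 * real m - \<alpha>)) \<longlongrightarrow> 0) (at_right 0)"
      using m by (auto intro!: tendsto_eq_intros eventually_at_rightI[of 0 1])
    show "\<forall>\<^sub>F h in at_right 0. norm ((fdiff h ^^ (2 * m)) (G 0) (- real m * h) / h powr \<alpha>) \<le> CG * h powr (2 * real m - \<alpha>)"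
      using small
    proof eventually_elim
      case (elim h)
      have "\<bar>(fdiff h ^^ (2 * m)) (G 0) (- real m * h)\<bar> \<le> CG * h ^ (2 * m)"
      proof (rule fdiff_funpow_bound)
        fix t assume t: "- real m * h \<le> t" "t \<le> - real m * h + real (2 * m) * h"
        moreover have "- real m * h + real (2 * m) * h = real m * h" by (simp add: algebra_simps)
        ultimately have "\<bar>t\<bar> \<le> \<epsilon>" using elim by linarith
        then show "\<bar>G (2 * m) t\<bar> \<le> CG" "(G k has_real_derivative G (Suc k) t) (at t)" for k
          using CG G by auto
      qed (use elim in auto)
      then have "\<bar>(fdiff h ^^ (2 * m)) (G 0) (- real m * h)\<bar> / h powr \<alpha> \<le> CG * h ^ (2 * m) / h powr \<alpha>"
        by (intro divide_right_mono) auto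
      also have "\<dots> = CG * h powr (2 * real m - \<alpha>)"
        using elim powr_realpow[of h "2 * m"] by (simp add: powr_diff)
      finally show ?case by simp
    qed
  qed
  moreover have "((\<lambda>h. \<Sum>j\<le>2 * m. ?w j * (D 0 (\<bar>real j - real m\<bar> * h) / h powr \<alpha>)) \<longlongrightarrow>
      (\<Sum>j\<le>2 * m. ?w j * (c * \<bar>real j - real m\<bar> powr \<alpha>))) (at_right 0)"
  proof (intro tendsto_intros)
    fix j :: nat
    define s where "s = \<bar>real j - real m\<bar>"
    show "((\<lambda>h. D 0 (s * h) / h powr \<alpha>) \<longlongrightarrow> c * s powr \<alpha>) (at_right 0)"
    proof (cases "s = 0")
      case False
      then have s: "s > 0" by (auto simp: s_def)
      have "filterlim (\<lambda>h. s * h) (at_right 0) (at_right 0)"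
        unfolding filterlim_at
        using s by (auto intro!: tendsto_eq_intros eventually_mono[OF eventually_at_right_less[of 0]])
      from filterlim_compose[OF Dlim this]
      have "((\<lambda>h. D 0 (s * h) / (s * h) powr \<alpha> * s powr \<alpha>) \<longlongrightarrow> c * s powr \<alpha>) (at_right 0)"
        by (intro tendsto_intros)
      then show ?thesis
        by (rule Lim_transform_eventually)
          (use s in \<open>auto intro!: eventually_mono[OF eventually_at_right_less[of 0]] simp: powr_mult\<close>)
    qed (simp add: D0)
  qed
  ultimately have "((\<lambda>h. (fdiff h ^^ (2 * m)) (G 0) (- real m * h) / h powr \<alpha>
      + (\<Sum>j\<le>2 * m. ?w j * (D 0 (\<bar>real j - real m\<bar> * h) / h powr \<alpha>))) \<longlongrightarrow>
      0 + (\<Sum>j\<le>2 * m. ?w j * (c * \<bar>real j - real m\<bar> powr \<alpha>))) (at_right 0)"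
    by (rule tendsto_add)
  moreover have "(\<Sum>j\<le>2 * m. ?w j * (c * \<bar>real j - real m\<bar> powr \<alpha>)) = c * power_const m \<alpha>"
    unfolding power_const_def fdiff_funpow_sum sum_distrib_left
    by (intro sum.cong) (auto simp: algebra_simps)
  moreover have "\<forall>\<^sub>F h in at_right 0. (fdiff h ^^ (2 * m)) (G 0) (- real m * h) / h powr \<alpha>
      + (\<Sum>j\<le>2 * m. ?w j * (D 0 (\<bar>real j - real m\<bar> * h) / h powr \<alpha>))
      = (fdiff h ^^ (2 * m)) g (- real m * h) / h powr \<alpha>"
    using small
  proof eventually_elim
    case (elim h)
    have abs: "\<bar>- real m * h + real j * h\<bar> = \<bar>real j - real m\<bar> * h" for j
    proof -
      have "- real m * h + real j * h = (real j - real m) * h" by (simp add: algebra_simps)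
      then show ?thesis using elim by (simp add: abs_mult)
    qed
    have "(fdiff h ^^ (2 * m)) g (- real m * h) = (fdiff h ^^ (2 * m)) (\<lambda>t. G 0 t + D 0 \<bar>t\<bar>) (- real m * h)"
    proof (rule fdiff_funpow_cong)
      fix j assume "j \<le> 2 * m"
      then have "\<bar>real j - real m\<bar> * h \<le> real m * h"
        using elim by (intro mult_right_mono) auto
      then show "g (- real m * h + real j * h) = G 0 (- real m * h + real j * h) + D 0 \<bar>- real m * h + real j * h\<bar>"
        using elim abs[of j] by (intro g) linarith
    qed
    also have "\<dots> = (fdiff h ^^ (2 * m)) (G 0) (- real m * h) + (\<Sum>j\<le>2 * m. ?w j * D 0 (\<bar>real j - real m\<bar> * h))"
      unfolding fdiff_funpow_add fdiff_funpow_sum[of _ h "\<lambda>t. D 0 \<bar>t\<bar>"] abs ..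
    finally show ?case
      by (simp add: add_divide_distrib sum_divide_distrib)
  qed
  ultimately show ?thesis
    by (auto intro: Lim_transform_eventually)
qed


section \<open>Gaussian spaces\<close>

lemma (in prob_space) gaussian_rv_moments:
  assumes "gaussian_rv M U"
  shows "integrable M U" "integrable M (\<lambda>\<omega>. (U \<omega>)\<^sup>2)"
    and "expectation U = 0 \<Longrightarrow> integrable M (\<lambda>\<omega>. U \<omega> ^ 4)"
    and "expectation U = 0 \<Longrightarrow> expectation (\<lambda>\<omega>. U \<omega> ^ 4) = 3 * (expectation (\<lambda>\<omega>. (U \<omega>)\<^sup>2))\<^sup>2"
proof -
  have U[measurable]: "U \<in> borel_measurable M"
    using assms by (simp add: gaussian_rv_def)
  consider (normal) \<mu> \<sigma> where "\<sigma> > 0" "distributed M lborel U (normal_density \<mu> \<sigma>)"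
    | (const) \<mu> where "AE \<omega> in M. U \<omega> = \<mu>"
    using assms by (auto simp: gaussian_rv_def)
  then have *: "integrable M U \<and> integrable M (\<lambda>\<omega>. (U \<omega>)\<^sup>2) \<and> (expectation U = 0 \<longrightarrow>
     integrable M (\<lambda>\<omega>. U \<omega> ^ 4) \<and> expectation (\<lambda>\<omega>. U \<omega> ^ 4) = 3 * (expectation (\<lambda>\<omega>. (U \<omega>)\<^sup>2))\<^sup>2)"
  proof cases
    case normal
    have int: "integrable M (\<lambda>\<omega>. (U \<omega> - \<mu>) ^ k)" for k
      using distributed_integrable[OF normal(2), of "\<lambda>x. (x - \<mu>) ^ k"] integrable_normal_moment[OF normal(1)]
      by simp
    have even: "expectation (\<lambda>\<omega>. (U \<omega> - \<mu>) ^ (2 * k)) = fact (2 * k) / ((2 / \<sigma>\<^sup>2) ^ k * fact k)" for k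
      using distributed_integral[OF normal(2), of "\<lambda>x. (x - \<mu>) ^ (2 * k)"]
        integral_normal_moment_even[OF normal(1), of \<mu> k] by simp
    have "expectation U = \<mu>"
      using distributed_integral[OF normal(2), of "\<lambda>x. x"] integral_normal_moment_nz_1[OF normal(1), of \<mu>]
      by simp
    moreover have "integrable M (\<lambda>\<omega>. (U \<omega> - \<mu>) + \<mu>)"
      using int[of 1] by (intro Bochner_Integration.integrable_add) simp_all
    moreover have "integrable M (\<lambda>\<omega>. (U \<omega> - \<mu>)\<^sup>2 + 2 * \<mu> * (U \<omega> - \<mu>) + \<mu>\<^sup>2)"
      using int[of 1] int[of 2]
      by (intro Bochner_Integration.integrable_add integrable_mult_right) simp_all
    moreover have "(U \<omega> - \<mu>)\<^sup>2 + 2 * \<mu> * (U \<omega> - \<mu>) + \<mu>\<^sup>2 = (U \<omega>)\<^sup>2" for \<omega>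
      by (simp add: power2_eq_square algebra_simps)
    moreover have "expectation (\<lambda>\<omega>. (U \<omega> - \<mu>) ^ 4) = 3 * (expectation (\<lambda>\<omega>. (U \<omega> - \<mu>)\<^sup>2))\<^sup>2"
      using even[of 1] even[of 2] normal(1)
      by (simp add: fact_numeral power2_eq_square field_simps)
    ultimately show ?thesis
      using int[of 4] by auto
  next
    case const
    have int: "integrable M (\<lambda>\<omega>. U \<omega> ^ k)" "expectation (\<lambda>\<omega>. U \<omega> ^ k) = \<mu> ^ k" for k
    proof -
      have "AE \<omega> in M. U \<omega> ^ k = \<mu> ^ k" using const by auto
      then show "integrable M (\<lambda>\<omega>. U \<omega> ^ k)"
        by (subst integrable_cong_AE[where g = "\<lambda>_. \<mu> ^ k"]) auto
      have "expectation (\<lambda>\<omega>. U \<omega> ^ k) = expectation (\<lambda>_. \<mu> ^ k)"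
        by (rule integral_cong_AE) (use \<open>AE \<omega> in M. U \<omega> ^ k = \<mu> ^ k\<close> in auto)
      then show "expectation (\<lambda>\<omega>. U \<omega> ^ k) = \<mu> ^ k" by (simp add: prob_space)
    qed
    then show ?thesis using int[of 1] int[of 2] int[of 4] by simp
  qed
  then show "integrable M U" "integrable M (\<lambda>\<omega>. (U \<omega>)\<^sup>2)"
    "expectation U = 0 \<Longrightarrow> integrable M (\<lambda>\<omega>. U \<omega> ^ 4)"
    "expectation U = 0 \<Longrightarrow> expectation (\<lambda>\<omega>. U \<omega> ^ 4) = 3 * (expectation (\<lambda>\<omega>. (U \<omega>)\<^sup>2))\<^sup>2"
    by auto
qed

text \<open>A linear space in which every fourth moment is three times the squared second moment.
  This is all of Gaussianity that is needed: the mixed fourth moments follow by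
  polarisation.\<close>

locale gaussian_space = prob_space M for M :: "'w measure" +
  fixes H :: "('w \<Rightarrow> real) set"
  assumes meas: "U \<in> H \<Longrightarrow> U \<in> borel_measurable M"
    and lin: "U \<in> H \<Longrightarrow> V \<in> H \<Longrightarrow> (\<lambda>\<omega>. a * U \<omega> + b * V \<omega>) \<in> H"
    and int4: "U \<in> H \<Longrightarrow> integrable M (\<lambda>\<omega>. U \<omega> ^ 4)"
    and moment4: "U \<in> H \<Longrightarrow> expectation (\<lambda>\<omega>. U \<omega> ^ 4) = 3 * (expectation (\<lambda>\<omega>. (U \<omega>)\<^sup>2))\<^sup>2"
begin

lemma add_mem: "U \<in> H \<Longrightarrow> V \<in> H \<Longrightarrow> (\<lambda>\<omega>. U \<omega> + V \<omega>) \<in> H"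
  using lin[of U V 1 1] by simp

lemma diff_mem: "U \<in> H \<Longrightarrow> V \<in> H \<Longrightarrow> (\<lambda>\<omega>. U \<omega> - V \<omega>) \<in> H"
  using lin[of U V 1 "-1"] by simp

lemma int_prod2:
  assumes [simp]: "A \<in> H" "B \<in> H"
  shows "integrable M (\<lambda>\<omega>. A \<omega> * B \<omega>)"
proof (rule Bochner_Integration.integrable_bound)
  show "integrable M (\<lambda>\<omega>. 1 + A \<omega> ^ 4 + B \<omega> ^ 4)"
    by (intro Bochner_Integration.integrable_add int4 assms) simp
  show "(\<lambda>\<omega>. A \<omega> * B \<omega>) \<in> borel_measurable M"
    by (intro borel_measurable_times meas assms)
  have "\<bar>a * b\<bar> \<le> 1 + a ^ 4 + b ^ 4" for a b :: real
  proof -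
    have "\<bar>a * b\<bar> \<le> (a\<^sup>2 + b\<^sup>2) / 2"
      using sum_squares_bound[of "\<bar>a\<bar>" "\<bar>b\<bar>"] by (simp add: abs_mult)
    moreover have "2 * x\<^sup>2 \<le> 1 + x ^ 4" for x :: real
      using sum_squares_bound[of "1" "x\<^sup>2"] by simp
    from this[of a] this[of b] have "(a\<^sup>2 + b\<^sup>2) / 2 \<le> (2 + a ^ 4 + b ^ 4) / 4" by simp
    moreover have "(2 + a ^ 4 + b ^ 4) / 4 \<le> 1 + a ^ 4 + b ^ 4"
      by (simp add: field_simps)
    ultimately show ?thesis by (meson order_trans)
  qed
  then show "AE \<omega> in M. norm (A \<omega> * B \<omega>) \<le> norm (1 + A \<omega> ^ 4 + B \<omega> ^ 4)"
    by (auto intro: order_trans[OF _ abs_ge_self])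
qed

lemma int_prod4:
  assumes [simp]: "A \<in> H" "B \<in> H" "C \<in> H" "D \<in> H"
  shows "integrable M (\<lambda>\<omega>. A \<omega> * B \<omega> * (C \<omega> * D \<omega>))"
proof (rule Bochner_Integration.integrable_bound)
  show "integrable M (\<lambda>\<omega>. A \<omega> ^ 4 + B \<omega> ^ 4 + C \<omega> ^ 4 + D \<omega> ^ 4)"
    by (intro Bochner_Integration.integrable_add int4 assms)
  show "(\<lambda>\<omega>. A \<omega> * B \<omega> * (C \<omega> * D \<omega>)) \<in> borel_measurable M"
    by (intro borel_measurable_times meas assms)
  have "\<bar>a * b * (c * d)\<bar> \<le> a ^ 4 + b ^ 4 + c ^ 4 + d ^ 4" for a b c d :: real
  proof -
    have s: "\<bar>x * y\<bar> \<le> (x\<^sup>2 + y\<^sup>2) / 2" for x y :: real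
      using sum_squares_bound[of "\<bar>x\<bar>" "\<bar>y\<bar>"] by (simp add: abs_mult)
    have q: "(x * y)\<^sup>2 \<le> (x ^ 4 + y ^ 4) / 2" for x y :: real
      using s[of "x\<^sup>2" "y\<^sup>2"] by (simp add: power_mult_distrib)
    have "\<bar>a * b * (c * d)\<bar> \<le> ((a * b)\<^sup>2 + (c * d)\<^sup>2) / 2" by (rule s)
    also have "\<dots> \<le> ((a ^ 4 + b ^ 4) / 2 + (c ^ 4 + d ^ 4) / 2) / 2"
      by (intro divide_right_mono add_mono q) simp
    also have "\<dots> \<le> a ^ 4 + b ^ 4 + c ^ 4 + d ^ 4"
    proof -
      have "0 \<le> a ^ 4" "0 \<le> b ^ 4" "0 \<le> c ^ 4" "0 \<le> d ^ 4" by auto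
      then show ?thesis by (simp add: field_simps)
    qed
    finally show ?thesis .
  qed
  then show "AE \<omega> in M. norm (A \<omega> * B \<omega> * (C \<omega> * D \<omega>)) \<le> norm (A \<omega> ^ 4 + B \<omega> ^ 4 + C \<omega> ^ 4 + D \<omega> ^ 4)"
    by (auto intro: order_trans[OF _ abs_ge_self])
qed

text \<open>The sum of the fourth powers of \<open>P + Q\<close> and \<open>P - Q\<close> contains
  the mixed moment 12 times, and no odd terms.\<close>

lemma isserlis_squares:
  assumes P: "P \<in> H" and Q: "Q \<in> H"
  shows "expectation (\<lambda>\<omega>. P \<omega> * P \<omega> * (Q \<omega> * Q \<omega>)) =
    expectation (\<lambda>\<omega>. P \<omega> * P \<omega>) * expectation (\<lambda>\<omega>. Q \<omega> * Q \<omega>) + 2 * (expectation (\<lambda>\<omega>. P \<omega> * Q \<omega>))\<^sup>2"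
proof -
  define p q c where "p = expectation (\<lambda>\<omega>. P \<omega> * P \<omega>)" and "q = expectation (\<lambda>\<omega>. Q \<omega> * Q \<omega>)"
    and "c = expectation (\<lambda>\<omega>. P \<omega> * Q \<omega>)"
  note int = int_prod2[OF P P] int_prod2[OF Q Q] int_prod2[OF P Q] int_prod4[OF P P Q Q]
    int4[OF P] int4[OF Q] int4[OF add_mem[OF P Q]] int4[OF diff_mem[OF P Q]]
  have m4: "expectation (\<lambda>\<omega>. P \<omega> ^ 4) = 3 * p\<^sup>2" "expectation (\<lambda>\<omega>. Q \<omega> ^ 4) = 3 * q\<^sup>2"
    using moment4[OF P] moment4[OF Q] by (simp_all add: p_def q_def power2_eq_square)
  have "expectation (\<lambda>\<omega>. (P \<omega> + Q \<omega>)\<^sup>2) = expectation (\<lambda>\<omega>. P \<omega> * P \<omega> + 2 * (P \<omega> * Q \<omega>) + Q \<omega> * Q \<omega>)"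
    by (rule Bochner_Integration.integral_cong) (auto simp: power2_eq_square algebra_simps)
  also have "\<dots> = p + 2 * c + q"
    using int by (simp add: p_def q_def c_def)
  finally have plus: "expectation (\<lambda>\<omega>. (P \<omega> + Q \<omega>) ^ 4) = 3 * (p + 2 * c + q)\<^sup>2"
    using moment4[OF add_mem[OF P Q]] by simp
  have "expectation (\<lambda>\<omega>. (P \<omega> - Q \<omega>)\<^sup>2) = expectation (\<lambda>\<omega>. P \<omega> * P \<omega> - 2 * (P \<omega> * Q \<omega>) + Q \<omega> * Q \<omega>)"
    by (rule Bochner_Integration.integral_cong) (auto simp: power2_eq_square algebra_simps)
  also have "\<dots> = p - 2 * c + q"
    using int by (simp add: p_def q_def c_def)
  finally have minus: "expectation (\<lambda>\<omega>. (P \<omega> - Q \<omega>) ^ 4) = 3 * (p - 2 * c + q)\<^sup>2"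
    using moment4[OF diff_mem[OF P Q]] by simp
  have "expectation (\<lambda>\<omega>. (P \<omega> + Q \<omega>) ^ 4 + (P \<omega> - Q \<omega>) ^ 4)
      = expectation (\<lambda>\<omega>. 2 * P \<omega> ^ 4 + 12 * (P \<omega> * P \<omega> * (Q \<omega> * Q \<omega>)) + 2 * Q \<omega> ^ 4)"
    by (rule Bochner_Integration.integral_cong) (auto simp: power4_eq_xxxx algebra_simps)
  then have "3 * (p + 2 * c + q)\<^sup>2 + 3 * (p - 2 * c + q)\<^sup>2
      = 2 * (3 * p\<^sup>2) + 12 * expectation (\<lambda>\<omega>. P \<omega> * P \<omega> * (Q \<omega> * Q \<omega>)) + 2 * (3 * q\<^sup>2)"
    using int plus minus m4 by simp
  then have "expectation (\<lambda>\<omega>. P \<omega> * P \<omega> * (Q \<omega> * Q \<omega>)) = p * q + 2 * c\<^sup>2"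
    by (simp add: power2_eq_square algebra_simps)
  then show ?thesis by (simp add: p_def q_def c_def)
qed

lemma isserlis:
  assumes A: "A \<in> H" and B: "B \<in> H" and C: "C \<in> H" and D: "D \<in> H"
  shows "expectation (\<lambda>\<omega>. A \<omega> * B \<omega> * (C \<omega> * D \<omega>)) =
    expectation (\<lambda>\<omega>. A \<omega> * B \<omega>) * expectation (\<lambda>\<omega>. C \<omega> * D \<omega>)
    + expectation (\<lambda>\<omega>. A \<omega> * C \<omega>) * expectation (\<lambda>\<omega>. B \<omega> * D \<omega>)
    + expectation (\<lambda>\<omega>. A \<omega> * D \<omega>) * expectation (\<lambda>\<omega>. B \<omega> * C \<omega>)"
proof -
  note prods = int_prod2[OF A A] int_prod2[OF A B] int_prod2[OF A C] int_prod2[OF A D] int_prod2[OF B B]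
    int_prod2[OF B C] int_prod2[OF B D] int_prod2[OF C C] int_prod2[OF C D] int_prod2[OF D D]
  \<comment> \<open>Second polarisation: the signed sum of \<open>f s t\<close> over signs
    \<open>s\<close>, \<open>t\<close> is \<open>16 * A * B * C * D\<close>, and each
    \<open>f s t\<close> is a product of two squares.\<close>
  define f where "f s t \<omega> = (A \<omega> + s * B \<omega>) * (A \<omega> + s * B \<omega>) * ((C \<omega> + t * D \<omega>) * (C \<omega> + t * D \<omega>))"
    for s t :: real and \<omega>
  have AB: "(\<lambda>\<omega>. A \<omega> + s * B \<omega>) \<in> H" and CD: "(\<lambda>\<omega>. C \<omega> + s * D \<omega>) \<in> H" for s
    using lin[OF A B, of 1 s] lin[OF C D, of 1 s] by simp_all
  have bilin: "expectation (\<lambda>\<omega>. (U \<omega> + s * V \<omega>) * (U' \<omega> + t * V' \<omega>)) =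
      expectation (\<lambda>\<omega>. U \<omega> * U' \<omega>) + t * expectation (\<lambda>\<omega>. U \<omega> * V' \<omega>) + s * expectation (\<lambda>\<omega>. V \<omega> * U' \<omega>)
       + s * t * expectation (\<lambda>\<omega>. V \<omega> * V' \<omega>)"
    if "U \<in> H" "V \<in> H" "U' \<in> H" "V' \<in> H" for U V U' V' s t
  proof -
    have "expectation (\<lambda>\<omega>. (U \<omega> + s * V \<omega>) * (U' \<omega> + t * V' \<omega>))
       = expectation (\<lambda>\<omega>. U \<omega> * U' \<omega> + t * (U \<omega> * V' \<omega>) + s * (V \<omega> * U' \<omega>) + s * t * (V \<omega> * V' \<omega>))"
      by (rule Bochner_Integration.integral_cong) (auto simp: algebra_simps)
    then show ?thesis using that by (simp add: int_prod2)
  qed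
  have f: "integrable M (f s t)" for s t
    unfolding f_def by (intro int_prod4 AB CD)
  have Ef: "expectation (f s t) = expectation (\<lambda>\<omega>. (A \<omega> + s * B \<omega>) * (A \<omega> + s * B \<omega>)) * expectation (\<lambda>\<omega>. (C \<omega> + t * D \<omega>) * (C \<omega> + t * D \<omega>))
      + 2 * (expectation (\<lambda>\<omega>. (A \<omega> + s * B \<omega>) * (C \<omega> + t * D \<omega>)))\<^sup>2" for s t
    unfolding f_def by (rule isserlis_squares[OF AB CD])
  have "16 * expectation (\<lambda>\<omega>. A \<omega> * B \<omega> * (C \<omega> * D \<omega>)) = expectation (\<lambda>\<omega>. f 1 1 \<omega> - f (-1) 1 \<omega> - f 1 (-1) \<omega> + f (-1) (-1) \<omega>)"
    unfolding integral_mult_right_zero[symmetric]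
    by (rule Bochner_Integration.integral_cong) (auto simp: f_def algebra_simps)
  also have "\<dots> = expectation (f 1 1) - expectation (f (-1) 1) - expectation (f 1 (-1)) + expectation (f (-1) (-1))"
    using f by simp
  finally show ?thesis
    unfolding Ef bilin[OF A B A B] bilin[OF C D C D] bilin[OF A B C D]
    by (simp add: mult.commute[of "B _" "A _"] mult.commute[of "D _" "C _"] power2_eq_square algebra_simps)
qed

end

text \<open>The subtracted \<open>1 / n\<close> carries the induction, as each new term is at most
  \<open>1 / n - 1 / (n + 1)\<close>.\<close>

lemma sum_inverse_squares_le: "n > 0 \<Longrightarrow> (\<Sum>k<n. 1 / (1 + real k)\<^sup>2) \<le> 2 - 1 / real n"
proof (induction n)
  case (Suc n)
  show ?case
  proof (cases "n = 0")
    case False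
    then have "(\<Sum>k<n. 1 / (1 + real k)\<^sup>2) \<le> 2 - 1 / real n"
      using Suc by simp
    moreover have "1 / (1 + real n)\<^sup>2 \<le> 1 / real n - 1 / real (Suc n)"
    proof -
      have "1 / (1 + real n)\<^sup>2 \<le> 1 / (real n * (1 + real n))"
        using False by (intro divide_left_mono) (auto simp: power2_eq_square)
      also have "\<dots> = 1 / real n - 1 / real (Suc n)"
        using False by (simp add: field_simps)
      finally show ?thesis .
    qed
    ultimately show ?thesis by simp
  qed simp
qed simp

text \<open>The lags to the left and to the right of \<open>i\<close> contribute at most 2 each,
  whatever \<open>n\<close> is.\<close>

lemma sum_lag_squares_le:
  assumes "i < n"
  shows "(\<Sum>j<n. 1 / (1 + \<bar>real i - real j\<bar>)\<^sup>2) \<le> 4"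
proof -
  have b: "(\<Sum>k<m. 1 / (1 + real k)\<^sup>2) \<le> 2" for m
    using sum_inverse_squares_le[of m] by (cases "m = 0") (auto intro: order_trans)
  have "(\<Sum>j<n. 1 / (1 + \<bar>real i - real j\<bar>)\<^sup>2) =
      (\<Sum>j\<in>{..i} \<union> {i<..<n}. 1 / (1 + \<bar>real i - real j\<bar>)\<^sup>2)"
    using assms by (intro sum.cong) auto
  also have "\<dots> = (\<Sum>j\<in>{..i}. 1 / (1 + \<bar>real i - real j\<bar>)\<^sup>2) + (\<Sum>j\<in>{i<..<n}. 1 / (1 + \<bar>real i - real j\<bar>)\<^sup>2)"
    by (intro sum.union_disjoint) auto
  also have "(\<Sum>j\<in>{..i}. 1 / (1 + \<bar>real i - real j\<bar>)\<^sup>2) = (\<Sum>k<Suc i. 1 / (1 + real k)\<^sup>2)"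
    by (rule sum.reindex_bij_witness[of _ "\<lambda>k. i - k" "\<lambda>k. i - k"]) auto
  also have "(\<Sum>j\<in>{i<..<n}. 1 / (1 + \<bar>real i - real j\<bar>)\<^sup>2) = (\<Sum>k\<in>{1..<n-i}. 1 / (1 + real k)\<^sup>2)"
    by (rule sum.reindex_bij_witness[of _ "\<lambda>k. i + k" "\<lambda>k. k - i"]) auto
  also have "\<dots> \<le> (\<Sum>k<n - i. 1 / (1 + real k)\<^sup>2)"
    by (intro sum_mono2) auto
  finally show ?thesis
    using b[of "Suc i"] b[of "n - i"] by linarith
qed

text \<open>By Isserlis' formula the left side of \<open>bound\<close> is the covariance of two
  products. Among the \<open>n * n\<close> pairs the decaying part sums to at most
  \<open>4 * a * n\<close> and the constant part to \<open>b * n\<^sup>2\<close>. The term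
  \<open>b\<close> takes a contribution that is small by itself and need not be averaged
  out.\<close>

lemma (in gaussian_space) sample_covariance_variance:
  assumes n: "n > 0" and U: "\<And>i. i < n \<Longrightarrow> U i \<in> H" and V: "\<And>i. i < n \<Longrightarrow> V i \<in> H"
    and \<mu>: "\<And>i. i < n \<Longrightarrow> expectation (\<lambda>\<omega>. U i \<omega> * V i \<omega>) = \<mu>"
    and bound: "\<And>i j. i < n \<Longrightarrow> j < n \<Longrightarrow>
      expectation (\<lambda>\<omega>. U i \<omega> * U j \<omega>) * expectation (\<lambda>\<omega>. V i \<omega> * V j \<omega>)
      + expectation (\<lambda>\<omega>. U i \<omega> * V j \<omega>) * expectation (\<lambda>\<omega>. V i \<omega> * U j \<omega>)
      \<le> a / (1 + \<bar>real i - real j\<bar>)\<^sup>2 + b"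
    and a: "a \<ge> 0"
  defines "S \<equiv> \<lambda>\<omega>. (\<Sum>i<n. U i \<omega> * V i \<omega>) / real n"
  shows "integrable M (\<lambda>\<omega>. (S \<omega> - \<mu>)\<^sup>2)"
    and "expectation (\<lambda>\<omega>. (S \<omega> - \<mu>)\<^sup>2) \<le> 4 * a / real n + b"
proof -
  define g where "g i j \<omega> = (U i \<omega> * V i \<omega> - \<mu>) * (U j \<omega> * V j \<omega> - \<mu>)" for i j \<omega>
  have g_eq: "g i j \<omega> = U i \<omega> * V i \<omega> * (U j \<omega> * V j \<omega>) - \<mu> * (U i \<omega> * V i \<omega>) - \<mu> * (U j \<omega> * V j \<omega>) + \<mu> * \<mu>" for i j \<omega>
    by (simp add: g_def algebra_simps)
  have int: "integrable M (g i j)" if "i < n" "j < n" for i j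
    unfolding g_eq[abs_def] using that by (intro Bochner_Integration.integrable_add Bochner_Integration.integrable_diff int_prod4 integrable_mult_right int_prod2 U V) auto
  have Eg: "expectation (g i j) \<le> a * (1 / (1 + \<bar>real i - real j\<bar>)\<^sup>2) + b" if ij: "i < n" "j < n" for i j
  proof -
    have "expectation (g i j) = expectation (\<lambda>\<omega>. U i \<omega> * V i \<omega> * (U j \<omega> * V j \<omega>)) - \<mu> * \<mu> - \<mu> * \<mu> + \<mu> * \<mu>"
      unfolding g_eq[abs_def] using ij by (simp add: int_prod4 int_prod2 U V \<mu> prob_space)
    also have "\<dots> = expectation (\<lambda>\<omega>. U i \<omega> * U j \<omega>) * expectation (\<lambda>\<omega>. V i \<omega> * V j \<omega>)
      + expectation (\<lambda>\<omega>. U i \<omega> * V j \<omega>) * expectation (\<lambda>\<omega>. V i \<omega> * U j \<omega>)"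
      using ij by (simp add: isserlis U V \<mu>)
    finally show ?thesis using bound[OF ij] by simp
  qed
  have "S \<omega> - \<mu> = (\<Sum>i<n. U i \<omega> * V i \<omega> - \<mu>) / real n" for \<omega>
    using n by (simp add: S_def sum_subtractf diff_divide_distrib)
  then have sq: "(S \<omega> - \<mu>)\<^sup>2 = (\<Sum>i<n. \<Sum>j<n. g i j \<omega>) / (real n)\<^sup>2" for \<omega>
    by (simp add: power_divide power2_eq_square sum_product g_def)
  show "integrable M (\<lambda>\<omega>. (S \<omega> - \<mu>)\<^sup>2)"
    unfolding sq by (intro integrable_divide Bochner_Integration.integrable_sum int) auto
  have "expectation (\<lambda>\<omega>. (S \<omega> - \<mu>)\<^sup>2) = (\<Sum>i<n. \<Sum>j<n. expectation (g i j)) / (real n)\<^sup>2"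
  proof -
    have "expectation (\<lambda>\<omega>. \<Sum>i<n. \<Sum>j<n. g i j \<omega>) = (\<Sum>i<n. \<Sum>j<n. expectation (g i j))"
      by (subst Bochner_Integration.integral_sum, intro Bochner_Integration.integrable_sum int,
          simp_all, intro sum.cong refl, subst Bochner_Integration.integral_sum) (auto intro: int)
    then show ?thesis unfolding sq by simp
  qed
  also have "\<dots> \<le> (\<Sum>i<n. \<Sum>j<n. a * (1 / (1 + \<bar>real i - real j\<bar>)\<^sup>2) + b) / (real n)\<^sup>2"
    by (intro divide_right_mono sum_mono Eg) auto
  also have "(\<Sum>i<n. \<Sum>j<n. a * (1 / (1 + \<bar>real i - real j\<bar>)\<^sup>2) + b) \<le> (\<Sum>i<n. 4 * a + real n * b)"
  proof (rule sum_mono)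
    fix i assume "i \<in> {..<n}"
    then have "a * (\<Sum>j<n. 1 / (1 + \<bar>real i - real j\<bar>)\<^sup>2) \<le> a * 4"
      using a by (intro mult_left_mono sum_lag_squares_le) auto
    then show "(\<Sum>j<n. a * (1 / (1 + \<bar>real i - real j\<bar>)\<^sup>2) + b) \<le> 4 * a + real n * b"
      by (simp add: sum.distrib sum_distrib_left)
  qed
  also have "(\<Sum>i<n. 4 * a + real n * b) / (real n)\<^sup>2 = 4 * a / real n + b"
    using n by (simp add: power2_eq_square field_simps)
  finally show "expectation (\<lambda>\<omega>. (S \<omega> - \<mu>)\<^sup>2) \<le> 4 * a / real n + b"
    by (simp add: divide_right_mono)
qed


section \<open>Regression with small errors\<close>

lemma tendsto_0_le:
  fixes f g :: "nat \<Rightarrow> real"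
  assumes "g \<longlonglongrightarrow> 0" "\<And>n. 0 \<le> f n" "\<And>n. f n \<le> g n"
  shows "f \<longlonglongrightarrow> 0"
  using assms by (intro tendsto_sandwich[of "\<lambda>_. 0" f sequentially g]) auto

context prob_space
begin

text \<open>Chebyshev's inequality on the scale \<open>s n\<close>.\<close>

lemma deviation_tendsto_0:
  fixes N :: "nat \<Rightarrow> 'a \<Rightarrow> real"
  assumes N: "\<And>n. integrable M (\<lambda>\<omega>. (N n \<omega> - \<mu> n)\<^sup>2)"
    and lim: "(\<lambda>n. expectation (\<lambda>\<omega>. (N n \<omega> - \<mu> n)\<^sup>2) / (s n)\<^sup>2) \<longlonglongrightarrow> 0"
    and s: "\<And>n. s n > 0" and \<delta>: "\<delta> > 0"
  shows "(\<lambda>n. prob {\<omega> \<in> space M. \<delta> * s n \<le> \<bar>N n \<omega> - \<mu> n\<bar>}) \<longlonglongrightarrow> 0"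
proof (rule tendsto_sandwich[OF _ _ tendsto_const])
  show "\<forall>\<^sub>F n in sequentially. 0 \<le> prob {\<omega> \<in> space M. \<delta> * s n \<le> \<bar>N n \<omega> - \<mu> n\<bar>}"
    by simp
  show "(\<lambda>n. expectation (\<lambda>\<omega>. (N n \<omega> - \<mu> n)\<^sup>2) / (s n)\<^sup>2 / \<delta>\<^sup>2) \<longlonglongrightarrow> 0"
    using tendsto_divide[OF lim tendsto_const[of "\<delta>\<^sup>2"]] \<delta> by simp
  show "\<forall>\<^sub>F n in sequentially. prob {\<omega> \<in> space M. \<delta> * s n \<le> \<bar>N n \<omega> - \<mu> n\<bar>}
      \<le> expectation (\<lambda>\<omega>. (N n \<omega> - \<mu> n)\<^sup>2) / (s n)\<^sup>2 / \<delta>\<^sup>2"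
  proof (intro always_eventually allI)
    fix n
    have ds: "0 < \<delta> * s n" using s[of n] \<delta> by simp
    have "{\<omega> \<in> space M. \<delta> * s n \<le> \<bar>N n \<omega> - \<mu> n\<bar>} = {\<omega> \<in> space M. (\<delta> * s n)\<^sup>2 \<le> (N n \<omega> - \<mu> n)\<^sup>2}"
      using ds by (auto simp: abs_le_square_iff[symmetric] abs_of_pos)
    also have "prob \<dots> \<le> expectation (\<lambda>\<omega>. (N n \<omega> - \<mu> n)\<^sup>2) / (\<delta> * s n)\<^sup>2"
      using ds by (intro integral_Markov_inequality_measure[OF N sets.top]) auto
    finally show "prob {\<omega> \<in> space M. \<delta> * s n \<le> \<bar>N n \<omega> - \<mu> n\<bar>}
      \<le> expectation (\<lambda>\<omega>. (N n \<omega> - \<mu> n)\<^sup>2) / (s n)\<^sup>2 / \<delta>\<^sup>2"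
      by (simp add: power_mult_distrib mult.commute)
  qed
qed

text \<open>The event \<open>\<epsilon> * D \<le> \<bar>N\<bar>\<close> includes \<open>D = 0\<close>, where the quotient \<open>N / D\<close> is junk.\<close>

lemma ratio_tendsto_0:
  fixes N D :: "nat \<Rightarrow> 'a \<Rightarrow> real"
  assumes [measurable]: "\<And>n. N n \<in> borel_measurable M" "\<And>n. D n \<in> borel_measurable M"
    and N: "\<And>n. integrable M (\<lambda>\<omega>. (N n \<omega> - \<mu> n)\<^sup>2)"
      "(\<lambda>n. expectation (\<lambda>\<omega>. (N n \<omega> - \<mu> n)\<^sup>2) / (s n)\<^sup>2) \<longlonglongrightarrow> 0"
      "(\<lambda>n. \<mu> n / s n) \<longlonglongrightarrow> 0"
    and D: "\<And>n. integrable M (\<lambda>\<omega>. (D n \<omega> - \<nu> n)\<^sup>2)"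
      "(\<lambda>n. expectation (\<lambda>\<omega>. (D n \<omega> - \<nu> n)\<^sup>2) / (s n)\<^sup>2) \<longlonglongrightarrow> 0"
      "(\<lambda>n. \<nu> n / s n) \<longlonglongrightarrow> C" "C > 0"
    and s: "\<And>n. s n > 0" and \<epsilon>: "\<epsilon> > 0"
  shows "(\<lambda>n. prob {\<omega> \<in> space M. \<epsilon> * D n \<omega> \<le> \<bar>N n \<omega>\<bar>}) \<longlonglongrightarrow> 0"
proof (rule tendsto_sandwich[OF _ _ tendsto_const])
  \<comment> \<open>Outside \<open>Q n\<close> the denominator exceeds \<open>C / 4 * s n\<close>,
    since eventually its mean exceeds \<open>C / 2 * s n\<close>. The allowance for \<open>N\<close>
    is then \<open>\<epsilon> * C / 4 * s n\<close>, shared equally by its mean and its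
    deviation.\<close>
  define P Q where "P n = {\<omega> \<in> space M. (\<epsilon> * C / 8) * s n \<le> \<bar>N n \<omega> - \<mu> n\<bar>}"
    and "Q n = {\<omega> \<in> space M. (C / 4) * s n \<le> \<bar>D n \<omega> - \<nu> n\<bar>}" for n
  have sets: "P n \<in> events" "Q n \<in> events" for n
    unfolding P_def Q_def by measurable
  show "\<forall>\<^sub>F n in sequentially. 0 \<le> prob {\<omega> \<in> space M. \<epsilon> * D n \<omega> \<le> \<bar>N n \<omega>\<bar>}"
    by simp
  have "(\<lambda>n. prob (P n)) \<longlonglongrightarrow> 0"
    unfolding P_def using \<epsilon> D(4) by (intro deviation_tendsto_0[OF N(1,2) s]) simp
  moreover have "(\<lambda>n. prob (Q n)) \<longlonglongrightarrow> 0"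
    unfolding Q_def using D(4) by (intro deviation_tendsto_0[OF D(1,2) s]) simp
  ultimately show "(\<lambda>n. prob (P n) + prob (Q n)) \<longlonglongrightarrow> 0"
    using tendsto_add[of _ 0 sequentially _ 0] by simp
  have "\<forall>\<^sub>F n in sequentially. \<bar>\<mu> n / s n\<bar> < \<epsilon> * C / 8"
    using N(3) \<epsilon> D(4) by (intro order_tendstoD(2)[of _ 0] tendsto_rabs_zero) auto
  moreover have "\<forall>\<^sub>F n in sequentially. \<nu> n / s n > C / 2"
    using D(3,4) by (intro order_tendstoD(1)[of _ C]) auto
  ultimately show "\<forall>\<^sub>F n in sequentially. prob {\<omega> \<in> space M. \<epsilon> * D n \<omega> \<le> \<bar>N n \<omega>\<bar>} \<le> prob (P n) + prob (Q n)"
  proof eventually_elim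
    case (elim n)
    have \<mu>: "\<bar>\<mu> n\<bar> < \<epsilon> * C / 8 * s n"
      using elim(1) s[of n] by (simp add: pos_divide_less_eq)
    have \<nu>: "C / 2 * s n < \<nu> n"
      using elim(2) s[of n] by (simp add: pos_less_divide_eq)
    have "{\<omega> \<in> space M. \<epsilon> * D n \<omega> \<le> \<bar>N n \<omega>\<bar>} \<subseteq> P n \<union> Q n"
    proof (safe)
      fix \<omega> assume \<omega>: "\<omega> \<in> space M" "\<epsilon> * D n \<omega> \<le> \<bar>N n \<omega>\<bar>" "\<omega> \<notin> Q n"
      then have "\<bar>D n \<omega> - \<nu> n\<bar> < C / 4 * s n"
        by (simp add: Q_def not_le)
      then have "C / 4 * s n < D n \<omega>"
        using \<nu> by linarith
      then have "\<epsilon> * (C / 4 * s n) < \<epsilon> * D n \<omega>"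
        using \<epsilon> by simp
      moreover have "\<epsilon> * (C / 4 * s n) = 2 * (\<epsilon> * C / 8 * s n)"
        by simp
      ultimately have "\<epsilon> * C / 8 * s n \<le> \<bar>N n \<omega> - \<mu> n\<bar>"
        using \<omega>(2) \<mu> by linarith
      then show "\<omega> \<in> P n"
        using \<omega>(1) by (simp add: P_def)
    qed
    then have "prob {\<omega> \<in> space M. \<epsilon> * D n \<omega> \<le> \<bar>N n \<omega>\<bar>} \<le> prob (P n \<union> Q n)"
      using sets by (intro finite_measure_mono) auto
    also have "\<dots> \<le> prob (P n) + prob (Q n)"
      using sets by (intro measure_Un_le)
    finally show ?case .
  qed
qed

text \<open>A single real random variable is tight: the tail events decrease to the empty
  set.\<close>

lemma exists_tail_bound:
  fixes T :: "'a \<Rightarrow> real"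
  assumes [measurable]: "T \<in> borel_measurable M" and \<epsilon>: "\<epsilon> > 0"
  shows "\<exists>t\<ge>0. prob {\<omega> \<in> space M. t < \<bar>T \<omega>\<bar>} < \<epsilon>"
proof -
  let ?A = "\<lambda>n::nat. {\<omega> \<in> space M. real n < \<bar>T \<omega>\<bar>}"
  have "(\<lambda>n. prob (?A n)) \<longlonglongrightarrow> prob (\<Inter>n. ?A n)"
    by (rule finite_Lim_measure_decseq) (auto simp: decseq_def)
  also have "(\<Inter>n. ?A n) = {}"
  proof -
    have "\<exists>n. \<not> real n < \<bar>T \<omega>\<bar>" for \<omega>
      using real_arch_simple[of "\<bar>T \<omega>\<bar>"] by (auto simp: not_less)
    then show ?thesis by blast
  qed
  finally have "\<forall>\<^sub>F n in sequentially. prob (?A n) < \<epsilon>"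
    using \<epsilon> by (auto intro: order_tendstoD)
  then obtain n where "prob (?A n) < \<epsilon>"
    by (auto simp: eventually_sequentially)
  then show ?thesis by (intro exI[of _ "real n"]) auto
qed

text \<open>\<open>D\<^sub>1\<close>, \<open>D\<^sub>2\<close>, \<open>N\<^sub>1\<^sub>2\<close>, \<open>N\<^sub>1\<^sub>3\<close>, \<open>N\<^sub>2\<^sub>3\<close> are the
  empirical second moments of two regressors and an error.  The regression on the second regressor
  amplifies the error in the first coefficient by the uncontrolled factor \<open>N\<^sub>1\<^sub>2 / D\<^sub>2\<close>;
  hence the first coefficient is estimated at a scale \<open>k n\<close> so fine that this is harmless.\<close>

lemma two_stage_regression:
  fixes D\<^sub>1 D\<^sub>2 N\<^sub>1\<^sub>2 N\<^sub>1\<^sub>3 N\<^sub>2\<^sub>3 :: "nat \<Rightarrow> 'a \<Rightarrow> real"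
  assumes [measurable]: "\<And>n. D\<^sub>1 n \<in> borel_measurable M" "\<And>n. D\<^sub>2 n \<in> borel_measurable M"
      "\<And>n. N\<^sub>1\<^sub>2 n \<in> borel_measurable M" "\<And>n. N\<^sub>1\<^sub>3 n \<in> borel_measurable M"
      "\<And>n. N\<^sub>2\<^sub>3 n \<in> borel_measurable M"
    and nonneg: "\<And>n \<omega>. D\<^sub>1 n \<omega> \<ge> 0" "\<And>n \<omega>. D\<^sub>2 n \<omega> \<ge> 0"
    and lim12: "\<And>\<epsilon>. \<epsilon> > 0 \<Longrightarrow> (\<lambda>n. prob {\<omega> \<in> space M. \<epsilon> * D\<^sub>1 n \<omega> \<le> \<bar>N\<^sub>1\<^sub>2 n \<omega>\<bar>}) \<longlonglongrightarrow> 0"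
    and lim13: "\<And>\<epsilon>. \<epsilon> > 0 \<Longrightarrow> (\<lambda>n. prob {\<omega> \<in> space M. \<epsilon> * D\<^sub>1 n \<omega> \<le> \<bar>N\<^sub>1\<^sub>3 n \<omega>\<bar>}) \<longlonglongrightarrow> 0"
    and lim23: "\<And>\<epsilon>. \<epsilon> > 0 \<Longrightarrow> (\<lambda>n. prob {\<omega> \<in> space M. \<epsilon> * D\<^sub>2 n \<omega> \<le> \<bar>N\<^sub>2\<^sub>3 n \<omega>\<bar>}) \<longlonglongrightarrow> 0"
  obtains k :: "nat \<Rightarrow> nat" where "\<And>b c \<epsilon>. \<epsilon> > 0 \<Longrightarrow>
    \<exists>E. (\<forall>n. E n \<in> events) \<and> (\<lambda>n. prob (E n)) \<longlonglongrightarrow> 0 \<and>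
      (\<forall>\<^sub>F n in sequentially. \<forall>\<omega>\<in>space M - E n.
        let b' = (b * D\<^sub>1 (k n) \<omega> + c * N\<^sub>1\<^sub>2 (k n) \<omega> + N\<^sub>1\<^sub>3 (k n) \<omega>) / D\<^sub>1 (k n) \<omega>;
            c' = (b * N\<^sub>1\<^sub>2 n \<omega> + c * D\<^sub>2 n \<omega> + N\<^sub>2\<^sub>3 n \<omega> - b' * N\<^sub>1\<^sub>2 n \<omega>) / D\<^sub>2 n \<omega>
        in \<bar>b' - b\<bar> \<le> \<epsilon> \<and> \<bar>c' - c\<bar> \<le> \<epsilon>)"
proof -
  \<comment> \<open>Where \<open>D\<^sub>2 n \<omega> = 0\<close> the quotient is 0 and the point
    may escape this event; such points are caught by the event \<open>G n\<close> below.\<close>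
  define A where "A n t = {\<omega> \<in> space M. t < \<bar>N\<^sub>1\<^sub>2 n \<omega> / D\<^sub>2 n \<omega>\<bar>}" for n t
  have "\<exists>t. t \<ge> 0 \<and> prob (A n t) < 1 / real (Suc n)" for n
    unfolding A_def using exists_tail_bound[of "\<lambda>\<omega>. N\<^sub>1\<^sub>2 n \<omega> / D\<^sub>2 n \<omega>" "1 / real (Suc n)"] by auto
  then obtain t where t: "\<And>n. t n \<ge> 0" "\<And>n. prob (A n (t n)) < 1 / real (Suc n)"
    by metis
  \<comment> \<open>Chosen so that \<open>e n\<close> and \<open>e n * t n\<close> are both at most
    \<open>1 / (n + 1)\<close>.\<close>
  define e where "e n = 1 / (real (Suc n) * (t n + 1))" for n
  have e: "e n > 0" for n using t(1)[of n] by (simp add: e_def)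
  define B\<^sub>2 B\<^sub>3 where "B\<^sub>2 n m = {\<omega> \<in> space M. e n * D\<^sub>1 m \<omega> \<le> \<bar>N\<^sub>1\<^sub>2 m \<omega>\<bar>}"
    and "B\<^sub>3 n m = {\<omega> \<in> space M. e n * D\<^sub>1 m \<omega> \<le> \<bar>N\<^sub>1\<^sub>3 m \<omega>\<bar>}" for n m
  \<comment> \<open>The finer scale is determined by \<open>n\<close> and the laws of the moments
    alone, before \<open>b\<close>, \<open>c\<close> and the accuracy are given. An estimator built
    on it does not depend on the parameter.\<close>
  have "\<exists>m. prob (B\<^sub>2 n m) < 1 / real (Suc n) \<and> prob (B\<^sub>3 n m) < 1 / real (Suc n)" for n
  proof -
    have "\<forall>\<^sub>F m in sequentially. prob (B\<^sub>2 n m) < 1 / real (Suc n) \<and> prob (B\<^sub>3 n m) < 1 / real (Suc n)"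
      unfolding B\<^sub>2_def B\<^sub>3_def
      by (intro eventually_conj order_tendstoD(2)[OF lim12[OF e]] order_tendstoD(2)[OF lim13[OF e]]) auto
    then show ?thesis by (auto simp: eventually_sequentially)
  qed
  then obtain k where k: "\<And>n. prob (B\<^sub>2 n (k n)) < 1 / real (Suc n)" "\<And>n. prob (B\<^sub>3 n (k n)) < 1 / real (Suc n)"
    by metis
  show ?thesis
  proof (rule that[of k])
    fix b c \<epsilon> :: real assume \<epsilon>: "\<epsilon> > 0"
    define G where "G n = {\<omega> \<in> space M. \<epsilon> / 2 * D\<^sub>2 n \<omega> \<le> \<bar>N\<^sub>2\<^sub>3 n \<omega>\<bar>}" for n
    define E where "E n = (A n (t n) \<union> B\<^sub>2 n (k n)) \<union> (B\<^sub>3 n (k n) \<union> G n)" for n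
    have sets: "A n x \<in> events" "B\<^sub>2 n m \<in> events" "B\<^sub>3 n m \<in> events" "G n \<in> events" for n m x
      unfolding A_def B\<^sub>2_def B\<^sub>3_def G_def by measurable
    have probE: "prob (E n) \<le> 3 * (1 / real (Suc n)) + prob (G n)" for n
    proof -
      have "prob (E n) \<le> (prob (A n (t n)) + prob (B\<^sub>2 n (k n))) + (prob (B\<^sub>3 n (k n)) + prob (G n))"
        unfolding E_def using sets
        by (intro order_trans[OF measure_Un_le] add_mono measure_Un_le) auto
      then show ?thesis using t(2)[of n] k(1)[of n] k(2)[of n] by linarith
    qed
    have inv: "(\<lambda>n. 1 / real (Suc n)) \<longlonglongrightarrow> 0"
      using LIMSEQ_inverse_real_of_nat by (simp add: inverse_eq_divide)
    have "(\<lambda>n. prob (G n)) \<longlonglongrightarrow> 0"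
      unfolding G_def using \<epsilon> by (intro lim23) auto
    then have "(\<lambda>n. 3 * (1 / real (Suc n)) + prob (G n)) \<longlonglongrightarrow> 3 * 0 + 0"
      by (intro tendsto_intros inv)
    then have limE: "(\<lambda>n. prob (E n)) \<longlonglongrightarrow> 0"
      using probE by (intro tendsto_sandwich[of "\<lambda>_. 0" "\<lambda>n. prob (E n)" sequentially "\<lambda>n. 3 * (1 / real (Suc n)) + prob (G n)"]
          always_eventually allI) simp_all
    have "(\<lambda>n. (\<bar>c\<bar> + 1) * (1 / real (Suc n))) \<longlonglongrightarrow> (\<bar>c\<bar> + 1) * 0"
      by (intro tendsto_intros inv)
    then have small: "\<forall>\<^sub>F n in sequentially. (\<bar>c\<bar> + 1) * (1 / real (Suc n)) < \<epsilon> / 2"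
      using \<epsilon> by (intro order_tendstoD(2)) auto
    have main: "\<bar>b' - b\<bar> \<le> \<epsilon> \<and> \<bar>c' - c\<bar> \<le> \<epsilon>"
      if n: "(\<bar>c\<bar> + 1) * (1 / real (Suc n)) < \<epsilon> / 2" and \<omega>: "\<omega> \<in> space M" "\<omega> \<notin> E n"
        and b': "b' = (b * D\<^sub>1 (k n) \<omega> + c * N\<^sub>1\<^sub>2 (k n) \<omega> + N\<^sub>1\<^sub>3 (k n) \<omega>) / D\<^sub>1 (k n) \<omega>"
        and c': "c' = (b * N\<^sub>1\<^sub>2 n \<omega> + c * D\<^sub>2 n \<omega> + N\<^sub>2\<^sub>3 n \<omega> - b' * N\<^sub>1\<^sub>2 n \<omega>) / D\<^sub>2 n \<omega>"
      for n \<omega> b' c'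
    proof -
      have 1: "\<bar>N\<^sub>1\<^sub>2 n \<omega> / D\<^sub>2 n \<omega>\<bar> \<le> t n" "\<bar>N\<^sub>1\<^sub>2 (k n) \<omega>\<bar> < e n * D\<^sub>1 (k n) \<omega>"
        "\<bar>N\<^sub>1\<^sub>3 (k n) \<omega>\<bar> < e n * D\<^sub>1 (k n) \<omega>" "\<bar>N\<^sub>2\<^sub>3 n \<omega>\<bar> < \<epsilon> / 2 * D\<^sub>2 n \<omega>"
        using \<omega> by (auto simp: E_def A_def B\<^sub>2_def B\<^sub>3_def G_def)
      \<comment> \<open>A strict bound of an absolute value by a multiple of a nonnegative quantity
        rules out that this quantity is 0.\<close>
      have D: "D\<^sub>1 (k n) \<omega> > 0" "D\<^sub>2 n \<omega> > 0"
        using 1 nonneg[of "k n" \<omega>] nonneg[of n \<omega>] by (auto simp: less_le)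
      have "b' - b = c * (N\<^sub>1\<^sub>2 (k n) \<omega> / D\<^sub>1 (k n) \<omega>) + N\<^sub>1\<^sub>3 (k n) \<omega> / D\<^sub>1 (k n) \<omega>"
        using D unfolding b' by (simp add: field_simps)
      also have "\<bar>\<dots>\<bar> \<le> \<bar>c\<bar> * \<bar>N\<^sub>1\<^sub>2 (k n) \<omega> / D\<^sub>1 (k n) \<omega>\<bar> + \<bar>N\<^sub>1\<^sub>3 (k n) \<omega> / D\<^sub>1 (k n) \<omega>\<bar>"
        by (rule order_trans[OF abs_triangle_ineq]) (simp add: abs_mult)
      also have "\<dots> \<le> \<bar>c\<bar> * e n + e n"
        using 1 D by (intro add_mono mult_left_mono) (auto simp: pos_divide_le_eq)
      finally have bb: "\<bar>b' - b\<bar> \<le> (\<bar>c\<bar> + 1) * e n"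
        by (simp add: algebra_simps)
      have en: "e n \<le> 1 / real (Suc n)" "e n * t n \<le> 1 / real (Suc n)"
      proof -
        have eq: "e n = 1 / real (Suc n) * (1 / (t n + 1))" by (simp add: e_def)
        have "1 / (t n + 1) \<le> 1" "1 / (t n + 1) * t n \<le> 1"
          using t(1)[of n] by (auto simp: pos_divide_le_eq)
        then show "e n \<le> 1 / real (Suc n)" "e n * t n \<le> 1 / real (Suc n)"
          unfolding eq mult.assoc by (intro mult_left_le; simp)+
      qed
      have "(\<bar>c\<bar> + 1) * e n \<le> (\<bar>c\<bar> + 1) * (1 / real (Suc n))"
        by (intro mult_left_mono en) auto
      then have "\<bar>b' - b\<bar> \<le> \<epsilon>" using bb n \<epsilon> by linarith
      have "c' - c = (b - b') * (N\<^sub>1\<^sub>2 n \<omega> / D\<^sub>2 n \<omega>) + N\<^sub>2\<^sub>3 n \<omega> / D\<^sub>2 n \<omega>"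
        using D unfolding c' by (simp add: field_simps)
      also have "\<bar>\<dots>\<bar> \<le> \<bar>b' - b\<bar> * \<bar>N\<^sub>1\<^sub>2 n \<omega> / D\<^sub>2 n \<omega>\<bar> + \<bar>N\<^sub>2\<^sub>3 n \<omega> / D\<^sub>2 n \<omega>\<bar>"
        by (rule order_trans[OF abs_triangle_ineq]) (simp add: abs_mult abs_minus_commute)
      also have "\<dots> \<le> ((\<bar>c\<bar> + 1) * e n) * t n + \<epsilon> / 2"
        using 1 D bb e[of n] by (intro add_mono mult_mono) (auto simp: pos_divide_le_eq)
      also have "((\<bar>c\<bar> + 1) * e n) * t n \<le> (\<bar>c\<bar> + 1) * (1 / real (Suc n))"
        unfolding mult.assoc by (intro mult_left_mono en) auto
      finally show ?thesis using \<open>\<bar>b' - b\<bar> \<le> \<epsilon>\<close> n by linarith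
    qed
    show "\<exists>E. (\<forall>n. E n \<in> events) \<and> (\<lambda>n. prob (E n)) \<longlonglongrightarrow> 0 \<and>
      (\<forall>\<^sub>F n in sequentially. \<forall>\<omega>\<in>space M - E n.
        let b' = (b * D\<^sub>1 (k n) \<omega> + c * N\<^sub>1\<^sub>2 (k n) \<omega> + N\<^sub>1\<^sub>3 (k n) \<omega>) / D\<^sub>1 (k n) \<omega>;
            c' = (b * N\<^sub>1\<^sub>2 n \<omega> + c * D\<^sub>2 n \<omega> + N\<^sub>2\<^sub>3 n \<omega> - b' * N\<^sub>1\<^sub>2 n \<omega>) / D\<^sub>2 n \<omega>
        in \<bar>b' - b\<bar> \<le> \<epsilon> \<and> \<bar>c' - c\<bar> \<le> \<epsilon>)"
    proof (intro exI[of _ E] conjI allI limE)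
      show "E n \<in> events" for n
        unfolding E_def using sets by auto
      show "\<forall>\<^sub>F n in sequentially. \<forall>\<omega>\<in>space M - E n.
        let b' = (b * D\<^sub>1 (k n) \<omega> + c * N\<^sub>1\<^sub>2 (k n) \<omega> + N\<^sub>1\<^sub>3 (k n) \<omega>) / D\<^sub>1 (k n) \<omega>;
            c' = (b * N\<^sub>1\<^sub>2 n \<omega> + c * D\<^sub>2 n \<omega> + N\<^sub>2\<^sub>3 n \<omega> - b' * N\<^sub>1\<^sub>2 n \<omega>) / D\<^sub>2 n \<omega>
        in \<bar>b' - b\<bar> \<le> \<epsilon> \<and> \<bar>c' - c\<bar> \<le> \<epsilon>"
        using small unfolding Let_def by eventually_elim (use main in blast)
    qed
  qed
qed

end

text \<open>The sample type is left open: these means are formed both on the probability space and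
  on the space of observed paths.\<close>

definition sample_mean_prod :: "(nat \<Rightarrow> 'w \<Rightarrow> real) \<Rightarrow> (nat \<Rightarrow> 'w \<Rightarrow> real) \<Rightarrow> nat \<Rightarrow> 'w \<Rightarrow> real" where
  "sample_mean_prod U V n \<omega> = (\<Sum>i<n. U i \<omega> * V i \<omega>) / real n"

text \<open>Here \<open>s n\<close> is the order of the regressor variance. The decay in
  \<open>UU\<close> gives the denominator a relative variance of order \<open>1 / n\<close>. The
  bound in \<open>UV\<close> separates what is averaged out (\<open>a\<close>) from what is
  negligible without averaging (\<open>b\<close>).\<close>

lemma (in gaussian_space) regression_tendsto_0:
  fixes U V :: "nat \<Rightarrow> nat \<Rightarrow> 'w \<Rightarrow> real" and s a b :: "nat \<Rightarrow> real"
  assumes U: "\<And>n i. U n i \<in> H" and V: "\<And>n i. V n i \<in> H"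
    and \<mu>: "\<And>n i. i \<le> n \<Longrightarrow> expectation (\<lambda>\<omega>. U n i \<omega> * V n i \<omega>) = \<mu> n" "(\<lambda>n. \<mu> n / s n) \<longlonglongrightarrow> 0"
    and \<nu>: "\<And>n i. i \<le> n \<Longrightarrow> expectation (\<lambda>\<omega>. U n i \<omega> * U n i \<omega>) = \<nu> n" "(\<lambda>n. \<nu> n / s n) \<longlonglongrightarrow> C" "C > 0"
    and UU: "\<And>n i j. i \<le> n \<Longrightarrow> j \<le> n \<Longrightarrow>
      \<bar>expectation (\<lambda>\<omega>. U n i \<omega> * U n j \<omega>)\<bar> \<le> d * s n / (1 + \<bar>real i - real j\<bar>)\<^sup>2"
    and UV: "\<And>n i j. i \<le> n \<Longrightarrow> j \<le> n \<Longrightarrow>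
      expectation (\<lambda>\<omega>. U n i \<omega> * U n j \<omega>) * expectation (\<lambda>\<omega>. V n i \<omega> * V n j \<omega>)
      + expectation (\<lambda>\<omega>. U n i \<omega> * V n j \<omega>) * expectation (\<lambda>\<omega>. V n i \<omega> * U n j \<omega>)
      \<le> a n / (1 + \<bar>real i - real j\<bar>)\<^sup>2 + b n"
    and a: "\<And>n. a n \<ge> 0" "(\<lambda>n. a n / real (Suc n) / (s n)\<^sup>2) \<longlonglongrightarrow> 0"
    and b: "(\<lambda>n. b n / (s n)\<^sup>2) \<longlonglongrightarrow> 0"
    and s: "\<And>n. s n > 0" and \<epsilon>: "\<epsilon> > 0"
  shows "(\<lambda>n. prob {\<omega> \<in> space M. \<epsilon> * sample_mean_prod (U n) (U n) (Suc n) \<omega>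
      \<le> \<bar>sample_mean_prod (U n) (V n) (Suc n) \<omega>\<bar>}) \<longlonglongrightarrow> 0"
proof (rule ratio_tendsto_0[where s = s and \<mu> = \<mu> and \<nu> = \<nu> and C = C])
  have [measurable]: "U n i \<in> borel_measurable M" "V n i \<in> borel_measurable M" for n i
    using U V meas by auto
  show "sample_mean_prod (U n) (V n) (Suc n) \<in> borel_measurable M"
    "sample_mean_prod (U n) (U n) (Suc n) \<in> borel_measurable M" for n
    unfolding sample_mean_prod_def[abs_def] by measurable
  have UV': "integrable M (\<lambda>\<omega>. (sample_mean_prod (U n) (V n) (Suc n) \<omega> - \<mu> n)\<^sup>2)"
    "expectation (\<lambda>\<omega>. (sample_mean_prod (U n) (V n) (Suc n) \<omega> - \<mu> n)\<^sup>2) \<le> 4 * a n / real (Suc n) + b n" for n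
  proof -
    have 1: "expectation (\<lambda>\<omega>. U n i \<omega> * V n i \<omega>) = \<mu> n" if "i < Suc n" for i
      using \<mu>(1) that by (simp add: less_Suc_eq_le)
    have 2: "expectation (\<lambda>\<omega>. U n i \<omega> * U n j \<omega>) * expectation (\<lambda>\<omega>. V n i \<omega> * V n j \<omega>)
      + expectation (\<lambda>\<omega>. U n i \<omega> * V n j \<omega>) * expectation (\<lambda>\<omega>. V n i \<omega> * U n j \<omega>)
      \<le> a n / (1 + \<bar>real i - real j\<bar>)\<^sup>2 + b n" if "i < Suc n" "j < Suc n" for i j
      using UV that by (simp add: less_Suc_eq_le)
    show "integrable M (\<lambda>\<omega>. (sample_mean_prod (U n) (V n) (Suc n) \<omega> - \<mu> n)\<^sup>2)"
      "expectation (\<lambda>\<omega>. (sample_mean_prod (U n) (V n) (Suc n) \<omega> - \<mu> n)\<^sup>2) \<le> 4 * a n / real (Suc n) + b n"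
      unfolding sample_mean_prod_def
      by (rule sample_covariance_variance[OF zero_less_Suc U V 1 2 a(1)]; assumption)+
  qed
  have UU': "integrable M (\<lambda>\<omega>. (sample_mean_prod (U n) (U n) (Suc n) \<omega> - \<nu> n)\<^sup>2)"
    "expectation (\<lambda>\<omega>. (sample_mean_prod (U n) (U n) (Suc n) \<omega> - \<nu> n)\<^sup>2)
      \<le> 4 * (2 * (d * s n)\<^sup>2) / real (Suc n) + 0" for n
  proof -
    have "expectation (\<lambda>\<omega>. U n i \<omega> * U n j \<omega>) * expectation (\<lambda>\<omega>. U n i \<omega> * U n j \<omega>)
      + expectation (\<lambda>\<omega>. U n i \<omega> * U n j \<omega>) * expectation (\<lambda>\<omega>. U n i \<omega> * U n j \<omega>)
      \<le> 2 * (d * s n)\<^sup>2 / (1 + \<bar>real i - real j\<bar>)\<^sup>2 + 0" if "i < Suc n" "j < Suc n" for i j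
    proof -
      define r where "r = expectation (\<lambda>\<omega>. U n i \<omega> * U n j \<omega>)"
      define l where "l = (1 + \<bar>real i - real j\<bar>)\<^sup>2"
      have l: "l \<ge> 1" by (simp add: l_def)
      have "\<bar>r\<bar> \<le> d * s n / l" using UU[of i n j] that by (simp add: r_def l_def)
      then have "r\<^sup>2 \<le> (d * s n / l)\<^sup>2"
        by (metis abs_ge_zero power2_abs power_mono)
      also have "\<dots> = (d * s n)\<^sup>2 / (l * l)" by (simp add: power_divide power2_eq_square)
      also have "\<dots> \<le> (d * s n)\<^sup>2 / l"
        using l by (intro divide_left_mono) auto
      finally show ?thesis unfolding r_def[symmetric] l_def[symmetric] by (simp add: power2_eq_square)
    qed
    note 2 = this
    have 1: "expectation (\<lambda>\<omega>. U n i \<omega> * U n i \<omega>) = \<nu> n" if "i < Suc n" for i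
      using \<nu>(1) that by (simp add: less_Suc_eq_le)
    have 3: "0 \<le> 2 * (d * s n)\<^sup>2" by simp
    show "integrable M (\<lambda>\<omega>. (sample_mean_prod (U n) (U n) (Suc n) \<omega> - \<nu> n)\<^sup>2)"
      "expectation (\<lambda>\<omega>. (sample_mean_prod (U n) (U n) (Suc n) \<omega> - \<nu> n)\<^sup>2)
        \<le> 4 * (2 * (d * s n)\<^sup>2) / real (Suc n) + 0"
      unfolding sample_mean_prod_def
      by (rule sample_covariance_variance[OF zero_less_Suc U U 1 2 3]; assumption)+
  qed
  have inv: "(\<lambda>n. 1 / real (Suc n)) \<longlonglongrightarrow> 0"
    using LIMSEQ_inverse_real_of_nat by (simp add: inverse_eq_divide)
  show "integrable M (\<lambda>\<omega>. (sample_mean_prod (U n) (V n) (Suc n) \<omega> - \<mu> n)\<^sup>2)"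
    "integrable M (\<lambda>\<omega>. (sample_mean_prod (U n) (U n) (Suc n) \<omega> - \<nu> n)\<^sup>2)" for n
    by (rule UV' UU')+
  have "(\<lambda>n. 4 * (a n / real (Suc n) / (s n)\<^sup>2) + b n / (s n)\<^sup>2) \<longlonglongrightarrow> 4 * 0 + 0"
    by (intro tendsto_intros a b)
  then show "(\<lambda>n. expectation (\<lambda>\<omega>. (sample_mean_prod (U n) (V n) (Suc n) \<omega> - \<mu> n)\<^sup>2) / (s n)\<^sup>2) \<longlonglongrightarrow> 0"
  proof (rule tendsto_0_le[OF tendsto_eq_rhs])
    fix n
    have "expectation (\<lambda>\<omega>. (sample_mean_prod (U n) (V n) (Suc n) \<omega> - \<mu> n)\<^sup>2) / (s n)\<^sup>2
        \<le> (4 * a n / real (Suc n) + b n) / (s n)\<^sup>2"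
      by (intro divide_right_mono UV') simp
    also have "\<dots> = 4 * (a n / real (Suc n) / (s n)\<^sup>2) + b n / (s n)\<^sup>2"
      by (simp add: add_divide_distrib)
    finally show "expectation (\<lambda>\<omega>. (sample_mean_prod (U n) (V n) (Suc n) \<omega> - \<mu> n)\<^sup>2) / (s n)\<^sup>2
        \<le> 4 * (a n / real (Suc n) / (s n)\<^sup>2) + b n / (s n)\<^sup>2" .
  qed auto
  have "(\<lambda>n. 8 * d\<^sup>2 * (1 / real (Suc n))) \<longlonglongrightarrow> 8 * d\<^sup>2 * 0"
    by (intro tendsto_intros inv)
  then show "(\<lambda>n. expectation (\<lambda>\<omega>. (sample_mean_prod (U n) (U n) (Suc n) \<omega> - \<nu> n)\<^sup>2) / (s n)\<^sup>2) \<longlonglongrightarrow> 0"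
  proof (rule tendsto_0_le[OF tendsto_eq_rhs])
    fix n
    have "4 * (2 * (d * s n)\<^sup>2) / real (Suc n) / (s n)\<^sup>2 = 8 * d\<^sup>2 * (1 / real (Suc n))"
      using s[of n] by (simp add: power_mult_distrib)
    moreover have "expectation (\<lambda>\<omega>. (sample_mean_prod (U n) (U n) (Suc n) \<omega> - \<nu> n)\<^sup>2) / (s n)\<^sup>2
        \<le> (4 * (2 * (d * s n)\<^sup>2) / real (Suc n) + 0) / (s n)\<^sup>2"
      by (intro divide_right_mono UU') simp
    ultimately show "expectation (\<lambda>\<omega>. (sample_mean_prod (U n) (U n) (Suc n) \<omega> - \<nu> n)\<^sup>2) / (s n)\<^sup>2
        \<le> 8 * d\<^sup>2 * (1 / real (Suc n))"
      by simp
  qed auto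
qed (use \<mu> \<nu> s \<epsilon> in auto)


section \<open>Choice of the basis; covariances of contrasts\<close>

lemma tendsto_div_powr_0:
  fixes f :: "real \<Rightarrow> real"
  assumes "((\<lambda>h. f h / h powr b) \<longlongrightarrow> l) (at_right 0)" "a < b"
  shows "((\<lambda>h. f h / h powr a) \<longlongrightarrow> 0) (at_right 0)"
proof -
  have "((\<lambda>h. h powr (b - a)) \<longlongrightarrow> 0) (at_right (0::real))"
    using assms(2) by (auto intro!: tendsto_eq_intros eventually_at_rightI[of 0 1])
  with assms(1) have "((\<lambda>h. f h / h powr b * h powr (b - a)) \<longlongrightarrow> l * 0) (at_right 0)"
    by (intro tendsto_intros)
  moreover have "\<forall>\<^sub>F h in at_right 0. f h / h powr b * h powr (b - a) = f h / h powr a"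
    by (rule eventually_mono[OF eventually_at_right_less[of 0]]) (simp add: powr_diff)
  ultimately show ?thesis
    by (simp add: tendsto_cong)
qed

text \<open>One Gram-Schmidt step in the limit, starting from the rougher coordinate direction. The
  bounds on the exponents, also at \<open>v + w\<close>, allow the cross-covariance to be polarised
  later at the rate of \<open>v\<close>.\<close>

lemma regression_basis:
  fixes r :: "real \<Rightarrow> real ^ 2 \<Rightarrow> real ^ 2 \<Rightarrow> real" and \<alpha> :: "real ^ 2 \<Rightarrow> real"
  assumes lin: "\<And>h a b v w u. r h (a *\<^sub>R v + b *\<^sub>R w) u = a * r h v u + b * r h w u"
    and sym: "\<And>h v w. r h v w = r h w v"
    and psd: "\<And>h v. h > 0 \<Longrightarrow> r h v v \<ge> 0"
    and lim: "\<And>v. v \<noteq> 0 \<Longrightarrow> \<exists>C. C \<noteq> 0 \<and> ((\<lambda>h. r h v v / h powr \<alpha> v) \<longlongrightarrow> C) (at_right 0)"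
  obtains v w where "v \<noteq> 0" "w \<noteq> 0" "v + w \<noteq> 0" "\<alpha> v \<le> \<alpha> w" "\<alpha> v \<le> \<alpha> (v + w)"
    "\<And>\<beta>. \<exists>b c. \<beta> = b *\<^sub>R v + c *\<^sub>R w" "((\<lambda>h. r h v w / h powr \<alpha> v) \<longlongrightarrow> 0) (at_right 0)"
proof -
  obtain p q :: "real ^ 2" where pq: "\<alpha> p \<le> \<alpha> q"
    "p = axis 1 1 \<and> q = axis 2 1 \<or> p = axis 2 1 \<and> q = axis 1 1"
    using linorder_linear[of "\<alpha> (axis 1 1)" "\<alpha> (axis 2 1)"] by blast
  have span: "\<exists>b c. \<beta> = b *\<^sub>R p + c *\<^sub>R q" for \<beta>
  proof -
    have e: "\<beta> = (\<beta> $ 1) *\<^sub>R axis 1 1 + (\<beta> $ 2) *\<^sub>R axis 2 1"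
      by (simp add: vec_eq_iff forall_2 axis_def)
    then have "\<beta> = (\<beta> $ 2) *\<^sub>R axis 2 1 + (\<beta> $ 1) *\<^sub>R axis 1 1"
      by (simp add: add.commute)
    with e pq(2) show ?thesis
      by blast
  qed
  have indep: "b *\<^sub>R p + c *\<^sub>R q \<noteq> 0" if "b \<noteq> 0 \<or> c \<noteq> 0" for b c
  proof -
    have "(axis 1 1 :: real ^ 2) $ 2 = 0" "(axis 2 1 :: real ^ 2) $ 1 = 0"
      by (simp_all add: axis_def)
    then show ?thesis
      using pq(2) that by (auto simp: vec_eq_iff forall_2)
  qed
  have p0: "p \<noteq> 0" and q0: "q \<noteq> 0" and pq0: "p + q \<noteq> 0"
    using indep[of 1 0] indep[of 0 1] indep[of 1 1] by auto
  have lin2: "r h u (a *\<^sub>R v + b *\<^sub>R w) = a * r h u v + b * r h u w" for h a b u v w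
    using lin[of h a v b w u] by (simp add: sym[of h u])
  have quad: "r h (b *\<^sub>R p + c *\<^sub>R q) (b *\<^sub>R p + c *\<^sub>R q)
      = b\<^sup>2 * r h p p + 2 * b * c * r h p q + c\<^sup>2 * r h q q" for h b c
    unfolding lin lin2 sym[of h q p] by (simp add: power2_eq_square algebra_simps)
  have lim_le: "\<exists>l. ((\<lambda>h. r h v v / h powr \<alpha> p) \<longlongrightarrow> l) (at_right 0)"
    if v: "v \<noteq> 0" and le: "\<alpha> p \<le> \<alpha> v" for v
  proof (cases "\<alpha> p = \<alpha> v")
    case True
    then show ?thesis using lim[OF v] by auto
  next
    case False
    then have less: "\<alpha> p < \<alpha> v" using le by simp
    obtain C where C: "((\<lambda>h. r h v v / h powr \<alpha> v) \<longlongrightarrow> C) (at_right 0)"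
      using lim[OF v] by blast
    show ?thesis by (rule exI, rule tendsto_div_powr_0[OF C less])
  qed
  obtain Cp Cq where Cp: "((\<lambda>h. r h p p / h powr \<alpha> p) \<longlongrightarrow> Cp) (at_right 0)" "Cp \<noteq> 0"
    and Cq: "((\<lambda>h. r h q q / h powr \<alpha> p) \<longlongrightarrow> Cq) (at_right 0)"
    using lim[OF p0] lim_le[OF q0 pq(1)] by auto
  \<comment> \<open>Nonnegativity at \<open>b p - c q\<close> bounds the form at
    \<open>b p + c q\<close> by \<open>2 * b\<^sup>2\<close> and \<open>2 * c\<^sup>2\<close> times
    the values at \<open>p\<close> and \<open>q\<close>. A rougher \<open>v\<close> would have a
    non-zero limit on its own scale, while this bound tends to 0 there.\<close>
  have min: "\<alpha> p \<le> \<alpha> v" if v: "v \<noteq> 0" for v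
  proof (rule ccontr)
    assume "\<not> \<alpha> p \<le> \<alpha> v"
    then have less: "\<alpha> v < \<alpha> p" by simp
    obtain b c where bc: "v = b *\<^sub>R p + c *\<^sub>R q" using span by blast
    obtain C where C: "C \<noteq> 0" "((\<lambda>h. r h v v / h powr \<alpha> v) \<longlongrightarrow> C) (at_right 0)"
      using lim[OF v] by blast
    have "((\<lambda>h. 2 * b\<^sup>2 * (r h p p / h powr \<alpha> v) + 2 * c\<^sup>2 * (r h q q / h powr \<alpha> v))
        \<longlongrightarrow> 2 * b\<^sup>2 * 0 + 2 * c\<^sup>2 * 0) (at_right 0)"
      by (intro tendsto_intros tendsto_div_powr_0[OF Cp(1) less] tendsto_div_powr_0[OF Cq less])
    then have lim0: "((\<lambda>h. 2 * b\<^sup>2 * (r h p p / h powr \<alpha> v) + 2 * c\<^sup>2 * (r h q q / h powr \<alpha> v))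
        \<longlongrightarrow> 0) (at_right 0)" by simp
    have le: "\<forall>\<^sub>F h in at_right 0. norm (r h v v / h powr \<alpha> v)
        \<le> 2 * b\<^sup>2 * (r h p p / h powr \<alpha> v) + 2 * c\<^sup>2 * (r h q q / h powr \<alpha> v)"
    proof (rule eventually_mono[OF eventually_at_right_less[of 0]])
      fix h :: real assume h: "0 < h"
      have "0 \<le> r h (b *\<^sub>R p + (- c) *\<^sub>R q) (b *\<^sub>R p + (- c) *\<^sub>R q)"
        using h by (rule psd)
      then have "r h v v \<le> 2 * b\<^sup>2 * r h p p + 2 * c\<^sup>2 * r h q q"
        unfolding bc quad by (simp add: algebra_simps)
      then have "r h v v / h powr \<alpha> v \<le> (2 * b\<^sup>2 * r h p p + 2 * c\<^sup>2 * r h q q) / h powr \<alpha> v"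
        by (intro divide_right_mono) auto
      then show "norm (r h v v / h powr \<alpha> v)
          \<le> 2 * b\<^sup>2 * (r h p p / h powr \<alpha> v) + 2 * c\<^sup>2 * (r h q q / h powr \<alpha> v)"
        using psd[OF h, of v] by (simp add: add_divide_distrib)
    qed
    have "((\<lambda>h. r h v v / h powr \<alpha> v) \<longlongrightarrow> 0) (at_right 0)"
      by (rule Lim_null_comparison[OF le lim0])
    then show False
      using tendsto_unique[OF trivial_limit_at_right_real C(2)] C(1) by blast
  qed
  obtain Cs where Cs: "((\<lambda>h. r h (p + q) (p + q) / h powr \<alpha> p) \<longlongrightarrow> Cs) (at_right 0)"
    using lim_le[OF pq0 min[OF pq0]] by blast
  \<comment> \<open>Polarisation: \<open>l\<close> is the limit of the cross term on the scale of
    \<open>p\<close>.\<close>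
  define l where "l = (Cs - Cp - Cq) / 2"
  have "((\<lambda>h. (r h (p + q) (p + q) / h powr \<alpha> p - r h p p / h powr \<alpha> p - r h q q / h powr \<alpha> p) / 2)
      \<longlongrightarrow> l) (at_right 0)"
    unfolding l_def by (intro tendsto_intros Cs Cp Cq) simp
  moreover have "(r h (p + q) (p + q) / h powr \<alpha> p - r h p p / h powr \<alpha> p - r h q q / h powr \<alpha> p) / 2
      = r h p q / h powr \<alpha> p" for h
    using quad[of h 1 1] by (simp add: add_divide_distrib)
  ultimately have l: "((\<lambda>h. r h p q / h powr \<alpha> p) \<longlongrightarrow> l) (at_right 0)"
    by simp
  \<comment> \<open>Subtracting the asymptotic projection onto \<open>p\<close> removes this
    limit.\<close>
  define w where "w = (- (l / Cp)) *\<^sub>R p + 1 *\<^sub>R q"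
  have "((\<lambda>h. - (l / Cp) * (r h p p / h powr \<alpha> p) + r h p q / h powr \<alpha> p)
      \<longlongrightarrow> - (l / Cp) * Cp + l) (at_right 0)"
    by (intro tendsto_intros l Cp)
  then have limw: "((\<lambda>h. r h p w / h powr \<alpha> p) \<longlongrightarrow> 0) (at_right 0)"
    using Cp(2) unfolding w_def lin2 by (simp add: add_divide_distrib diff_divide_distrib)
  have w0: "w \<noteq> 0" unfolding w_def by (rule indep) simp
  have "p + w = (1 - l / Cp) *\<^sub>R p + 1 *\<^sub>R q"
    by (simp add: w_def algebra_simps)
  then have pw0: "p + w \<noteq> 0" using indep[of "1 - l / Cp" 1] by simp
  show ?thesis
  proof (rule that[OF p0 w0 pw0 min[OF w0] min[OF pw0] _ limw])
    fix \<beta>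
    obtain b c where "\<beta> = b *\<^sub>R p + c *\<^sub>R q" using span by blast
    then have "\<beta> = (b + c * (l / Cp)) *\<^sub>R p + c *\<^sub>R w"
      by (simp add: w_def algebra_simps)
    then show "\<exists>b c. \<beta> = b *\<^sub>R p + c *\<^sub>R w" by blast
  qed
qed

text \<open>Integrability of \<open>U\<close> is included because that of the square alone does not
  make \<open>U\<close> measurable.\<close>

definition square_integrable :: "'w measure \<Rightarrow> ('w \<Rightarrow> real) \<Rightarrow> bool" where
  "square_integrable M U \<longleftrightarrow> integrable M U \<and> integrable M (\<lambda>\<omega>. (U \<omega>)\<^sup>2)"

lemma square_integrable_mult:
  assumes "square_integrable M U" "square_integrable M V"
  shows "integrable M (\<lambda>\<omega>. U \<omega> * V \<omega>)"
proof (rule Bochner_Integration.integrable_bound)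
  show "integrable M (\<lambda>\<omega>. (U \<omega>)\<^sup>2 + (V \<omega>)\<^sup>2)"
    using assms by (auto simp: square_integrable_def)
  show "(\<lambda>\<omega>. U \<omega> * V \<omega>) \<in> borel_measurable M"
    using assms by (auto simp: square_integrable_def)
  have "\<bar>x * y\<bar> \<le> x\<^sup>2 + y\<^sup>2" for x y :: real
  proof -
    have "2 * \<bar>x * y\<bar> \<le> x\<^sup>2 + y\<^sup>2"
      using sum_squares_bound[of "\<bar>x\<bar>" "\<bar>y\<bar>"] by (simp add: abs_mult)
    then show ?thesis by linarith
  qed
  then show "AE \<omega> in M. norm (U \<omega> * V \<omega>) \<le> norm ((U \<omega>)\<^sup>2 + (V \<omega>)\<^sup>2)"
    by auto
qed

lemma square_integrable_lin:
  assumes "square_integrable M U" "square_integrable M V"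
  shows "square_integrable M (\<lambda>\<omega>. a * U \<omega> + b * V \<omega>)"
proof -
  have "(a * U \<omega> + b * V \<omega>)\<^sup>2 = a\<^sup>2 * (U \<omega>)\<^sup>2 + 2 * a * b * (U \<omega> * V \<omega>) + b\<^sup>2 * (V \<omega>)\<^sup>2" for \<omega>
    by (simp add: power2_eq_square algebra_simps)
  then show ?thesis
    using assms square_integrable_mult[OF assms] by (simp add: square_integrable_def)
qed

lemma square_integrable_sum:
  assumes "\<And>k. k \<in> A \<Longrightarrow> square_integrable M (U k)"
  shows "square_integrable M (\<lambda>\<omega>. \<Sum>k\<in>A. a k * U k \<omega>)"
  using assms
proof (induction A rule: infinite_finite_induct)
  case (insert k A)
  then show ?case
    using square_integrable_lin[of M "U k" "\<lambda>\<omega>. \<Sum>k\<in>A. a k * U k \<omega>" "a k" 1] by simp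
qed (auto simp: square_integrable_def)

context prob_space
begin

lemma cov_eq:
  assumes U: "square_integrable M U" and V: "square_integrable M V"
  shows "cov M U V = expectation (\<lambda>\<omega>. U \<omega> * V \<omega>) - expectation U * expectation V"
proof -
  have "cov M U V = expectation (\<lambda>\<omega>. U \<omega> * V \<omega> - expectation V * U \<omega> - expectation U * V \<omega> + expectation U * expectation V)"
    unfolding cov_def by (rule Bochner_Integration.integral_cong) (auto simp: algebra_simps)
  then show ?thesis
    using U V square_integrable_mult[OF U V] by (simp add: square_integrable_def prob_space)
qed

lemma cov_lin_left:
  assumes "square_integrable M U" "square_integrable M V" "square_integrable M W"
  shows "cov M (\<lambda>\<omega>. a * U \<omega> + b * V \<omega>) W = a * cov M U W + b * cov M V W"
proof -
  have "(a * U \<omega> + b * V \<omega>) * W \<omega> = a * (U \<omega> * W \<omega>) + b * (V \<omega> * W \<omega>)" for \<omega>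
    by (simp add: algebra_simps)
  then show ?thesis
    using assms square_integrable_mult[OF assms(1,3)] square_integrable_mult[OF assms(2,3)]
    by (simp add: cov_eq square_integrable_lin) (simp add: square_integrable_def algebra_simps)
qed

lemma cov_commute: "cov M U V = cov M V U"
  unfolding cov_def by (rule Bochner_Integration.integral_cong) (auto simp: mult.commute)

lemma cov_sum_left:
  assumes "\<And>k. k \<in> A \<Longrightarrow> square_integrable M (U k)" "square_integrable M W"
  shows "cov M (\<lambda>\<omega>. \<Sum>k\<in>A. a k * U k \<omega>) W = (\<Sum>k\<in>A. a k * cov M (U k) W)"
  using assms
proof (induction A rule: infinite_finite_induct)
  case (insert k A)
  then show ?case
    using cov_lin_left[of "U k" "\<lambda>\<omega>. \<Sum>k\<in>A. a k * U k \<omega>" W "a k" 1] square_integrable_sum[of A M U a]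
    by simp
qed (auto simp: cov_def)

lemma square_integrable_fdiff:
  assumes "\<And>x. square_integrable M (U x)"
  shows "square_integrable M (\<lambda>\<omega>. (fdiff h ^^ m) (\<lambda>x. U x \<omega>) x)"
proof (induction m arbitrary: x)
  case (Suc m)
  then show ?case
    using square_integrable_lin[OF Suc[of "x + h"] Suc[of x], where a = 1 and b = "-1"] by (simp only: fdiff_funpow_Suc) simp
qed (simp add: assms)

text \<open>The covariance depends on \<open>x - y\<close>, so a forward difference in
  \<open>y\<close> is minus a forward difference of \<open>g\<close> taken one step to the left.
  This produces the sign and the shift by \<open>n * h\<close>.\<close>

lemma cov_fdiff:
  assumes U: "\<And>x. square_integrable M (U x)" and V: "\<And>x. square_integrable M (V x)"
    and g: "\<And>x y. cov M (U x) (V y) = g (x - y)"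
  shows "cov M (\<lambda>\<omega>. (fdiff h ^^ m) (\<lambda>x. U x \<omega>) x) (\<lambda>\<omega>. (fdiff h ^^ n) (\<lambda>x. V x \<omega>) y)
    = (-1) ^ n * (fdiff h ^^ (m + n)) g (x - y - real n * h)"
proof -
  note UV = square_integrable_fdiff[OF U] square_integrable_fdiff[OF V]
  have 0: "cov M (\<lambda>\<omega>. (fdiff h ^^ m) (\<lambda>x. U x \<omega>) x) (V y) = (fdiff h ^^ m) g (x - y)" for m x y
  proof (induction m arbitrary: x)
    case (Suc m)
    have "cov M (\<lambda>\<omega>. (fdiff h ^^ Suc m) (\<lambda>x. U x \<omega>) x) (V y) =
        cov M (\<lambda>\<omega>. (fdiff h ^^ m) (\<lambda>x. U x \<omega>) (x + h)) (V y) - cov M (\<lambda>\<omega>. (fdiff h ^^ m) (\<lambda>x. U x \<omega>) x) (V y)"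
      using cov_lin_left[OF UV(1)[where m = m and h = h and x = "x + h"] UV(1)[where m = m and h = h and x = x] V[of y], where a = 1 and b = "-1"] by (simp only: fdiff_funpow_Suc) simp
    then show ?case
      unfolding Suc fdiff_funpow_Suc by (simp add: algebra_simps)
  qed (simp add: g)
  show ?thesis
  proof (induction n arbitrary: y)
    case (Suc n)
    let ?A = "\<lambda>\<omega>. (fdiff h ^^ m) (\<lambda>x. U x \<omega>) x"
    have "cov M ?A (\<lambda>\<omega>. (fdiff h ^^ Suc n) (\<lambda>x. V x \<omega>) y) =
        cov M ?A (\<lambda>\<omega>. (fdiff h ^^ n) (\<lambda>x. V x \<omega>) (y + h)) - cov M ?A (\<lambda>\<omega>. (fdiff h ^^ n) (\<lambda>x. V x \<omega>) y)"
      using cov_lin_left[OF UV(2)[where m = n and h = h and x = "y + h"] UV(2)[where m = n and h = h and x = y]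
          UV(1)[where m = m and h = h and x = x], where a = 1 and b = "-1"]
      by (simp only: fdiff_funpow_Suc cov_commute[of ?A]) simp
    also have "\<dots> = (-1) ^ n * ((fdiff h ^^ (m + n)) g (x - y - real (Suc n) * h)
         - (fdiff h ^^ (m + n)) g (x - y - real (Suc n) * h + h))"
      unfolding Suc by (simp add: algebra_simps)
    also have "\<dots> = (-1) ^ Suc n * (fdiff h ^^ (m + Suc n)) g (x - y - real (Suc n) * h)"
      by (simp only: add_Suc_right fdiff_funpow_Suc) (simp add: algebra_simps)
    finally show ?case .
  qed (simp add: 0)
qed

end

definition field_span :: "('k \<Rightarrow> 's \<Rightarrow> 'w \<Rightarrow> real) \<Rightarrow> ('w \<Rightarrow> real) set" where
  "field_span X = {U. \<exists>T a. finite T \<and> U = (\<lambda>\<omega>. \<Sum>(k, s)\<in>T. a k s * X k s \<omega>)}"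

lemma field_span_lin:
  assumes "U \<in> field_span X" "V \<in> field_span X"
  shows "(\<lambda>\<omega>. a * U \<omega> + b * V \<omega>) \<in> field_span X"
proof -
  obtain S c where S: "finite S" "U = (\<lambda>\<omega>. \<Sum>(k, s)\<in>S. c k s * X k s \<omega>)"
    using assms(1) by (auto simp: field_span_def)
  obtain T d where T: "finite T" "V = (\<lambda>\<omega>. \<Sum>(k, s)\<in>T. d k s * X k s \<omega>)"
    using assms(2) by (auto simp: field_span_def)
  define e where "e k s = a * (if (k, s) \<in> S then c k s else 0) + b * (if (k, s) \<in> T then d k s else 0)" for k s
  have "a * U \<omega> + b * V \<omega> = (\<Sum>(k, s)\<in>S \<union> T. e k s * X k s \<omega>)" for \<omega>
  proof -
    have "(\<Sum>(k, s)\<in>S. c k s * X k s \<omega>) = (\<Sum>(k, s)\<in>S \<union> T. (if (k, s) \<in> S then c k s else 0) * X k s \<omega>)"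
      using S(1) T(1) by (intro sum.mono_neutral_cong_left) auto
    moreover have "(\<Sum>(k, s)\<in>T. d k s * X k s \<omega>) = (\<Sum>(k, s)\<in>S \<union> T. (if (k, s) \<in> T then d k s else 0) * X k s \<omega>)"
      using S(1) T(1) by (intro sum.mono_neutral_cong_left) auto
    ultimately show ?thesis
      unfolding S(2) T(2) e_def
      by (simp add: sum_distrib_left sum.distrib[symmetric] case_prod_unfold algebra_simps)
  qed
  then show ?thesis
    using S(1) T(1) by (auto simp: field_span_def intro!: exI[of _ "S \<union> T"] exI[of _ e])
qed

lemma field_span_base: "X k s \<in> field_span X"
  unfolding field_span_def
  by (rule CollectI, rule exI[of _ "{(k, s)}"], rule exI[of _ "\<lambda>_ _. 1"]) simp

lemma field_span_sum:
  assumes "finite A" "\<And>k. k \<in> A \<Longrightarrow> U k \<in> field_span X"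
  shows "(\<lambda>\<omega>. \<Sum>k\<in>A. a k * U k \<omega>) \<in> field_span X"
  using assms
proof (induction A rule: finite_induct)
  case empty
  show ?case
    unfolding field_span_def by (rule CollectI, rule exI[of _ "{}"]) simp
next
  case (insert k A)
  then show ?case
    using field_span_lin[of "U k" X "\<lambda>\<omega>. \<Sum>k\<in>A. a k * U k \<omega>" "a k" 1] by simp
qed

lemma field_span_fdiff:
  assumes "\<And>x. U x \<in> field_span X"
  shows "(\<lambda>\<omega>. (fdiff h ^^ m) (\<lambda>x. U x \<omega>) x) \<in> field_span X"
proof (induction m arbitrary: x)
  case (Suc m)
  then show ?case
    using field_span_lin[OF Suc[of "x + h"] Suc[of x], where a = 1 and b = "-1"] by (simp only: fdiff_funpow_Suc) simp
qed (simp add: assms)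

context prob_space
begin

lemma field_span_gaussian:
  assumes "gaussian_field M X" "U \<in> field_span X"
  shows "gaussian_rv M U"
  using assms by (auto simp: gaussian_field_def field_span_def)

lemma gaussian_space_centred_field_span:
  assumes X: "gaussian_field M X"
  shows "gaussian_space M {U \<in> field_span X. expectation U = 0}"
proof
  fix U V a b assume U: "U \<in> {U \<in> field_span X. expectation U = 0}" and V: "V \<in> {U \<in> field_span X. expectation U = 0}"
  have g: "gaussian_rv M U" "gaussian_rv M V"
    using U V field_span_gaussian[OF X] by auto
  show "(\<lambda>\<omega>. a * U \<omega> + b * V \<omega>) \<in> {U \<in> field_span X. expectation U = 0}"
    using U V field_span_lin[of U X V a b] gaussian_rv_moments(1)[OF g(1)] gaussian_rv_moments(1)[OF g(2)] by simp
next
  fix U assume U: "U \<in> {U \<in> field_span X. expectation U = 0}"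
  then have g: "gaussian_rv M U" "expectation U = 0"
    using field_span_gaussian[OF X] by auto
  show "U \<in> borel_measurable M" using g by (simp add: gaussian_rv_def)
  show "integrable M (\<lambda>\<omega>. U \<omega> ^ 4)" "expectation (\<lambda>\<omega>. U \<omega> ^ 4) = 3 * (expectation (\<lambda>\<omega>. (U \<omega>)\<^sup>2))\<^sup>2"
    using gaussian_rv_moments[OF g(1)] g(2) by auto
qed

text \<open>One difference already annihilates the constant mean, which need not be 0; this places
  the contrasts in the space of centred variables.\<close>

lemma expectation_fdiff:
  assumes "\<And>x. integrable M (U x)" "\<And>x. expectation (U x) = c" "m > 0"
  shows "expectation (\<lambda>\<omega>. (fdiff h ^^ m) (\<lambda>x. U x \<omega>) x) = 0"
proof -
  have "integrable M (\<lambda>\<omega>. (fdiff h ^^ m) (\<lambda>x. U x \<omega>) x) \<and>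
      expectation (\<lambda>\<omega>. (fdiff h ^^ m) (\<lambda>x. U x \<omega>) x) = (if m = 0 then c else 0)" for m x
  proof (induction m arbitrary: x)
    case (Suc m)
    then show ?case unfolding fdiff_funpow_Suc by simp
  qed (simp add: assms)
  then show ?thesis using assms(3) by simp
qed

end


section \<open>Contrasts of a stationary Gaussian field\<close>

text \<open>Regressors, error and response are all of this form, so that covariances need to be
  treated only once, as bilinear forms.\<close>

definition vfield :: "('k::finite \<Rightarrow> 's \<Rightarrow> 'w \<Rightarrow> real) \<Rightarrow> real ^ 'k \<Rightarrow> 's \<Rightarrow> 'w \<Rightarrow> real" where
  "vfield X v s \<omega> = (\<Sum>k\<in>UNIV. v $ k * X k s \<omega>)"

lemma vfield_lin: "vfield X (a *\<^sub>R v + b *\<^sub>R w) s \<omega> = a * vfield X v s \<omega> + b * vfield X w s \<omega>"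
  by (simp add: vfield_def sum.distrib sum_distrib_left algebra_simps)

locale stationary_gaussian = prob_space M for M :: "'w measure" +
  fixes X :: "'k::finite \<Rightarrow> real ^ 'd \<Rightarrow> 'w \<Rightarrow> real" and K :: "real ^ 'd \<Rightarrow> real ^ 'k ^ 'k" and e :: "real ^ 'd"
  assumes gaussian: "gaussian_field M X"
    and stationary: "stationary_with_cov M X K"
    and K_sym: "K u $ k $ l = K u $ l $ k"
begin

definition vcov :: "real ^ 'k \<Rightarrow> real ^ 'k \<Rightarrow> real ^ 'd \<Rightarrow> real" where
  "vcov v w u = (\<Sum>k\<in>UNIV. \<Sum>l\<in>UNIV. v $ k * (w $ l * K u $ k $ l))"

definition line_cov :: "real ^ 'k \<Rightarrow> real ^ 'k \<Rightarrow> real \<Rightarrow> real" where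
  "line_cov v w t = vcov v w (t *\<^sub>R e)"

definition contrast :: "nat \<Rightarrow> real \<Rightarrow> real ^ 'k \<Rightarrow> nat \<Rightarrow> 'w \<Rightarrow> real" where
  "contrast m h v i \<omega> = (fdiff h ^^ m) (\<lambda>x. vfield X v (x *\<^sub>R e) \<omega>) (real i * h)"

text \<open>The covariance of two contrasts at lag \<open>k\<close>, as given by
  \<open>cov_fdiff\<close> with both orders equal to \<open>m\<close>: a central difference around
  the distance \<open>k * h\<close>.\<close>

definition contrast_cov :: "nat \<Rightarrow> real \<Rightarrow> real ^ 'k \<Rightarrow> real ^ 'k \<Rightarrow> nat \<Rightarrow> real" where
  "contrast_cov m h v w k = (-1) ^ m * (fdiff h ^^ (2 * m)) (line_cov v w) ((real k - real m) * h)"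

abbreviation Hspace :: "('w \<Rightarrow> real) set" where
  "Hspace \<equiv> {U \<in> field_span X. expectation U = 0}"

lemma gaussian_space: "gaussian_space M Hspace"
  by (rule gaussian_space_centred_field_span[OF gaussian])

lemma square_integrable_X: "square_integrable M (X k s)"
  using gaussian_rv_moments(1,2)[OF field_span_gaussian[OF gaussian field_span_base]]
  by (simp add: square_integrable_def)

lemma square_integrable_vfield: "square_integrable M (vfield X v s)"
  unfolding vfield_def[abs_def] by (intro square_integrable_sum square_integrable_X)

lemma cov_vfield: "cov M (vfield X v s) (vfield X w t) = vcov v w (s - t)"
proof -
  have X: "cov M (X k s) (X l t) = K (s - t) $ k $ l" for k l
  proof -
    have "cov M (X k (t + (s - t))) (X l t) = K (s - t) $ k $ l"
      using stationary unfolding stationary_with_cov_def by blast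
    then show ?thesis by simp
  qed
  have vf: "vfield X v s = (\<lambda>\<omega>. \<Sum>k\<in>UNIV. v $ k * X k s \<omega>)" for v s
    by (simp add: vfield_def fun_eq_iff)
  have "cov M (vfield X v s) (vfield X w t) = (\<Sum>k\<in>UNIV. v $ k * cov M (X k s) (vfield X w t))"
    unfolding vf[of v s]
    by (intro cov_sum_left square_integrable_X square_integrable_vfield)
  also have "\<dots> = (\<Sum>k\<in>UNIV. v $ k * (\<Sum>l\<in>UNIV. w $ l * K (s - t) $ k $ l))"
  proof (intro sum.cong refl)
    fix k
    have "cov M (vfield X w t) (X k s) = (\<Sum>l\<in>UNIV. w $ l * cov M (X l t) (X k s))"
      unfolding vf[of w t] by (intro cov_sum_left square_integrable_X)
    then show "v $ k * cov M (X k s) (vfield X w t) = v $ k * (\<Sum>l\<in>UNIV. w $ l * K (s - t) $ k $ l)"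
      by (simp add: cov_commute[of "X k s"] X[symmetric])
  qed
  finally show ?thesis by (simp add: vcov_def sum_distrib_left)
qed

lemma vcov_sym: "vcov v w u = vcov w v u"
proof -
  have "vcov v w u = (\<Sum>l\<in>UNIV. \<Sum>k\<in>UNIV. v $ k * (w $ l * K u $ k $ l))"
    unfolding vcov_def by (rule sum.swap)
  then show ?thesis
    unfolding vcov_def using K_sym[of u] by (simp add: mult.left_commute)
qed

text \<open>Stationarity alone exchanges \<open>v\<close> and \<open>w\<close> under reflection; the
  symmetry of the cross-covariances exchanges them back.\<close>

lemma vcov_even: "vcov v w (- u) = vcov v w u"
  using cov_vfield[of v 0 w u] cov_vfield[of w u v 0] vcov_sym[of v w u]
  by (simp add: cov_commute)

lemma vcov_lin: "vcov (a *\<^sub>R v + b *\<^sub>R v') w u = a * vcov v w u + b * vcov v' w u"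
  by (simp add: vcov_def sum.distrib sum_distrib_left algebra_simps)

lemma contrast_cov_sym: "contrast_cov m h v w k = contrast_cov m h w v k"
  unfolding contrast_cov_def line_cov_def vcov_sym[of v w] ..

lemma contrast_cov_lin:
  "contrast_cov m h (a *\<^sub>R v + b *\<^sub>R v') w k = a * contrast_cov m h v w k + b * contrast_cov m h v' w k"
  unfolding contrast_cov_def line_cov_def[abs_def] vcov_lin fdiff_funpow_lin
  by (simp add: algebra_simps)

lemma contrast_lin: "contrast m h (a *\<^sub>R v + b *\<^sub>R w) i \<omega> = a * contrast m h v i \<omega> + b * contrast m h w i \<omega>"
  unfolding contrast_def vfield_lin by (rule fdiff_funpow_lin)

lemma expectation_vfield: "expectation (vfield X v s) = expectation (vfield X v t)"
proof -
  have int: "integrable M (X k s)" for k s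
    using square_integrable_X[of k s] by (simp add: square_integrable_def)
  have "expectation (vfield X v s) = (\<Sum>k\<in>UNIV. v $ k * expectation (X k s))" for s
    unfolding vfield_def[abs_def] using int by simp
  moreover have "expectation (X k s) = expectation (X k t)" for k
    using stationary unfolding stationary_with_cov_def by blast
  ultimately show ?thesis by simp
qed

lemma contrast_in_Hspace:
  assumes "m > 0"
  shows "contrast m h v i \<in> Hspace"
proof -
  have "contrast m h v i \<in> field_span X"
    unfolding contrast_def[abs_def] vfield_def
    by (rule field_span_fdiff, rule field_span_sum) (auto simp: field_span_base)
  moreover have "expectation (contrast m h v i) = 0"
    unfolding contrast_def[abs_def]
    using square_integrable_vfield assms
    by (intro expectation_fdiff[of _ "expectation (vfield X v 0)"])
      (auto simp: square_integrable_def intro: expectation_vfield)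
  ultimately show ?thesis by simp
qed

text \<open>With truncated subtraction \<open>(i - j) + (j - i)\<close> is the distance of
  \<open>i\<close> and \<open>j\<close>.\<close>

lemma expectation_contrast_prod:
  assumes m: "m > 0"
  shows "expectation (\<lambda>\<omega>. contrast m h v i \<omega> * contrast m h w j \<omega>) = contrast_cov m h v w ((i - j) + (j - i))"
proof -
  have le: "expectation (\<lambda>\<omega>. contrast m h v i \<omega> * contrast m h w j \<omega>) = contrast_cov m h v w (i - j)"
    if "j \<le> i" for v w i j
  proof -
    have E0: "expectation (contrast m h v i) = 0" for v i
      using contrast_in_Hspace[OF m] by blast
    have "expectation (\<lambda>\<omega>. contrast m h v i \<omega> * contrast m h w j \<omega>) = cov M (contrast m h v i) (contrast m h w j)"
      unfolding cov_def E0 by simp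
    also have "\<dots> = (-1) ^ m * (fdiff h ^^ (m + m)) (line_cov v w) (real i * h - real j * h - real m * h)"
      unfolding contrast_def[abs_def]
    proof (rule cov_fdiff)
      show "cov M (vfield X v (x *\<^sub>R e)) (vfield X w (y *\<^sub>R e)) = line_cov v w (x - y)" for x y
        by (simp add: cov_vfield line_cov_def scaleR_diff_left)
    qed (rule square_integrable_vfield)+
    also have "real i * h - real j * h - real m * h = (real (i - j) - real m) * h"
      using that by (simp add: of_nat_diff algebra_simps)
    finally show ?thesis by (simp add: contrast_cov_def mult_2)
  qed
  show ?thesis
  proof (cases "j \<le> i")
    case True
    then show ?thesis using le[OF True] by simp
  next
    case False
    then have "i \<le> j" by simp
    from le[OF this, of w v] show ?thesis
      using \<open>i \<le> j\<close> by (simp add: mult.commute contrast_cov_sym[of m h v w])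
  qed
qed

lemma contrast_cov_nonneg:
  assumes "m > 0"
  shows "contrast_cov m h v v 0 \<ge> 0"
proof -
  have "0 \<le> expectation (\<lambda>\<omega>. contrast m h v 0 \<omega> * contrast m h v 0 \<omega>)"
    by (rule Bochner_Integration.integral_nonneg) simp
  then show ?thesis
    unfolding expectation_contrast_prod[OF assms] by simp
qed

lemma contrast_cov_limit:
  assumes "local_power c \<alpha> (line_cov v w)" "\<alpha> < 2 * real m"
  shows "((\<lambda>h. contrast_cov m h v w 0 / h powr \<alpha>) \<longlongrightarrow> (-1) ^ m * (c * power_const m \<alpha>)) (at_right 0)"
proof -
  have "((\<lambda>h. (-1) ^ m * ((fdiff h ^^ (2 * m)) (line_cov v w) (- real m * h) / h powr \<alpha>))
      \<longlongrightarrow> (-1) ^ m * (c * power_const m \<alpha>)) (at_right 0)"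
    by (intro tendsto_intros local_power_limit assms)
  then show ?thesis by (simp add: contrast_cov_def)
qed

text \<open>Stated for all small \<epsilon>, so that finitely many such bounds can be imposed on one
  segment.\<close>

lemma contrast_cov_decay:
  assumes "local_power c \<alpha> (line_cov v w)" "0 < a" "a \<le> \<alpha>" "a + 2 \<le> 2 * real m"
  shows "\<forall>\<^sub>F \<epsilon> in at_right 0. \<exists>C\<ge>0. \<forall>h k. h > 0 \<longrightarrow> (real k + real m) * h \<le> \<epsilon> \<longrightarrow>
    \<bar>contrast_cov m h v w k\<bar> \<le> C * h powr a / (1 + real k)\<^sup>2"
proof -
  obtain \<delta> C where \<delta>: "\<delta> > 0" and C: "\<And>h k. h > 0 \<Longrightarrow> (real k + real m) * h \<le> \<delta> \<Longrightarrow>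
       \<bar>(fdiff h ^^ (2 * m)) (line_cov v w) ((real k - real m) * h)\<bar> \<le> C * h powr a / (1 + real k)\<^sup>2"
    using local_power_decay[OF assms] by blast
  have "\<bar>contrast_cov m h v w k\<bar> \<le> \<bar>C\<bar> * h powr a / (1 + real k)\<^sup>2"
    if "h > 0" "(real k + real m) * h \<le> \<delta>" for h k
  proof -
    have "\<bar>contrast_cov m h v w k\<bar> \<le> C * h powr a / (1 + real k)\<^sup>2"
      using C[OF that] by (simp add: contrast_cov_def abs_mult)
    also have "\<dots> \<le> \<bar>C\<bar> * h powr a / (1 + real k)\<^sup>2"
      by (intro divide_right_mono mult_right_mono) auto
    finally show ?thesis .
  qed
  then show ?thesis
    by (intro eventually_at_rightI[OF _ \<delta>] exI[of _ "\<bar>C\<bar>"]) auto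
qed

end

text \<open>The \<open>n + 1\<close> contrasts of order \<open>m\<close> use grid points with
  indices up to \<open>n + m\<close>, so all points and all arguments of the covariance stay within
  distance \<epsilon> of the origin.\<close>

definition mesh :: "real \<Rightarrow> nat \<Rightarrow> nat \<Rightarrow> real" where
  "mesh \<epsilon> m n = \<epsilon> / real (n + 1 + m)"

lemma mesh_pos: "\<epsilon> > 0 \<Longrightarrow> mesh \<epsilon> m n > 0"
  by (simp add: mesh_def)

lemma mesh_le:
  assumes "\<epsilon> > 0" "k \<le> n"
  shows "(real k + real m) * mesh \<epsilon> m n \<le> \<epsilon>"
proof -
  have "(real k + real m) * \<epsilon> \<le> \<epsilon> * real (n + 1 + m)"
    using assms by (subst mult.commute) (intro mult_left_mono, auto)
  then show ?thesis by (simp add: mesh_def pos_divide_le_eq)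
qed

lemma mesh_tendsto:
  assumes "\<epsilon> > 0"
  shows "filterlim (mesh \<epsilon> m) (at_right 0) sequentially"
proof -
  have "(\<lambda>n. \<epsilon> * inverse (real (Suc (n + m)))) \<longlonglongrightarrow> \<epsilon> * 0"
    by (intro tendsto_intros LIMSEQ_ignore_initial_segment[OF LIMSEQ_inverse_real_of_nat])
  then have "mesh \<epsilon> m \<longlonglongrightarrow> 0"
    by (simp add: mesh_def[abs_def] divide_inverse add_ac)
  then show ?thesis
    using mesh_pos[OF assms]
    by (auto simp: filterlim_at less_imp_neq[THEN not_sym] intro!: always_eventually)
qed

lemma mesh_powr_tendsto:
  assumes "\<epsilon> > 0" "b > 0"
  shows "(\<lambda>n. mesh \<epsilon> m n powr b) \<longlonglongrightarrow> 0"
proof -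
  have "((\<lambda>h. h powr b) \<longlongrightarrow> 0) (at_right (0::real))"
    using assms(2) by (auto intro!: tendsto_eq_intros eventually_at_rightI[of 0 1])
  from filterlim_compose[OF this mesh_tendsto[OF assms(1)]] show ?thesis .
qed

text \<open>Averaging over \<open>n + 1\<close> contrasts is worth one power of the mesh; this is
  where the gain of 1 in the exponent arises.\<close>

lemma inverse_Suc_le_mesh:
  assumes "\<epsilon> > 0"
  shows "1 / real (Suc n) \<le> (real m + 1) / \<epsilon> * mesh \<epsilon> m n"
proof -
  have "real (n + 1 + m) \<le> (real m + 1) * real (Suc n)"
    by (simp add: algebra_simps)
  then have "1 / real (Suc n) \<le> (real m + 1) / real (n + 1 + m)"
    by (simp add: field_simps del: of_nat_Suc of_nat_add)
  then show ?thesis using assms by (simp add: mesh_def)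
qed

context stationary_gaussian
begin

text \<open>On the scale \<open>h powr a\<close> the bias has order \<open>d - a\<close>. Of the
  relative variance, the averaged part has order \<open>b + 1 - a\<close> and the squared
  cross-covariance has order \<open>2 * (d - a)\<close>. The assumptions make all of them
  positive.\<close>

lemma regression_error_tendsto_0:
  fixes u v :: "real ^ 'k" and \<epsilon> :: real and m :: nat
  defines "h \<equiv> mesh \<epsilon> m"
  assumes m: "m > 0" and \<epsilon>: "\<epsilon> > 0" and \<delta>: "\<delta> > 0"
    and lim: "((\<lambda>h. contrast_cov m h u u 0 / h powr a) \<longlongrightarrow> C) (at_right 0)" "C > 0"
    and uu: "\<And>n k. k \<le> n \<Longrightarrow> \<bar>contrast_cov m (h n) u u k\<bar> \<le> C1 * h n powr a / (1 + real k)\<^sup>2"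
    and vv: "\<And>n k. k \<le> n \<Longrightarrow> \<bar>contrast_cov m (h n) v v k\<bar> \<le> C2 * h n powr b / (1 + real k)\<^sup>2"
    and uv: "\<And>n k. k \<le> n \<Longrightarrow> \<bar>contrast_cov m (h n) u v k\<bar> \<le> C3 * h n powr d / (1 + real k)\<^sup>2"
    and C: "C1 \<ge> 0" "C2 \<ge> 0" "C3 \<ge> 0" and ab: "a < b + 1" "a < d"
  shows "(\<lambda>n. prob {\<omega> \<in> space M. \<delta> * sample_mean_prod (contrast m (h n) u) (contrast m (h n) u) (Suc n) \<omega>
      \<le> \<bar>sample_mean_prod (contrast m (h n) u) (contrast m (h n) v) (Suc n) \<omega>\<bar>}) \<longlonglongrightarrow> 0"
proof -
  interpret gaussian_space M Hspace by (rule gaussian_space)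
  have h: "h n > 0" for n unfolding h_def by (rule mesh_pos[OF \<epsilon>])
  define s where "s n = h n powr a" for n
  have s: "s n > 0" for n using h[of n] by (simp add: s_def)
  have lag: "real ((i - j) + (j - i)) = \<bar>real i - real j\<bar>" "(i - j) + (j - i) \<le> n" if "i \<le> n" "j \<le> n" for i j n :: nat
    using that by auto
  \<comment> \<open>In each product of covariances the decay of one factor is enough, and the
    squared cross-covariance needs none.\<close>
  have drop: "x \<le> c" if "x \<le> c / (1 + real k)\<^sup>2" "c \<ge> 0" for x c :: real and k :: nat
  proof -
    have "c / (1 + real k)\<^sup>2 \<le> c / 1"
      using that(2) by (intro divide_left_mono) (auto intro!: one_le_power add_pos_nonneg)
    then show ?thesis using that by simp
  qed
  show ?thesis
  proof (rule regression_tendsto_0[where U = "\<lambda>n. contrast m (h n) u" and V = "\<lambda>n. contrast m (h n) v" and s = s and d = C1 and C = C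
        and \<mu> = "\<lambda>n. contrast_cov m (h n) u v 0" and \<nu> = "\<lambda>n. contrast_cov m (h n) u u 0"
        and a = "\<lambda>n. C1 * s n * (C2 * h n powr b)" and b = "\<lambda>n. (C3 * h n powr d)\<^sup>2"])
    show "contrast m (h n) u i \<in> Hspace" "contrast m (h n) v i \<in> Hspace" for n i
      by (rule contrast_in_Hspace[OF m])+
    show "expectation (\<lambda>\<omega>. contrast m (h n) u i \<omega> * contrast m (h n) v i \<omega>) = contrast_cov m (h n) u v 0"
      "expectation (\<lambda>\<omega>. contrast m (h n) u i \<omega> * contrast m (h n) u i \<omega>) = contrast_cov m (h n) u u 0" for n i
      by (simp_all add: expectation_contrast_prod[OF m])
    have "(\<lambda>n. C3 * h n powr (d - a)) \<longlonglongrightarrow> C3 * 0"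
      unfolding h_def using ab \<epsilon> by (intro tendsto_intros mesh_powr_tendsto) auto
    then have "(\<lambda>n. C3 * h n powr (d - a)) \<longlonglongrightarrow> 0" by simp
    then show "(\<lambda>n. contrast_cov m (h n) u v 0 / s n) \<longlonglongrightarrow> 0"
    proof (rule Lim_null_comparison[rotated], intro always_eventually allI)
      fix n
      have "\<bar>contrast_cov m (h n) u v 0\<bar> / s n \<le> C3 * h n powr d / s n"
        using uv[of 0 n] s[of n] by (intro divide_right_mono) auto
      then show "norm (contrast_cov m (h n) u v 0 / s n) \<le> C3 * h n powr (d - a)"
        using s[of n] by (simp add: s_def powr_diff)
    qed
    show "(\<lambda>n. contrast_cov m (h n) u u 0 / s n) \<longlonglongrightarrow> C"
      unfolding s_def h_def using filterlim_compose[OF lim(1) mesh_tendsto[OF \<epsilon>]] .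
    fix n i j :: nat assume ij: "i \<le> n" "j \<le> n"
    define k where "k = (i - j) + (j - i)"
    have k: "k \<le> n" "\<bar>real i - real j\<bar> = real k" using lag[OF ij] by (auto simp: k_def)
    have k': "(j - i) + (i - j) = k" by (simp add: k_def)
    show "\<bar>expectation (\<lambda>\<omega>. contrast m (h n) u i \<omega> * contrast m (h n) u j \<omega>)\<bar>
        \<le> C1 * s n / (1 + \<bar>real i - real j\<bar>)\<^sup>2"
      unfolding k(2) expectation_contrast_prod[OF m] k_def[symmetric] s_def using uu k by blast
    have "contrast_cov m (h n) u u k * contrast_cov m (h n) v v k
        \<le> \<bar>contrast_cov m (h n) u u k\<bar> * \<bar>contrast_cov m (h n) v v k\<bar>"
      by (metis abs_ge_self abs_mult)
    also have "\<dots> \<le> (C1 * s n / (1 + real k)\<^sup>2) * (C2 * h n powr b)"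
      using uu[OF k(1)] drop[OF vv[OF k(1)]] C s[of n] by (intro mult_mono) (auto simp: s_def)
    finally have 1: "contrast_cov m (h n) u u k * contrast_cov m (h n) v v k
        \<le> C1 * s n * (C2 * h n powr b) / (1 + real k)\<^sup>2" by simp
    have "contrast_cov m (h n) u v k * contrast_cov m (h n) v u k = \<bar>contrast_cov m (h n) u v k\<bar>\<^sup>2"
      by (simp add: contrast_cov_sym[of m "h n" v u] power2_eq_square)
    also have "\<dots> \<le> (C3 * h n powr d)\<^sup>2"
      using drop[OF uv[OF k(1)]] C by (intro power_mono) auto
    finally have 2: "contrast_cov m (h n) u v k * contrast_cov m (h n) v u k \<le> (C3 * h n powr d)\<^sup>2" .
    show "expectation (\<lambda>\<omega>. contrast m (h n) u i \<omega> * contrast m (h n) u j \<omega>) * expectation (\<lambda>\<omega>. contrast m (h n) v i \<omega> * contrast m (h n) v j \<omega>)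
      + expectation (\<lambda>\<omega>. contrast m (h n) u i \<omega> * contrast m (h n) v j \<omega>) * expectation (\<lambda>\<omega>. contrast m (h n) v i \<omega> * contrast m (h n) u j \<omega>)
      \<le> C1 * s n * (C2 * h n powr b) / (1 + \<bar>real i - real j\<bar>)\<^sup>2 + (C3 * h n powr d)\<^sup>2"
      unfolding k(2) expectation_contrast_prod[OF m] k_def[symmetric] k' using 1 2 by linarith
  next
    show "0 \<le> C1 * s n * (C2 * h n powr b)" for n
      using C s[of n] by simp
    have "(\<lambda>n. C1 * C2 * ((real m + 1) / \<epsilon>) * h n powr (b + 1 - a)) \<longlonglongrightarrow> C1 * C2 * ((real m + 1) / \<epsilon>) * 0"
      unfolding h_def using ab \<epsilon> by (intro tendsto_intros mesh_powr_tendsto) auto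
    then have lim0: "(\<lambda>n. C1 * C2 * ((real m + 1) / \<epsilon>) * h n powr (b + 1 - a)) \<longlonglongrightarrow> 0" by simp
    show "(\<lambda>n. C1 * s n * (C2 * h n powr b) / real (Suc n) / (s n)\<^sup>2) \<longlonglongrightarrow> 0"
    proof (rule tendsto_0_le[OF lim0])
      fix n
      show "0 \<le> C1 * s n * (C2 * h n powr b) / real (Suc n) / (s n)\<^sup>2"
        using C s[of n] by simp
      have "C1 * s n * (C2 * h n powr b) / real (Suc n) / (s n)\<^sup>2 = C1 * C2 * (h n powr b / s n) * (1 / real (Suc n))"
        using s[of n] by (simp add: power2_eq_square mult_ac)
      also have "\<dots> \<le> C1 * C2 * (h n powr b / s n) * ((real m + 1) / \<epsilon> * h n)"
      proof (rule mult_left_mono)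
        show "1 / real (Suc n) \<le> (real m + 1) / \<epsilon> * h n"
          unfolding h_def by (rule inverse_Suc_le_mesh[OF \<epsilon>])
        show "0 \<le> C1 * C2 * (h n powr b / s n)"
          using C s[of n] by simp
      qed
      also have "\<dots> = C1 * C2 * ((real m + 1) / \<epsilon>) * (h n powr b * h n powr 1 / h n powr a)"
        using h[of n] by (simp add: s_def mult_ac)
      also have "h n powr b * h n powr 1 / h n powr a = h n powr (b + 1 - a)"
        by (subst powr_diff, subst powr_add) (rule refl)
      finally show "C1 * s n * (C2 * h n powr b) / real (Suc n) / (s n)\<^sup>2
          \<le> C1 * C2 * ((real m + 1) / \<epsilon>) * h n powr (b + 1 - a)" .
    qed
    have "(\<lambda>n. (C3 * h n powr (d - a))\<^sup>2) \<longlonglongrightarrow> (C3 * 0)\<^sup>2"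
      unfolding h_def using ab \<epsilon> by (intro tendsto_intros mesh_powr_tendsto) auto
    moreover have "(C3 * h n powr (d - a))\<^sup>2 = (C3 * h n powr d)\<^sup>2 / (s n)\<^sup>2" for n
      using s[of n] by (simp add: s_def powr_diff power_divide)
    ultimately show "(\<lambda>n. (C3 * h n powr d)\<^sup>2 / (s n)\<^sup>2) \<longlonglongrightarrow> 0" by simp
  qed (use lim(2) s \<delta> in simp_all)
qed

text \<open>The cross-covariance of \<open>u\<close> and \<open>v\<close> is only known to be
  negligible at lag 0. Its decay at the other lags comes from polarising the bounds for
  \<open>u\<close>, \<open>v\<close> and \<open>u + v\<close>, all at the rate of the rougher field
  \<open>u\<close>; averaging then makes the relative variance of order
  \<open>1 / n\<close>.\<close>

lemma regression_nuisance_tendsto_0: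
  fixes u v :: "real ^ 'k" and \<epsilon> :: real and m :: nat
  defines "h \<equiv> mesh \<epsilon> m"
  assumes m: "m > 0" and \<epsilon>: "\<epsilon> > 0" and \<delta>: "\<delta> > 0"
    and lim: "((\<lambda>h. contrast_cov m h u u 0 / h powr a) \<longlongrightarrow> C) (at_right 0)" "C > 0"
      "((\<lambda>h. contrast_cov m h u v 0 / h powr a) \<longlongrightarrow> 0) (at_right 0)"
    and uu: "\<And>n k. k \<le> n \<Longrightarrow> \<bar>contrast_cov m (h n) u u k\<bar> \<le> C1 * h n powr a / (1 + real k)\<^sup>2"
    and vv: "\<And>n k. k \<le> n \<Longrightarrow> \<bar>contrast_cov m (h n) v v k\<bar> \<le> C2 * h n powr a / (1 + real k)\<^sup>2"
    and uv: "\<And>n k. k \<le> n \<Longrightarrow> \<bar>contrast_cov m (h n) (u + v) (u + v) k\<bar> \<le> C3 * h n powr a / (1 + real k)\<^sup>2"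
    and C: "C1 \<ge> 0" "C2 \<ge> 0" "C3 \<ge> 0"
  shows "(\<lambda>n. prob {\<omega> \<in> space M. \<delta> * sample_mean_prod (contrast m (h n) u) (contrast m (h n) u) (Suc n) \<omega>
      \<le> \<bar>sample_mean_prod (contrast m (h n) u) (contrast m (h n) v) (Suc n) \<omega>\<bar>}) \<longlonglongrightarrow> 0"
proof -
  interpret gaussian_space M Hspace by (rule gaussian_space)
  have h: "h n > 0" for n unfolding h_def by (rule mesh_pos[OF \<epsilon>])
  define s where "s n = h n powr a" for n
  have s: "s n > 0" for n using h[of n] by (simp add: s_def)
  define D where "D = C1 + C2 + C3"
  have D: "D \<ge> 0" using C by (simp add: D_def)
  have lag: "real ((i - j) + (j - i)) = \<bar>real i - real j\<bar>" "(i - j) + (j - i) \<le> n" if "i \<le> n" "j \<le> n" for i j n :: nat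
    using that by auto
  have bd: "\<bar>contrast_cov m (h n) u u k\<bar> \<le> D * s n / (1 + real k)\<^sup>2"
    "\<bar>contrast_cov m (h n) v v k\<bar> \<le> D * s n / (1 + real k)\<^sup>2"
    "\<bar>contrast_cov m (h n) u v k\<bar> \<le> D * s n / (1 + real k)\<^sup>2" if k: "k \<le> n" for n k
  proof -
    define t where "t = s n / (1 + real k)\<^sup>2"
    have t: "t \<ge> 0" using s[of n] by (simp add: t_def)
    have b: "\<bar>contrast_cov m (h n) u u k\<bar> \<le> C1 * t" "\<bar>contrast_cov m (h n) v v k\<bar> \<le> C2 * t"
      "\<bar>contrast_cov m (h n) (u + v) (u + v) k\<bar> \<le> C3 * t"
      using uu[OF k] vv[OF k] uv[OF k] by (simp_all add: s_def t_def)
    have Ct: "0 \<le> C1 * t" "0 \<le> C2 * t" "0 \<le> C3 * t" using C t by auto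
    have Dt: "D * t = C1 * t + C2 * t + C3 * t" by (simp add: D_def algebra_simps)
    have "contrast_cov m (h n) (u + v) (u + v) k
        = contrast_cov m (h n) u (u + v) k + contrast_cov m (h n) v (u + v) k"
      using contrast_cov_lin[of m "h n" 1 u 1 v "u + v" k] by simp
    also have "\<dots> = contrast_cov m (h n) (1 *\<^sub>R u + 1 *\<^sub>R v) u k + contrast_cov m (h n) (1 *\<^sub>R u + 1 *\<^sub>R v) v k"
      by (simp add: contrast_cov_sym[of m "h n" _ "u + v"])
    also have "\<dots> = contrast_cov m (h n) u u k + contrast_cov m (h n) v v k + 2 * contrast_cov m (h n) u v k"
      unfolding contrast_cov_lin by (simp add: contrast_cov_sym[of m "h n" v u])
    finally show "\<bar>contrast_cov m (h n) u u k\<bar> \<le> D * s n / (1 + real k)\<^sup>2"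
      "\<bar>contrast_cov m (h n) v v k\<bar> \<le> D * s n / (1 + real k)\<^sup>2"
      "\<bar>contrast_cov m (h n) u v k\<bar> \<le> D * s n / (1 + real k)\<^sup>2"
      using b Ct unfolding times_divide_eq_right[symmetric] t_def[symmetric] Dt by linarith+
  qed
  show ?thesis
  proof (rule regression_tendsto_0[where U = "\<lambda>n. contrast m (h n) u" and V = "\<lambda>n. contrast m (h n) v" and s = s and d = D and C = C
        and \<mu> = "\<lambda>n. contrast_cov m (h n) u v 0" and \<nu> = "\<lambda>n. contrast_cov m (h n) u u 0"
        and a = "\<lambda>n. 2 * (D * s n)\<^sup>2" and b = "\<lambda>n. 0"])
    show "contrast m (h n) u i \<in> Hspace" "contrast m (h n) v i \<in> Hspace" for n i
      by (rule contrast_in_Hspace[OF m])+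
    show "expectation (\<lambda>\<omega>. contrast m (h n) u i \<omega> * contrast m (h n) v i \<omega>) = contrast_cov m (h n) u v 0"
      "expectation (\<lambda>\<omega>. contrast m (h n) u i \<omega> * contrast m (h n) u i \<omega>) = contrast_cov m (h n) u u 0" for n i
      by (simp_all add: expectation_contrast_prod[OF m])
    show "(\<lambda>n. contrast_cov m (h n) u v 0 / s n) \<longlonglongrightarrow> 0"
      unfolding s_def h_def using filterlim_compose[OF lim(3) mesh_tendsto[OF \<epsilon>]] .
    show "(\<lambda>n. contrast_cov m (h n) u u 0 / s n) \<longlonglongrightarrow> C"
      unfolding s_def h_def using filterlim_compose[OF lim(1) mesh_tendsto[OF \<epsilon>]] .
    fix n i j :: nat assume ij: "i \<le> n" "j \<le> n"
    define k where "k = (i - j) + (j - i)"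
    have k: "k \<le> n" "\<bar>real i - real j\<bar> = real k" using lag[OF ij] by (auto simp: k_def)
    have k': "(j - i) + (i - j) = k" by (simp add: k_def)
    show "\<bar>expectation (\<lambda>\<omega>. contrast m (h n) u i \<omega> * contrast m (h n) u j \<omega>)\<bar>
        \<le> D * s n / (1 + \<bar>real i - real j\<bar>)\<^sup>2"
      unfolding k(2) expectation_contrast_prod[OF m] k_def[symmetric] using bd k by blast
    define l where "l = (1 + real k)\<^sup>2"
    have l: "l \<ge> 1" by (simp add: l_def)
    have prod: "x * y \<le> (D * s n)\<^sup>2 / l" if "\<bar>x\<bar> \<le> D * s n / l" "\<bar>y\<bar> \<le> D * s n / l" for x y
    proof -
      have "x * y \<le> \<bar>x\<bar> * \<bar>y\<bar>" by (metis abs_ge_self abs_mult)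
      also have "\<dots> \<le> (D * s n / l) * (D * s n / l)"
        using that by (intro mult_mono) (auto intro: order_trans[OF abs_ge_zero])
      also have "\<dots> = (D * s n)\<^sup>2 / (l * l)" by (simp add: power2_eq_square)
      also have "\<dots> \<le> (D * s n)\<^sup>2 / l"
        using l by (intro divide_left_mono) auto
      finally show ?thesis .
    qed
    have "contrast_cov m (h n) u u k * contrast_cov m (h n) v v k
        + contrast_cov m (h n) u v k * contrast_cov m (h n) v u k \<le> (D * s n)\<^sup>2 / l + (D * s n)\<^sup>2 / l"
      unfolding contrast_cov_sym[of m "h n" v u] using bd[OF k(1)] unfolding l_def[symmetric]
      by (intro add_mono prod) auto
    then show "expectation (\<lambda>\<omega>. contrast m (h n) u i \<omega> * contrast m (h n) u j \<omega>) * expectation (\<lambda>\<omega>. contrast m (h n) v i \<omega> * contrast m (h n) v j \<omega>)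
      + expectation (\<lambda>\<omega>. contrast m (h n) u i \<omega> * contrast m (h n) v j \<omega>) * expectation (\<lambda>\<omega>. contrast m (h n) v i \<omega> * contrast m (h n) u j \<omega>)
      \<le> 2 * (D * s n)\<^sup>2 / (1 + \<bar>real i - real j\<bar>)\<^sup>2 + 0"
      unfolding k(2) expectation_contrast_prod[OF m] k_def[symmetric] l_def by simp
  next
    have "(\<lambda>n. 2 * D\<^sup>2 * inverse (real (Suc n))) \<longlonglongrightarrow> 2 * D\<^sup>2 * 0"
      by (intro tendsto_intros LIMSEQ_inverse_real_of_nat)
    moreover have "2 * (D * s n)\<^sup>2 / real (Suc n) / (s n)\<^sup>2 = 2 * D\<^sup>2 * inverse (real (Suc n))" for n
      using s[of n] by (simp add: power_mult_distrib divide_inverse)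
    ultimately show "(\<lambda>n. 2 * (D * s n)\<^sup>2 / real (Suc n) / (s n)\<^sup>2) \<longlonglongrightarrow> 0" by simp
  qed (use lim(2) s \<delta> in simp_all)
qed

end


section \<open>Consistency\<close>

text \<open>The contrast as a functional of an observed path, with \<open>\<phi>\<close> selecting a
  scalar from the observation. An estimator has to be such a functional and may not refer to the
  parameter.\<close>

definition path_contrast ::
  "nat \<Rightarrow> real \<Rightarrow> real ^ 'd \<Rightarrow> ('z \<Rightarrow> real) \<Rightarrow> nat \<Rightarrow> (real ^ 'd \<Rightarrow> 'z) \<Rightarrow> real" where
  "path_contrast m h e \<phi> i p = (fdiff h ^^ m) (\<lambda>x. \<phi> (p (x *\<^sub>R e))) (real i * h)"

lemma measurable_path_contrast:
  fixes \<phi> :: "'z::topological_space \<Rightarrow> real"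
  assumes \<phi>: "\<phi> \<in> borel_measurable borel" and S: "\<And>j. j \<le> m \<Longrightarrow> (real i * h + real j * h) *\<^sub>R e \<in> S"
  shows "path_contrast m h e \<phi> i \<in> borel_measurable (PiM S (\<lambda>_. borel))"
  unfolding path_contrast_def[abs_def] fdiff_funpow_sum
proof (intro borel_measurable_sum borel_measurable_times borel_measurable_const)
  fix j assume "j \<in> {..m}"
  then have "(\<lambda>p. p ((real i * h + real j * h) *\<^sub>R e)) \<in> PiM S (\<lambda>_. borel) \<rightarrow>\<^sub>M (borel :: 'z measure)"
    using S by (intro measurable_component_singleton) auto
  then show "(\<lambda>p. \<phi> (p ((real i * h + real j * h) *\<^sub>R e))) \<in> borel_measurable (PiM S (\<lambda>_. borel))"
    using \<phi> by (rule measurable_compose)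
qed

lemma path_contrast_restrict:
  assumes "\<And>j. j \<le> m \<Longrightarrow> (real i * h + real j * h) *\<^sub>R e \<in> S"
  shows "path_contrast m h e \<phi> i (restrict p S) = path_contrast m h e \<phi> i p"
  unfolding path_contrast_def using assms by (intro fdiff_funpow_cong) auto

lemma sample_mean_prod_cong:
  assumes "\<And>i. i < n \<Longrightarrow> U i \<omega> = U' i \<omega>'" "\<And>i. i < n \<Longrightarrow> V i \<omega> = V' i \<omega>'"
  shows "sample_mean_prod U V n \<omega> = sample_mean_prod U' V' n \<omega>'"
  unfolding sample_mean_prod_def using assms by (auto intro!: arg_cong2[where f = "(/)"] sum.cong)

lemma measurable_sample_mean_prod:
  assumes "\<And>i. i < n \<Longrightarrow> U i \<in> borel_measurable N" "\<And>i. i < n \<Longrightarrow> V i \<in> borel_measurable N"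
  shows "sample_mean_prod U V n \<in> borel_measurable N"
  unfolding sample_mean_prod_def[abs_def] using assms by (intro borel_measurable_divide borel_measurable_sum borel_measurable_times) auto

definition embed3 :: "real ^ 2 \<Rightarrow> real ^ 3" where
  "embed3 v = v $ 1 *\<^sub>R axis 1 1 + v $ 2 *\<^sub>R axis 2 1"

lemma embed3_lin: "embed3 (a *\<^sub>R v + b *\<^sub>R w) = a *\<^sub>R embed3 v + b *\<^sub>R embed3 w"
  by (simp add: embed3_def algebra_simps)

lemma vfield_axis: "vfield X (axis k 1) s \<omega> = X k s \<omega>"
proof -
  have "vfield X (axis k 1) s \<omega> = (\<Sum>l\<in>{k}. axis k 1 $ l * X l s \<omega>)"
    unfolding vfield_def by (intro sum.mono_neutral_right) (auto simp: axis_def)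
  then show ?thesis by simp
qed

lemma vfield_embed3: "vfield X (embed3 v) s \<omega> = lin_comb_field v X s \<omega>"
  by (simp add: embed3_def vfield_lin vfield_axis lin_comb_field_def)

theorem theorem8:
  fixes M :: "'w measure"
    and X :: "3 \<Rightarrow> real ^ 'd \<Rightarrow> 'w \<Rightarrow> real"
    and K :: "real ^ 'd \<Rightarrow> real ^ 3 ^ 3"
    and L :: real
    and \<alpha> :: "3 \<Rightarrow> 3 \<Rightarrow> real"
    and \<alpha>vv \<alpha>v3 :: "real ^ 2 \<Rightarrow> real"
  assumes "prob_space M"
    and "gaussian_field M X"
    and "stationary_with_cov M X K"
    and "strictly_pos_def K"
    and "L > 0"
    and "\<And>u k l. K u $ k $ l = K u $ l $ k"
    and "\<And>k l. \<exists>c. (k = l \<longrightarrow> c \<noteq> 0) \<and> condition_Ad L c (\<alpha> k l) (\<lambda>u. K u $ k $ l)"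
    and "\<And>v. v \<noteq> 0 \<Longrightarrow> \<exists>c. c \<noteq> 0 \<and>
           condition_Ad L c (\<alpha>vv v) (cross_cov_fun M (lin_comb_field v X) (lin_comb_field v X))"
    and "\<And>v. v \<noteq> 0 \<Longrightarrow> \<exists>c.
           condition_Ad L c (\<alpha>v3 v) (cross_cov_fun M (lin_comb_field v X) (X 3))"
    and "\<And>v. v \<noteq> 0 \<Longrightarrow> \<alpha>vv v < min (\<alpha>v3 v) (\<alpha> 3 3 + 1)"
  shows "consistently_estimable M (cube L)
           (\<lambda>\<beta> s \<omega>. (response \<beta> X s \<omega>, X 1 s \<omega>, X 2 s \<omega>))"
proof -
  \<comment> \<open>Any coordinate direction would do; it has to be a coordinate axis because the
    derivatives in \<open>condition_Ad\<close> are taken along these.\<close>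
  define e where "e = (axis undefined 1 :: real ^ 'd)"
  interpret prob_space M by fact
  interpret stationary_gaussian M X K e
    by unfold_locales (fact assms)+
  define e3 where "e3 = (axis 3 1 :: real ^ 3)"
  have fields: "vfield X (embed3 v) = lin_comb_field v X" "vfield X e3 = X 3" for v
    by (simp_all add: fun_eq_iff vfield_embed3 vfield_axis e3_def)
  have cross: "cross_cov_fun M (vfield X v) (vfield X w) = vcov v w" for v w
    by (simp add: fun_eq_iff cross_cov_fun_def cov_vfield)

  \<comment> \<open>Local expansions of the covariances along the axis\<close>
  have line: "local_power c a (line_cov v w)" if "condition_Ad L c a (vcov v w)" for c a v w
    unfolding line_cov_def[abs_def]
    using condition_Ad_line[OF that \<open>L > 0\<close> vcov_even, of undefined] by (simp only: e_def[symmetric])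
  have lp_vv: "\<exists>c. c \<noteq> 0 \<and> local_power c (\<alpha>vv v) (line_cov (embed3 v) (embed3 v))" if "v \<noteq> 0" for v
    using assms(8)[OF that] line unfolding fields(1)[symmetric] cross by blast
  have lp_v3: "\<exists>c. local_power c (\<alpha>v3 v) (line_cov (embed3 v) e3)" if "v \<noteq> 0" for v
    using assms(9)[OF that] line unfolding fields[symmetric] cross by blast
  have lp_33: "\<exists>c. local_power c (\<alpha> 3 3) (line_cov e3 e3)"
  proof -
    have "(\<lambda>u. K u $ 3 $ 3) = cross_cov_fun M (vfield X e3) (vfield X e3)"
      unfolding fields cross_cov_fun_def using assms(3) unfolding stationary_with_cov_def
      by (metis add.left_neutral)
    then show ?thesis using assms(7)[of 3 3] line[of _ "\<alpha> 3 3" e3 e3] unfolding cross by auto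
  qed
  have pos: "\<alpha>vv v > 0" "\<alpha>v3 v > 0" "\<alpha> 3 3 > 0" if "v \<noteq> 0" for v
    using lp_vv[OF that] lp_v3[OF that] lp_33 by (auto simp: local_power_def)
  have lt: "\<alpha>vv v < \<alpha>v3 v" "\<alpha>vv v < \<alpha> 3 3 + 1" if "v \<noteq> 0" for v
    using assms(10)[OF that] by auto
  have "\<alpha> 3 3 > 0" using lp_33 by (auto simp: local_power_def)
  \<comment> \<open>Since \<open>\<alpha>vv\<close> is below \<open>\<alpha> 3 3 + 1\<close>, this
    gives \<open>2 * m\<close> at least 2 more than the exponents of the regressors and of the
    error, as the decay bounds require.\<close>
  define m where "m = nat \<lceil>\<alpha> 3 3 + 3\<rceil>"
  have m3: "\<alpha> 3 3 + 3 \<le> real m"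
    unfolding m_def by linarith
  then have m: "m > 0" using \<open>\<alpha> 3 3 > 0\<close> by (cases m) auto

  \<comment> \<open>Positive limits of the scaled contrast variances\<close>
  have lim: "\<exists>C>0. ((\<lambda>h. contrast_cov m h (embed3 v) (embed3 v) 0 / h powr \<alpha>vv v) \<longlongrightarrow> C) (at_right 0)"
    if v: "v \<noteq> 0" for v
  proof -
    obtain c where c: "c \<noteq> 0" "local_power c (\<alpha>vv v) (line_cov (embed3 v) (embed3 v))"
      using lp_vv[OF v] by blast
    define C where "C = (-1) ^ m * (c * power_const m (\<alpha>vv v))"
    have l: "((\<lambda>h. contrast_cov m h (embed3 v) (embed3 v) 0 / h powr \<alpha>vv v) \<longlongrightarrow> C) (at_right 0)"
      unfolding C_def using lt[OF v] m3 by (intro contrast_cov_limit c) linarith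
    have "power_const m (\<alpha>vv v) \<noteq> 0"
      using c(2) m by (intro power_const_nonzero) (auto simp: local_power_def)
    then have "C \<noteq> 0" using c by (simp add: C_def)
    \<comment> \<open>The sign is read off from the nonnegative variances; the signs of
      \<open>c\<close> and of the power constant need not be known.\<close>
    moreover have "C \<ge> 0"
      using l by (rule tendsto_lowerbound) (auto intro!: always_eventually divide_nonneg_nonneg contrast_cov_nonneg[OF m])
    ultimately show ?thesis using l by (intro exI[of _ C]) auto
  qed

  \<comment> \<open>Choice of the two regression directions\<close>
  obtain v w :: "real ^ 2" where v: "v \<noteq> 0" and w: "w \<noteq> 0" and vw: "v + w \<noteq> 0"
    and le: "\<alpha>vv v \<le> \<alpha>vv w" "\<alpha>vv v \<le> \<alpha>vv (v + w)"
    and basis: "\<And>\<beta>. \<exists>b c. \<beta> = b *\<^sub>R v + c *\<^sub>R w"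
    and lim_vw: "((\<lambda>h. contrast_cov m h (embed3 v) (embed3 w) 0 / h powr \<alpha>vv v) \<longlongrightarrow> 0) (at_right 0)"
  proof (rule regression_basis[of "\<lambda>h v w. contrast_cov m h (embed3 v) (embed3 w) 0" \<alpha>vv])
    show "contrast_cov m h (embed3 (a *\<^sub>R v + b *\<^sub>R w)) (embed3 u) 0
        = a * contrast_cov m h (embed3 v) (embed3 u) 0 + b * contrast_cov m h (embed3 w) (embed3 u) 0" for h a b v w u
      unfolding embed3_lin contrast_cov_lin ..
    show "\<exists>C. C \<noteq> 0 \<and> ((\<lambda>h. contrast_cov m h (embed3 v) (embed3 v) 0 / h powr \<alpha>vv v) \<longlongrightarrow> C) (at_right 0)" if "v \<noteq> 0" for v
      using lim[OF that] by (metis less_irrefl)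
  qed (auto intro: contrast_cov_sym contrast_cov_nonneg[OF m])

  \<comment> \<open>Covariance bounds on one common segment\<close>
  define P where "P \<epsilon> a u u' \<longleftrightarrow> (\<exists>C\<ge>0. \<forall>h k. h > 0 \<longrightarrow> (real k + real m) * h \<le> \<epsilon> \<longrightarrow>
    \<bar>contrast_cov m h u u' k\<bar> \<le> C * h powr a / (1 + real k)\<^sup>2)" for \<epsilon> a u u'
  \<comment> \<open>No upper bound on \<open>\<alpha>v3\<close> is assumed, while contrasts of order
    \<open>m\<close> show decay only up to the exponent \<open>2 * m - 2\<close>. The truncated
    exponent still exceeds \<open>\<alpha>vv\<close>.\<close>
  define d where "d u = min (\<alpha>v3 u) (2 * real m - 2)" for u
  have d: "\<alpha>vv u < d u" "0 < d u" if "u \<noteq> 0" for u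
    using lt[OF that] pos[OF that] m3 by (auto simp: d_def)
  have P_decay: "\<forall>\<^sub>F \<epsilon> in at_right 0. P \<epsilon> a u u'"
    if "local_power c \<gamma> (line_cov u u')" "0 < a" "a \<le> \<gamma>" "a + 2 \<le> 2 * real m" for c \<gamma> a u u'
    unfolding P_def using that by (rule contrast_cov_decay)
  have P_vv: "\<forall>\<^sub>F \<epsilon> in at_right 0. P \<epsilon> a (embed3 u) (embed3 u)"
    if u: "u \<noteq> 0" and a: "0 < a" "a \<le> \<alpha>vv u" for a u
  proof -
    obtain c where "local_power c (\<alpha>vv u) (line_cov (embed3 u) (embed3 u))"
      using lp_vv[OF u] by blast
    then show ?thesis using a by (rule P_decay) (use a lt[OF u] m3 in linarith)
  qed
  have P_v3: "\<forall>\<^sub>F \<epsilon> in at_right 0. P \<epsilon> (d u) (embed3 u) e3" if u: "u \<noteq> 0" for u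
  proof -
    obtain c where "local_power c (\<alpha>v3 u) (line_cov (embed3 u) e3)"
      using lp_v3[OF u] by blast
    then show ?thesis using d(2)[OF u] by (rule P_decay) (simp_all add: d_def)
  qed
  have P_33: "\<forall>\<^sub>F \<epsilon> in at_right 0. P \<epsilon> (\<alpha> 3 3) e3 e3"
  proof -
    obtain c where "local_power c (\<alpha> 3 3) (line_cov e3 e3)"
      using lp_33 by blast
    then show ?thesis using \<open>\<alpha> 3 3 > 0\<close> by (rule P_decay) (use m3 \<open>\<alpha> 3 3 > 0\<close> in linarith)+
  qed
  \<comment> \<open>The direction \<open>w\<close> occurs at two rates: at that of \<open>v\<close>
    when it disturbs the regression on \<open>v\<close>, and at its own when it is the
    regressor.\<close>
  have "\<forall>\<^sub>F \<epsilon> in at_right 0. \<epsilon> > 0 \<and> \<epsilon> \<le> L \<and> P \<epsilon> (\<alpha>vv v) (embed3 v) (embed3 v)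
      \<and> P \<epsilon> (\<alpha>vv v) (embed3 w) (embed3 w) \<and> P \<epsilon> (\<alpha>vv v) (embed3 (v + w)) (embed3 (v + w))
      \<and> P \<epsilon> (\<alpha>vv w) (embed3 w) (embed3 w) \<and> P \<epsilon> (d v) (embed3 v) e3 \<and> P \<epsilon> (d w) (embed3 w) e3
      \<and> P \<epsilon> (\<alpha> 3 3) e3 e3"
    using v w vw le pos
    by (intro eventually_conj P_vv P_v3 P_33) (auto intro!: eventually_at_rightI[of 0 L] \<open>L > 0\<close>)
  then obtain \<epsilon> where \<epsilon>: "\<epsilon> > 0" "\<epsilon> \<le> L" and P: "P \<epsilon> (\<alpha>vv v) (embed3 v) (embed3 v)"
      "P \<epsilon> (\<alpha>vv v) (embed3 w) (embed3 w)" "P \<epsilon> (\<alpha>vv v) (embed3 (v + w)) (embed3 (v + w))"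
      "P \<epsilon> (\<alpha>vv w) (embed3 w) (embed3 w)" "P \<epsilon> (d v) (embed3 v) e3" "P \<epsilon> (d w) (embed3 w) e3"
      "P \<epsilon> (\<alpha> 3 3) e3 e3"
    using eventually_happens'[OF trivial_limit_at_right_real] by blast
  define h where "h = mesh \<epsilon> m"
  have bound: "\<exists>C\<ge>0. \<forall>n k. k \<le> n \<longrightarrow> \<bar>contrast_cov m (mesh \<epsilon> m n) u u' k\<bar> \<le> C * mesh \<epsilon> m n powr a / (1 + real k)\<^sup>2"
    if "P \<epsilon> a u u'" for a u u'
    using that mesh_pos[OF \<epsilon>(1)] mesh_le[OF \<epsilon>(1)] unfolding P_def by meson
  define S where "S u u' n = sample_mean_prod (contrast m (h n) u) (contrast m (h n) u') (Suc n)" for u u' n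

  \<comment> \<open>Ratios of the empirical second moments\<close>
  have lim_vw_ratio: "(\<lambda>n. prob {\<omega> \<in> space M. \<delta> * S (embed3 v) (embed3 v) n \<omega> \<le> \<bar>S (embed3 v) (embed3 w) n \<omega>\<bar>}) \<longlonglongrightarrow> 0"
    if \<delta>: "\<delta> > 0" for \<delta>
  proof -
    obtain C where C: "C > 0" "((\<lambda>h. contrast_cov m h (embed3 v) (embed3 v) 0 / h powr \<alpha>vv v) \<longlongrightarrow> C) (at_right 0)"
      using lim[OF v] by blast
    obtain C1 where C1: "C1 \<ge> 0" "\<And>n k. k \<le> n \<Longrightarrow> \<bar>contrast_cov m (mesh \<epsilon> m n) (embed3 v) (embed3 v) k\<bar> \<le> C1 * mesh \<epsilon> m n powr \<alpha>vv v / (1 + real k)\<^sup>2"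
      using bound[OF P(1)] by blast
    obtain C2 where C2: "C2 \<ge> 0" "\<And>n k. k \<le> n \<Longrightarrow> \<bar>contrast_cov m (mesh \<epsilon> m n) (embed3 w) (embed3 w) k\<bar> \<le> C2 * mesh \<epsilon> m n powr \<alpha>vv v / (1 + real k)\<^sup>2"
      using bound[OF P(2)] by blast
    have "embed3 (v + w) = embed3 v + embed3 w" using embed3_lin[of 1 v 1 w] by simp
    then obtain C3 where C3: "C3 \<ge> 0" "\<And>n k. k \<le> n \<Longrightarrow> \<bar>contrast_cov m (mesh \<epsilon> m n) (embed3 v + embed3 w) (embed3 v + embed3 w) k\<bar> \<le> C3 * mesh \<epsilon> m n powr \<alpha>vv v / (1 + real k)\<^sup>2"
      using bound[OF P(3)] by auto
    show ?thesis
      unfolding S_def h_def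
      by (rule regression_nuisance_tendsto_0[OF m \<epsilon>(1) \<delta> C(2,1) lim_vw C1(2) C2(2) C3(2) C1(1) C2(1) C3(1)])
  qed
  have lim_u3_ratio: "(\<lambda>n. prob {\<omega> \<in> space M. \<delta> * S (embed3 u) (embed3 u) n \<omega> \<le> \<bar>S (embed3 u) e3 n \<omega>\<bar>}) \<longlonglongrightarrow> 0"
    if u: "u \<noteq> 0" and Pu: "P \<epsilon> (\<alpha>vv u) (embed3 u) (embed3 u)" "P \<epsilon> (d u) (embed3 u) e3" and \<delta>: "\<delta> > 0" for \<delta> u
  proof -
    obtain C where C: "C > 0" "((\<lambda>h. contrast_cov m h (embed3 u) (embed3 u) 0 / h powr \<alpha>vv u) \<longlongrightarrow> C) (at_right 0)"
      using lim[OF u] by blast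
    obtain C1 where C1: "C1 \<ge> 0" "\<And>n k. k \<le> n \<Longrightarrow> \<bar>contrast_cov m (mesh \<epsilon> m n) (embed3 u) (embed3 u) k\<bar> \<le> C1 * mesh \<epsilon> m n powr \<alpha>vv u / (1 + real k)\<^sup>2"
      using bound[OF Pu(1)] by blast
    obtain C2 where C2: "C2 \<ge> 0" "\<And>n k. k \<le> n \<Longrightarrow> \<bar>contrast_cov m (mesh \<epsilon> m n) e3 e3 k\<bar> \<le> C2 * mesh \<epsilon> m n powr \<alpha> 3 3 / (1 + real k)\<^sup>2"
      using bound[OF P(7)] by blast
    obtain C3 where C3: "C3 \<ge> 0" "\<And>n k. k \<le> n \<Longrightarrow> \<bar>contrast_cov m (mesh \<epsilon> m n) (embed3 u) e3 k\<bar> \<le> C3 * mesh \<epsilon> m n powr d u / (1 + real k)\<^sup>2"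
      using bound[OF Pu(2)] by blast
    show ?thesis
      unfolding S_def h_def
      by (rule regression_error_tendsto_0[OF m \<epsilon>(1) \<delta> C(2,1) C1(2) C2(2) C3(2) C1(1) C2(1) C3(1) lt(2)[OF u] d(1)[OF u]])
  qed
  have meas_S: "S u u' n \<in> borel_measurable M" for u u' n
  proof -
    interpret H: gaussian_space M Hspace by (rule gaussian_space)
    have "contrast m (h n) u i \<in> borel_measurable M" for u i
      by (rule H.meas[OF contrast_in_Hspace[OF m]])
    then show ?thesis unfolding S_def by (intro measurable_sample_mean_prod)
  qed
  have S_nonneg: "S u u n \<omega> \<ge> 0" for u n \<omega>
    unfolding S_def sample_mean_prod_def by (intro divide_nonneg_nonneg sum_nonneg) simp_all
  obtain k :: "nat \<Rightarrow> nat" where k: "\<And>b c \<delta>. \<delta> > 0 \<Longrightarrow>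
    \<exists>E. (\<forall>n. E n \<in> events) \<and> (\<lambda>n. prob (E n)) \<longlonglongrightarrow> 0 \<and>
      (\<forall>\<^sub>F n in sequentially. \<forall>\<omega>\<in>space M - E n.
        let b' = (b * S (embed3 v) (embed3 v) (k n) \<omega> + c * S (embed3 v) (embed3 w) (k n) \<omega> + S (embed3 v) e3 (k n) \<omega>)
              / S (embed3 v) (embed3 v) (k n) \<omega>;
            c' = (b * S (embed3 v) (embed3 w) n \<omega> + c * S (embed3 w) (embed3 w) n \<omega> + S (embed3 w) e3 n \<omega>
              - b' * S (embed3 v) (embed3 w) n \<omega>) / S (embed3 w) (embed3 w) n \<omega>
        in \<bar>b' - b\<bar> \<le> \<delta> \<and> \<bar>c' - c\<bar> \<le> \<delta>)"
    by (rule two_stage_regression[of "S (embed3 v) (embed3 v)" "S (embed3 w) (embed3 w)" "S (embed3 v) (embed3 w)"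
          "S (embed3 v) e3" "S (embed3 w) e3", OF meas_S meas_S meas_S meas_S meas_S S_nonneg S_nonneg
          lim_vw_ratio lim_u3_ratio[OF v P(1,5)] lim_u3_ratio[OF w P(4,6)]], assumption+) (erule that)

  \<comment> \<open>The estimators as measurable functions of the observed path\<close>
  define \<phi> where "\<phi> u z = u $ 1 * fst (snd z) + u $ 2 * snd (snd z)" for u :: "real ^ 2" and z :: "real \<times> real \<times> real"
  define Y where "Y n = path_contrast m (h n) e (fst :: real \<times> real \<times> real \<Rightarrow> real)" for n
  define Z where "Z u n = path_contrast m (h n) e (\<phi> u)" for u n
  define T where "T u u' n = sample_mean_prod (Z u n) (Z u' n) (Suc n)" for u u' n
  define R where "R u n = sample_mean_prod (Z u n) (Y n) (Suc n)" for u n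
  \<comment> \<open>The first coefficient uses the finer grid \<open>k n\<close>; the second comes
    from the regression on the grid \<open>n\<close>, after the fitted part along \<open>v\<close>
    has been removed.\<close>
  define b' where "b' n p = R v (k n) p / T v v (k n) p" for n p
  define c' where "c' n p = (R w n p - b' n p * T v w n p) / T w w n p" for n p
  define f where "f n p = b' n p *\<^sub>R v + c' n p *\<^sub>R w" for n p
  have in_cube: "(real i * h n + real j * h n) *\<^sub>R e \<in> cube L" if "i < Suc n" "j \<le> m" for i j n
  proof -
    have "(real i + real j) * h n \<le> (real n + real m) * h n"
      using that mesh_pos[OF \<epsilon>(1), of m n] by (intro mult_right_mono) (auto simp: h_def)
    also have "\<dots> \<le> \<epsilon>" unfolding h_def using \<epsilon>(1) by (rule mesh_le) simp
    finally have "real i * h n + real j * h n \<le> L" using \<epsilon> by (simp add: algebra_simps)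
    moreover have "0 \<le> real i * h n + real j * h n"
      using mesh_pos[OF \<epsilon>(1), of m n] by (auto simp: h_def)
    ultimately show ?thesis
      using \<open>L > 0\<close> by (auto simp: cube_def e_def axis_def)
  qed
  have \<phi>_meas: "\<phi> u \<in> borel_measurable borel" for u
    unfolding \<phi>_def[abs_def] by (intro borel_measurable_continuous_onI continuous_intros)
  have fst_meas: "(fst :: real \<times> real \<times> real \<Rightarrow> real) \<in> borel_measurable borel"
    by (intro borel_measurable_continuous_onI continuous_intros)
  let ?N = "PiM (cube L :: (real ^ 'd) set) (\<lambda>_. borel :: (real \<times> real \<times> real) measure)"
  have Z_meas: "Z u n i \<in> borel_measurable ?N" and Y_meas: "Y n i \<in> borel_measurable ?N"
    if "i < Suc n" for u n i
    unfolding Z_def Y_def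
    by (rule measurable_path_contrast[OF \<phi>_meas in_cube[OF that]]
        measurable_path_contrast[OF fst_meas in_cube[OF that]]; assumption)+
  have TR_meas: "T u u' n \<in> borel_measurable ?N" "R u n \<in> borel_measurable ?N" for u u' n
    unfolding T_def R_def by (rule measurable_sample_mean_prod; (rule Z_meas | rule Y_meas); assumption)+
  have f_meas: "f n \<in> borel_measurable ?N" for n
    unfolding f_def[abs_def] c'_def b'_def
    by (intro borel_measurable_add borel_measurable_scaleR borel_measurable_divide borel_measurable_diff
        borel_measurable_times TR_meas borel_measurable_const)

  \<comment> \<open>Convergence in probability for every parameter\<close>
  have conv: "tendsto_in_prob M (\<lambda>n \<omega>. f n (\<lambda>s\<in>cube L. (response \<beta> X s \<omega>, X 1 s \<omega>, X 2 s \<omega>))) \<beta>" for \<beta>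
    unfolding tendsto_in_prob_def
  proof (intro allI impI)
    fix \<delta> :: real assume "\<delta> > 0"
    obtain b c where bc: "\<beta> = b *\<^sub>R v + c *\<^sub>R w" using basis by blast
    define p where "p \<omega> = (\<lambda>s. (response \<beta> X s \<omega>, X 1 s \<omega>, X 2 s \<omega>))" for \<omega>
    define q where "q \<omega> = restrict (p \<omega>) (cube L)" for \<omega>
    have Zq: "Z u n i (q \<omega>) = contrast m (h n) (embed3 u) i \<omega>" if "i < Suc n" for u n i \<omega>
    proof -
      have "Z u n i (q \<omega>) = Z u n i (p \<omega>)"
        unfolding Z_def q_def by (intro path_contrast_restrict in_cube[OF that])
      also have "\<dots> = contrast m (h n) (embed3 u) i \<omega>"
        by (simp add: Z_def path_contrast_def contrast_def p_def \<phi>_def vfield_embed3 lin_comb_field_def)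
      finally show ?thesis .
    qed
    have Yq: "Y n i (q \<omega>) = b * contrast m (h n) (embed3 v) i \<omega> + c * contrast m (h n) (embed3 w) i \<omega>
        + contrast m (h n) e3 i \<omega>" if "i < Suc n" for n i \<omega>
    proof -
      \<comment> \<open>In the chosen basis the response has coefficients \<open>b\<close>,
        \<open>c\<close> and error coefficient 1. Thus the moments \<open>R\<close> of the data are
        the numerators in \<open>two_stage_regression\<close>.\<close>
      have resp: "response \<beta> X s \<omega> = vfield X (1 *\<^sub>R (b *\<^sub>R embed3 v + c *\<^sub>R embed3 w) + 1 *\<^sub>R e3) s \<omega>" for s
        unfolding embed3_lin[symmetric] bc[symmetric] vfield_lin[of _ 1 "embed3 \<beta>"] vfield_embed3 fields(2)
        by (simp add: response_def lin_comb_field_def)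
      have "Y n i (q \<omega>) = Y n i (p \<omega>)"
        unfolding Y_def q_def by (intro path_contrast_restrict in_cube[OF that])
      also have "\<dots> = contrast m (h n) (1 *\<^sub>R (b *\<^sub>R embed3 v + c *\<^sub>R embed3 w) + 1 *\<^sub>R e3) i \<omega>"
        unfolding Y_def path_contrast_def contrast_def p_def by (simp only: fst_conv resp)
      finally show ?thesis unfolding contrast_lin by simp
    qed
    have Tq: "T u u' n (q \<omega>) = S (embed3 u) (embed3 u') n \<omega>" for u u' n \<omega>
      unfolding T_def S_def by (intro sample_mean_prod_cong Zq)
    have Rq: "R u n (q \<omega>) = b * S (embed3 u) (embed3 v) n \<omega> + c * S (embed3 u) (embed3 w) n \<omega> + S (embed3 u) e3 n \<omega>"
      for u n \<omega>
    proof -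
      have "R u n (q \<omega>) = (\<Sum>i<Suc n. contrast m (h n) (embed3 u) i \<omega> *
          (b * contrast m (h n) (embed3 v) i \<omega> + c * contrast m (h n) (embed3 w) i \<omega> + contrast m (h n) e3 i \<omega>)) / real (Suc n)"
        unfolding R_def sample_mean_prod_def
        by (intro arg_cong2[where f = "(/)"] sum.cong refl) (simp only: Zq Yq lessThan_iff)
      also have "\<dots> = b * S (embed3 u) (embed3 v) n \<omega> + c * S (embed3 u) (embed3 w) n \<omega> + S (embed3 u) e3 n \<omega>"
        unfolding S_def sample_mean_prod_def times_divide_eq_right add_divide_distrib[symmetric]
          sum_distrib_left sum.distrib[symmetric]
        by (intro arg_cong2[where f = "(/)"] sum.cong refl) (simp add: algebra_simps)
      finally show ?thesis .
    qed
    have S_sym: "S (embed3 w) (embed3 v) n \<omega> = S (embed3 v) (embed3 w) n \<omega>" for n \<omega>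
      by (simp add: S_def sample_mean_prod_def mult.commute)
    define \<eta> where "\<eta> = \<delta> / (norm v + norm w + 1)"
    have nz: "norm v + norm w + 1 > 0"
      by (intro add_nonneg_pos add_nonneg_nonneg) auto
    then have \<eta>: "\<eta> > 0" using \<open>\<delta> > 0\<close> by (simp add: \<eta>_def)
    obtain E where E: "\<And>n. E n \<in> events" "(\<lambda>n. prob (E n)) \<longlonglongrightarrow> 0"
      "\<forall>\<^sub>F n in sequentially. \<forall>\<omega>\<in>space M - E n. \<bar>b' n (q \<omega>) - b\<bar> \<le> \<eta> \<and> \<bar>c' n (q \<omega>) - c\<bar> \<le> \<eta>"
      using k[OF \<eta>, of b c] unfolding Let_def b'_def c'_def Rq Tq S_sym by blast
    have "\<forall>\<^sub>F n in sequentially. prob {\<omega> \<in> space M. dist (f n (q \<omega>)) \<beta> > \<delta>} \<le> prob (E n)"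
      using E(3)
    proof eventually_elim
      case (elim n)
      have "dist (f n (q \<omega>)) \<beta> \<le> \<delta>" if "\<omega> \<in> space M - E n" for \<omega>
      proof -
        have "f n (q \<omega>) - \<beta> = (b' n (q \<omega>) - b) *\<^sub>R v + (c' n (q \<omega>) - c) *\<^sub>R w"
          by (simp add: f_def bc algebra_simps)
        then have "dist (f n (q \<omega>)) \<beta> \<le> \<bar>b' n (q \<omega>) - b\<bar> * norm v + \<bar>c' n (q \<omega>) - c\<bar> * norm w"
          unfolding dist_norm by (metis norm_scaleR norm_triangle_ineq)
        also have "\<dots> \<le> \<eta> * norm v + \<eta> * norm w"
          using elim that by (intro add_mono mult_right_mono) auto
        also have "\<dots> \<le> \<eta> * (norm v + norm w + 1)"
          using \<eta> by (simp add: algebra_simps)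
        also have "\<dots> = \<delta>" using nz by (simp add: \<eta>_def)
        finally show ?thesis .
      qed
      then have "{\<omega> \<in> space M. dist (f n (q \<omega>)) \<beta> > \<delta>} \<subseteq> E n"
        by (auto simp: not_less[symmetric])
      then show ?case using E(1) by (intro finite_measure_mono)
    qed
    then have "(\<lambda>n. prob {\<omega> \<in> space M. dist (f n (q \<omega>)) \<beta> > \<delta>}) \<longlonglongrightarrow> 0"
      by (rule tendsto_sandwich[OF _ _ tendsto_const E(2), rotated]) simp
    then show "(\<lambda>n. prob {\<omega> \<in> space M. dist (f n (\<lambda>s\<in>cube L. (response \<beta> X s \<omega>, X 1 s \<omega>, X 2 s \<omega>))) \<beta> > \<delta>}) \<longlonglongrightarrow> 0"
      by (simp add: q_def p_def)
  qed
  show ?thesis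
    unfolding consistently_estimable_def using f_meas conv by blast
qed

end
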